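(* Let $R$ be a valuation domain with maximal ideal $P$. Assume that there exists a finite family of prime ideals $P=L_0\supset L_1\supset\dots\supset L_{m-1}\supset L_m=0$ such that $R_{L_k}/L_{k+1}$ is almost maximal for all $k$, $0\leq k\leq m-1$. Let $G$ be a torsion-free $R$-module of finite rank. Then $G$ has a chain of pure submodules $$0=G_0\subseteq G_1\subseteq\dots\subseteq G_{m-1}\subseteq G_m\subseteq G_{m+1}=G$$ where $G_{j+1}/G_j$ is a finite direct sum of ideals of $R_{L_j}$ (up to isomorphism), for every $j$, $0\leq j\leq m$.
   Context: The symbol $\supset$ denotes strict inclusion. A valuation domain $S$ is almost maximal if $S/A$ is linearly compact in the discrete topology for every nonzero ideal $A$ of $S$. If $L'\subset L$ are primes of a valuation domain $R$, then $L'$ is also a prime ideal of $R_L$, so that $R_L/L'$ makes sense. The rank of a torsion-free $R$-module $M$ is $\dim_Q(Q\otimes_R M)$, where $Q$ is the field of quotients of $R$. The paper calls a chain of pure submodules as in the claim a pure-composition series. *)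

theory Defs
  imports "HOL-Algebra.QuotRing" "HOL-Algebra.Free_Abelian_Groups"
    "Jordan_Normal_Form.Missing_VectorSpace"
begin

section \<open>Modules\<close>

text \<open>
  A record of type \<open>module\<close> extends \<open>ring\<close>, but the locale \<open>module\<close> ignores the fields
  \<open>mult\<close> and \<open>one\<close>.  They are left undefined in the modules constructed below.
\<close>

text \<open>A ring \<open>B\<close> as a module over the domain of a ring homomorphism \<open>\<phi>\<close> into \<open>B\<close>.\<close>

definition module_via :: "('a \<Rightarrow> 'b) \<Rightarrow> ('b, 'c) ring_scheme \<Rightarrow> ('a, 'b) module" where
  "module_via \<phi> B =
    \<lparr>carrier = carrier B, monoid.mult = monoid.mult B, one = one B, ring.zero = ring.zero B, add = add B,
     smult = (\<lambda>r x. \<phi> r \<otimes>\<^bsub>B\<^esub> x)\<rparr>"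

definition quotient_module ::
  "('a, 'b, 'c) module_scheme \<Rightarrow> 'b set \<Rightarrow> ('a, 'b set) module" where
  "quotient_module M N =
    \<lparr>carrier = a_rcosets\<^bsub>M\<^esub> N, monoid.mult = undefined, one = undefined, ring.zero = N, add = set_add M,
     smult = (\<lambda>r X. \<Union>x\<in>X. N +>\<^bsub>M\<^esub> (r \<odot>\<^bsub>M\<^esub> x))\<rparr>"

definition finite_direct_sum ::
  "nat \<Rightarrow> (nat \<Rightarrow> ('a, 'b, 'c) module_scheme) \<Rightarrow> ('a, nat \<Rightarrow> 'b) module" where
  "finite_direct_sum n M =
    \<lparr>carrier = (\<Pi>\<^sub>E i\<in>{..<n}. carrier (M i)), monoid.mult = undefined, one = undefined,
     ring.zero = (\<lambda>i\<in>{..<n}. \<zero>\<^bsub>M i\<^esub>),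
     add = (\<lambda>x y. \<lambda>i\<in>{..<n}. x i \<oplus>\<^bsub>M i\<^esub> y i),
     smult = (\<lambda>r x. \<lambda>i\<in>{..<n}. r \<odot>\<^bsub>M i\<^esub> x i)\<rparr>"

definition module_isomorphic ::
  "('a, 'r) ring_scheme \<Rightarrow> ('a, 'b, 'c) module_scheme \<Rightarrow> ('a, 'd, 'e) module_scheme \<Rightarrow> bool" where
  "module_isomorphic R M N \<longleftrightarrow>
    (\<exists>f \<in> module_hom R M N. bij_betw f (carrier M) (carrier N))"

definition torsion_free ::
  "('a, 'r) ring_scheme \<Rightarrow> ('a, 'b, 'c) module_scheme \<Rightarrow> bool" where
  "torsion_free R M \<longleftrightarrow>
    (\<forall>r\<in>carrier R. \<forall>x\<in>carrier M. r \<odot>\<^bsub>M\<^esub> x = \<zero>\<^bsub>M\<^esub> \<longrightarrow> r = \<zero>\<^bsub>R\<^esub> \<or> x = \<zero>\<^bsub>M\<^esub>)"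

text \<open>
  Purity in the sense of relative divisibility, \<open>rN = N \<inter> rM\<close> for all \<open>r\<close>.  This is the usual
  definition over valuation domains, where it agrees with purity in the sense of Cohn.
\<close>

definition pure_submodule ::
  "('a, 'r) ring_scheme \<Rightarrow> 'b set \<Rightarrow> ('a, 'b, 'c) module_scheme \<Rightarrow> bool" where
  "pure_submodule R N M \<longleftrightarrow>
    LinearCombinations.submodule R N M \<and>
    (\<forall>r\<in>carrier R. (\<lambda>x. r \<odot>\<^bsub>M\<^esub> x) ` N = N \<inter> (\<lambda>x. r \<odot>\<^bsub>M\<^esub> x) ` carrier M)"


section \<open>Linear compactness\<close>

text \<open>
  Linear compactness in the discrete topology: all submodules are closed, so every family of
  cosets of submodules with the finite intersection property has a common element.
\<close>

definition linearly_compact_discrete ::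
  "('a, 'r) ring_scheme \<Rightarrow> ('a, 'b, 'c) module_scheme \<Rightarrow> bool" where
  "linearly_compact_discrete R M \<longleftrightarrow>
    (\<forall>\<C>. (\<forall>X\<in>\<C>. \<exists>N. LinearCombinations.submodule R N M \<and> X \<in> a_rcosets\<^bsub>M\<^esub> N) \<and>
         (\<forall>\<F>\<subseteq>\<C>. finite \<F> \<longrightarrow> carrier M \<inter> \<Inter>\<F> \<noteq> {})
       \<longrightarrow> carrier M \<inter> \<Inter>\<C> \<noteq> {})"

definition almost_maximal :: "('a, 'r) ring_scheme \<Rightarrow> bool" where
  "almost_maximal S \<longleftrightarrow>
    (\<forall>A. ideal A S \<and> A \<noteq> {\<zero>\<^bsub>S\<^esub>} \<longrightarrow>
       linearly_compact_discrete S (quotient_module (module_via (\<lambda>s. s) S) A))"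


section \<open>Valuation domains and localization\<close>

definition valuation_domain :: "('a, 'r) ring_scheme \<Rightarrow> bool" where
  "valuation_domain R \<longleftrightarrow>
    domain R \<and> (\<forall>I J. ideal I R \<and> ideal J R \<longrightarrow> I \<subseteq> J \<or> J \<subseteq> I)"

definition frac_rel :: "('a, 'r) ring_scheme \<Rightarrow> 'a set \<Rightarrow> (('a \<times> 'a) \<times> ('a \<times> 'a)) set" where
  "frac_rel R S =
    {((a, s), (b, t)). a \<in> carrier R \<and> s \<in> S \<and> b \<in> carrier R \<and> t \<in> S \<and>
       (\<exists>u\<in>S. u \<otimes>\<^bsub>R\<^esub> (a \<otimes>\<^bsub>R\<^esub> t \<ominus>\<^bsub>R\<^esub> b \<otimes>\<^bsub>R\<^esub> s) = \<zero>\<^bsub>R\<^esub>)}"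

definition fraction :: "('a, 'r) ring_scheme \<Rightarrow> 'a set \<Rightarrow> 'a \<Rightarrow> 'a \<Rightarrow> ('a \<times> 'a) set" where
  "fraction R S a s = frac_rel R S `` {(a, s)}"

text \<open>The localization of \<open>R\<close> at a multiplicatively closed set \<open>S\<close>.\<close>

definition localization :: "('a, 'r) ring_scheme \<Rightarrow> 'a set \<Rightarrow> ('a \<times> 'a) set ring" where
  "localization R S =
    \<lparr>carrier = (carrier R \<times> S) // frac_rel R S,
     monoid.mult = (\<lambda>X Y. \<Union>(a, s)\<in>X. \<Union>(b, t)\<in>Y. fraction R S (a \<otimes>\<^bsub>R\<^esub> b) (s \<otimes>\<^bsub>R\<^esub> t)),
     one = fraction R S \<one>\<^bsub>R\<^esub> \<one>\<^bsub>R\<^esub>,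
     ring.zero = fraction R S \<zero>\<^bsub>R\<^esub> \<one>\<^bsub>R\<^esub>,
     add = (\<lambda>X Y. \<Union>(a, s)\<in>X. \<Union>(b, t)\<in>Y.
              fraction R S (a \<otimes>\<^bsub>R\<^esub> t \<oplus>\<^bsub>R\<^esub> b \<otimes>\<^bsub>R\<^esub> s) (s \<otimes>\<^bsub>R\<^esub> t))\<rparr>"

definition fraction_field :: "('a, 'r) ring_scheme \<Rightarrow> ('a \<times> 'a) set ring" where
  "fraction_field R = localization R (carrier R - {\<zero>\<^bsub>R\<^esub>})"

definition to_fraction_field :: "('a, 'r) ring_scheme \<Rightarrow> 'a \<Rightarrow> ('a \<times> 'a) set" where
  "to_fraction_field R r = fraction R (carrier R - {\<zero>\<^bsub>R\<^esub>}) r \<one>\<^bsub>R\<^esub>"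

definition localization_at :: "('a, 'r) ring_scheme \<Rightarrow> 'a set \<Rightarrow> ('a \<times> 'a) set ring" where
  "localization_at R L = localization R (carrier R - L)"

definition to_localization_at :: "('a, 'r) ring_scheme \<Rightarrow> 'a set \<Rightarrow> 'a \<Rightarrow> ('a \<times> 'a) set" where
  "to_localization_at R L r = fraction R (carrier R - L) r \<one>\<^bsub>R\<^esub>"

text \<open>
  The ring \<open>R\<^sub>L / L'\<close> for primes \<open>L' \<subset> L\<close> of a valuation domain \<open>R\<close>.  Inside the field of
  quotients one has \<open>L' R\<^sub>L = L'\<close>, so the image of \<open>L'\<close> in \<open>R\<^sub>L\<close> is already an ideal.
\<close>

definition localization_quotient ::
  "('a, 'r) ring_scheme \<Rightarrow> 'a set \<Rightarrow> 'a set \<Rightarrow> ('a \<times> 'a) set set ring" where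
  "localization_quotient R L L' = localization_at R L Quot (to_localization_at R L ` L')"


section \<open>Tensor products and rank\<close>

text \<open>The subgroup of the free abelian group on \<open>A \<times> M\<close> whose quotient is \<open>A \<otimes>\<^sub>R M\<close>.\<close>

definition tensor_relations ::
  "('a, 'r) ring_scheme \<Rightarrow> ('a, 'b, 'c) module_scheme \<Rightarrow> ('a, 'd, 'e) module_scheme
    \<Rightarrow> (('b \<times> 'd) \<Rightarrow>\<^sub>0 int) set" where
  "tensor_relations R A M =
    generate (free_Abelian_group (carrier A \<times> carrier M))
      ({frag_of (p \<oplus>\<^bsub>A\<^esub> q, x) - frag_of (p, x) - frag_of (q, x) | p q x.
          p \<in> carrier A \<and> q \<in> carrier A \<and> x \<in> carrier M} \<union>
       {frag_of (p, x \<oplus>\<^bsub>M\<^esub> y) - frag_of (p, x) - frag_of (p, y) | p x y.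
          p \<in> carrier A \<and> x \<in> carrier M \<and> y \<in> carrier M} \<union>
       {frag_of (r \<odot>\<^bsub>A\<^esub> p, x) - frag_of (p, r \<odot>\<^bsub>M\<^esub> x) | r p x.
          r \<in> carrier R \<and> p \<in> carrier A \<and> x \<in> carrier M})"

text \<open>
  \<open>B \<otimes>\<^sub>R M\<close> as a module over \<open>B\<close>, for a ring homomorphism \<open>\<phi>\<close> from \<open>R\<close> to a commutative ring
  \<open>B\<close>.  The scalar \<open>b\<close> acts by \<open>b (q \<otimes> x) = (b q) \<otimes> x\<close>.
\<close>

definition base_change ::
  "('a, 'r) ring_scheme \<Rightarrow> ('a \<Rightarrow> 'b) \<Rightarrow> ('b, 's) ring_scheme \<Rightarrow> ('a, 'c, 'd) module_scheme
    \<Rightarrow> ('b, (('b \<times> 'c) \<Rightarrow>\<^sub>0 int) set) module" where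
  "base_change R \<phi> B M =
    (let F = free_Abelian_group (carrier B \<times> carrier M);
         K = tensor_relations R (module_via \<phi> B) M
     in \<lparr>carrier = rcosets\<^bsub>F\<^esub> K, monoid.mult = undefined, one = undefined, ring.zero = K, add = set_mult F,
         smult = (\<lambda>b X. \<Union>z\<in>X. K #>\<^bsub>F\<^esub> frag_extend (\<lambda>(q, x). frag_of (b \<otimes>\<^bsub>B\<^esub> q, x)) z)\<rparr>)"

text \<open>The rank of \<open>M\<close> is the dimension of \<open>Q \<otimes>\<^sub>R M\<close> over the field of quotients \<open>Q\<close> of \<open>R\<close>.\<close>

definition finite_rank :: "('a, 'r) ring_scheme \<Rightarrow> ('a, 'b, 'c) module_scheme \<Rightarrow> bool" where
  "finite_rank R M \<longleftrightarrow>
    vectorspace.fin_dim (fraction_field R)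
      (base_change R (to_fraction_field R) (fraction_field R) M)"


section \<open>Finite direct sums of ideals\<close>

text \<open>An ideal of \<open>R\<^sub>L\<close> is regarded as an \<open>R\<close>-module by restriction of scalars.\<close>

definition sum_of_ideals_of_localization ::
  "('a, 'r) ring_scheme \<Rightarrow> 'a set \<Rightarrow> ('a, 'b, 'c) module_scheme \<Rightarrow> bool" where
  "sum_of_ideals_of_localization R L M \<longleftrightarrow>
    (\<exists>n I. (\<forall>i<n. ideal (I i) (localization_at R L)) \<and>
       module_isomorphic R M
         (finite_direct_sum n (\<lambda>i.
            (module_via (to_localization_at R L) (localization_at R L))\<lparr>carrier := I i\<rparr>)))"

end

theory Submission
  imports Defs
begin

text \<open>
  Say that a torsion-free module \<open>M\<close> is divisible outside a prime \<open>L\<close> if \<open>s M = M\<close> for all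
  \<open>s \<notin> L\<close>.  Every module is divisible outside the maximal ideal \<open>P\<close>, since the elements outside
  \<open>P\<close> are units, and to be divisible outside \<open>0\<close> is to be a vector space over the field of
  quotients \<open>Q\<close>.  The series climbs from the first condition to the second.  Suppose that
  \<open>M = G / G\<^sub>j\<close> is divisible outside \<open>L\<^sub>j\<close>, and take in \<open>M\<close> a pure submodule \<open>B\<close> that is a direct
  sum of \<open>n\<close> ideals of the localization at \<open>L\<^sub>j\<close> and the top of a strict chain of pure submodules
  of length \<open>n\<close>, with \<open>n\<close> as large as possible.  For \<open>j < m\<close>, maximality makes \<open>M / B\<close>
  divisible outside \<open>L\<^bsub>j+1\<^esub>\<close> (\<open>basic_submodule\<close>), so the preimage of \<open>B\<close> can serve as
  \<open>G\<^bsub>j+1\<^esub>\<close>.  For \<open>j = m\<close> it makes \<open>B\<close> all of \<open>M\<close> (\<open>divisible_imp_sum_of_ideals\<close>).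

  The reason for the first consequence of maximality is linear compactness.  Write \<open>L = L\<^sub>j\<close> and
  \<open>L' = L\<^bsub>j+1\<^esub>\<close>, and suppose that \<open>s \<notin> L'\<close> and \<open>x \<notin> s M + B\<close>.  For each \<open>r\<close> that divides \<open>x\<close>
  modulo \<open>B\<close>, the elements \<open>b \<in> B\<close> with \<open>x + b \<in> r M\<close> form a coset of \<open>r B\<close>, by purity of \<open>B\<close>.
  These cosets are nested, and each such \<open>r\<close> divides \<open>s\<close>, because otherwise \<open>s\<close> would divide \<open>x\<close>
  modulo \<open>B\<close>.  In coordinates of \<open>B\<close> one obtains nested cosets of submodules \<open>r I \<supseteq> s I\<close> of ideals
  \<open>I\<close> of \<open>R\<^sub>L\<close>.  If \<open>I\<close> is divisible outside \<open>L'\<close>, all of them equal \<open>I\<close>; otherwise \<open>I\<close> can be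
  rescaled to an ideal that contains an element outside \<open>L'\<close>, and the almost maximality of
  \<open>R\<^sub>L / L'\<close> yields a common element (\<open>ideal_cosets_common_element\<close>).  Together the coordinates give
  \<open>c \<in> B\<close> such that \<open>x + c\<close> is divisible by every \<open>r\<close> that divides \<open>x\<close> modulo \<open>B\<close>
  (\<open>divisible_representative\<close>).  This is exactly what makes the sum of \<open>B\<close> and the pure closure of
  \<open>x + c\<close> direct and pure (\<open>extend_pure_sum_of_ideals\<close>).  Since \<open>s\<close> does not divide \<open>x + c\<close>, this
  pure closure consists of multiples of \<open>(x + c) / s\<close> by elements of \<open>R\<^sub>L\<close>, hence is isomorphic to
  an ideal of \<open>R\<^sub>L\<close> (\<open>cyclic_hull_iso_ideal\<close>), which contradicts the choice of \<open>B\<close>.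

  A maximal \<open>B\<close> exists because each enlargement lengthens a strict chain of pure submodules, and
  the rank bounds the length of such chains (\<open>finite_rank_bounds_pure_chains\<close>): as \<open>G\<close> is
  torsion-free, it embeds into \<open>Q \<otimes> G\<close>, and there strictly increasing pure submodules span
  strictly increasing subspaces.
\<close>

section \<open>Valuation domains\<close>

text \<open>
  Divisibility of elements is the only form in which the comparability of ideals is used below.
\<close>

locale valuation_ring = "domain" +
  assumes divides_total: "\<lbrakk>a \<in> carrier R; b \<in> carrier R\<rbrakk> \<Longrightarrow>
    (\<exists>c\<in>carrier R. b = a \<otimes> c) \<or> (\<exists>c\<in>carrier R. a = b \<otimes> c)"

lemma valuation_domain_imp_valuation_ring:
  fixes R (structure)
  assumes "valuation_domain R"
  shows "valuation_ring R"
proof -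
  interpret "domain" R using assms by (simp add: valuation_domain_def)
  show ?thesis
  proof
    fix a b assume a: "a \<in> carrier R" and b: "b \<in> carrier R"
    have "PIdl a \<subseteq> PIdl b \<or> PIdl b \<subseteq> PIdl a"
      using assms cgenideal_ideal[OF a] cgenideal_ideal[OF b] by (simp add: valuation_domain_def)
    then have "a \<in> PIdl b \<or> b \<in> PIdl a"
      using cgenideal_self[OF a] cgenideal_self[OF b] by blast
    then show "(\<exists>c\<in>carrier R. b = a \<otimes> c) \<or> (\<exists>c\<in>carrier R. a = b \<otimes> c)"
      unfolding cgenideal_def using a b by (auto simp: m_comm)
  qed
qed

section \<open>Localization of a domain\<close>

text \<open>
  In a domain, denominators that exclude \<open>0\<close> make two fractions equal as soon as their cross
  products agree, so that no further denominator enters the equivalence of fractions.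
\<close>

locale denominators = "domain" +
  fixes S
  assumes denominators_closed: "S \<subseteq> carrier R"
    and one_denominator: "\<one> \<in> S"
    and mult_denominator: "\<lbrakk>s \<in> S; t \<in> S\<rbrakk> \<Longrightarrow> s \<otimes> t \<in> S"
    and zero_not_denominator: "\<zero> \<notin> S"
begin

abbreviation "Frac \<equiv> fraction R S"
abbreviation "loc \<equiv> localization R S"

lemma denominator_carrier [simp]: "s \<in> S \<Longrightarrow> s \<in> carrier R"
  using denominators_closed by blast

declare one_denominator [simp] mult_denominator [simp]

lemma denominator_nonzero: "s \<in> S \<Longrightarrow> s \<noteq> \<zero>"
  using zero_not_denominator by auto

lemma frac_rel_iff:
  "((a, s), (b, t)) \<in> frac_rel R S \<longleftrightarrow>
     a \<in> carrier R \<and> s \<in> S \<and> b \<in> carrier R \<and> t \<in> S \<and> a \<otimes> t = b \<otimes> s"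
proof -
  have "(\<exists>u\<in>S. u \<otimes> (a \<otimes> t \<ominus> b \<otimes> s) = \<zero>) \<longleftrightarrow> a \<otimes> t = b \<otimes> s"
    if "a \<in> carrier R" "s \<in> S" "b \<in> carrier R" "t \<in> S"
  proof
    assume "\<exists>u\<in>S. u \<otimes> (a \<otimes> t \<ominus> b \<otimes> s) = \<zero>"
    then obtain u where u: "u \<in> S" "u \<otimes> (a \<otimes> t \<ominus> b \<otimes> s) = \<zero>" by blast
    have "a \<otimes> t \<ominus> b \<otimes> s = \<zero>"
      using integral[OF u(2)] u(1) denominator_nonzero that by auto
    then show "a \<otimes> t = b \<otimes> s" using that by simp
  next
    assume "a \<otimes> t = b \<otimes> s"
    then have "\<one> \<otimes> (a \<otimes> t \<ominus> b \<otimes> s) = \<zero>"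
      using that by simp
    then show "\<exists>u\<in>S. u \<otimes> (a \<otimes> t \<ominus> b \<otimes> s) = \<zero>" using one_denominator by blast
  qed
  then show ?thesis unfolding frac_rel_def by auto
qed

lemma frac_rel_equiv: "equiv (carrier R \<times> S) (frac_rel R S)"
proof (rule equivI)
  show "frac_rel R S \<subseteq> (carrier R \<times> S) \<times> carrier R \<times> S" by (auto simp: frac_rel_def)
  show "refl_on (carrier R \<times> S) (frac_rel R S)" by (auto simp: refl_on_def frac_rel_iff)
  show "sym (frac_rel R S)" by (auto simp: sym_def frac_rel_iff)
  show "trans (frac_rel R S)"
  proof (rule transI, clarify)
    fix a s b t c u
    assume "((a, s), (b, t)) \<in> frac_rel R S" "((b, t), (c, u)) \<in> frac_rel R S"
    then have *: "a \<in> carrier R" "b \<in> carrier R" "c \<in> carrier R" "s \<in> S" "t \<in> S" "u \<in> S"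
      "a \<otimes> t = b \<otimes> s" "b \<otimes> u = c \<otimes> t" by (auto simp: frac_rel_iff)
    have "t \<otimes> (a \<otimes> u) = (a \<otimes> t) \<otimes> u" using *(1-6) by (simp add: m_ac)
    also have "\<dots> = (b \<otimes> u) \<otimes> s" unfolding *(7) using *(1-6) by (simp add: m_ac)
    also have "\<dots> = t \<otimes> (c \<otimes> s)" unfolding *(8) using *(1-6) by (simp add: m_ac)
    finally have "a \<otimes> u = c \<otimes> s" using * denominator_nonzero m_lcancel by auto
    then show "((a, s), (c, u)) \<in> frac_rel R S" using * by (simp add: frac_rel_iff)
  qed
qed

lemma frac_eq_iff:
  assumes "a \<in> carrier R" "s \<in> S" "b \<in> carrier R" "t \<in> S"
  shows "Frac a s = Frac b t \<longleftrightarrow> a \<otimes> t = b \<otimes> s"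
  unfolding fraction_def using assms eq_equiv_class_iff[OF frac_rel_equiv, of "(a, s)" "(b, t)"]
  by (auto simp: frac_rel_iff)

lemma frac_closed [simp]: "\<lbrakk>a \<in> carrier R; s \<in> S\<rbrakk> \<Longrightarrow> Frac a s \<in> carrier loc"
  unfolding fraction_def localization_def by (auto intro: quotientI)

lemma loc_cases:
  assumes "X \<in> carrier loc"
  obtains a s where "a \<in> carrier R" "s \<in> S" "X = Frac a s"
  using assms unfolding fraction_def localization_def by (auto elim!: quotientE)

lemma mem_frac_iff:
  "\<lbrakk>a \<in> carrier R; s \<in> S\<rbrakk> \<Longrightarrow>
    (b, t) \<in> Frac a s \<longleftrightarrow> b \<in> carrier R \<and> t \<in> S \<and> a \<otimes> t = b \<otimes> s"
  unfolding fraction_def by (auto simp: frac_rel_iff)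

lemma frac_self: "\<lbrakk>a \<in> carrier R; s \<in> S\<rbrakk> \<Longrightarrow> (a, s) \<in> Frac a s"
  by (simp add: mem_frac_iff)

text \<open>
  The ring operations on fractions are unions over all representatives; such a union collapses
  to a single fraction once the terms do not depend on the representatives.
\<close>

lemma Union_frac_constant:
  assumes "a \<in> carrier R" "s \<in> S"
    and "\<And>b t. \<lbrakk>b \<in> carrier R; t \<in> S; a \<otimes> t = b \<otimes> s\<rbrakk> \<Longrightarrow> f b t = Z"
  shows "(\<Union>(b, t)\<in>Frac a s. f b t) = Z"
proof -
  have "f b t = Z" if "(b, t) \<in> Frac a s" for b t
    using that assms by (simp add: mem_frac_iff)
  then show ?thesis using frac_self[OF assms(1,2)] by fastforce
qed

lemma frac_mult:
  assumes "a \<in> carrier R" "s \<in> S" "b \<in> carrier R" "t \<in> S"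
  shows "Frac a s \<otimes>\<^bsub>loc\<^esub> Frac b t = Frac (a \<otimes> b) (s \<otimes> t)"
proof -
  have "(\<Union>(a', s')\<in>Frac a s. \<Union>(b', t')\<in>Frac b t. Frac (a' \<otimes> b') (s' \<otimes> t')) = Frac (a \<otimes> b) (s \<otimes> t)"
  proof (intro Union_frac_constant)
    fix a' s' b' t'
    assume *: "a' \<in> carrier R" "s' \<in> S" "b' \<in> carrier R" "t' \<in> S"
      "a \<otimes> s' = a' \<otimes> s" "b \<otimes> t' = b' \<otimes> t"
    have "(a \<otimes> s') \<otimes> (b \<otimes> t') = (a' \<otimes> s) \<otimes> (b' \<otimes> t)" using * by simp
    then have "(a \<otimes> b) \<otimes> (s' \<otimes> t') = (a' \<otimes> b') \<otimes> (s \<otimes> t)" using *(1-4) assms by (simp add: m_ac)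
    then show "Frac (a' \<otimes> b') (s' \<otimes> t') = Frac (a \<otimes> b) (s \<otimes> t)"
      using * assms by (simp add: frac_eq_iff)
  qed (use assms in auto)
  then show ?thesis by (simp add: localization_def)
qed

lemma frac_add:
  assumes "a \<in> carrier R" "s \<in> S" "b \<in> carrier R" "t \<in> S"
  shows "Frac a s \<oplus>\<^bsub>loc\<^esub> Frac b t = Frac (a \<otimes> t \<oplus> b \<otimes> s) (s \<otimes> t)"
proof -
  have "(\<Union>(a', s')\<in>Frac a s. \<Union>(b', t')\<in>Frac b t. Frac (a' \<otimes> t' \<oplus> b' \<otimes> s') (s' \<otimes> t'))
    = Frac (a \<otimes> t \<oplus> b \<otimes> s) (s \<otimes> t)"
  proof (intro Union_frac_constant)
    fix a' s' b' t'
    assume *: "a' \<in> carrier R" "s' \<in> S" "b' \<in> carrier R" "t' \<in> S"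
      "a \<otimes> s' = a' \<otimes> s" "b \<otimes> t' = b' \<otimes> t"
    have "(a \<otimes> t \<oplus> b \<otimes> s) \<otimes> (s' \<otimes> t') = (a \<otimes> s') \<otimes> (t \<otimes> t') \<oplus> (b \<otimes> t') \<otimes> (s \<otimes> s')"
      using *(1-4) assms by (simp add: m_ac l_distr r_distr)
    also have "\<dots> = (a' \<otimes> t' \<oplus> b' \<otimes> s') \<otimes> (s \<otimes> t)"
      unfolding *(5,6) using *(1-4) assms by (simp add: m_ac l_distr r_distr)
    finally show "Frac (a' \<otimes> t' \<oplus> b' \<otimes> s') (s' \<otimes> t') = Frac (a \<otimes> t \<oplus> b \<otimes> s) (s \<otimes> t)"
      using * assms by (simp add: frac_eq_iff)
  qed (use assms in auto)
  then show ?thesis by (simp add: localization_def)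
qed

lemma frac_add_same:
  assumes "a \<in> carrier R" "b \<in> carrier R" "s \<in> S"
  shows "Frac a s \<oplus>\<^bsub>loc\<^esub> Frac b s = Frac (a \<oplus> b) s"
  using assms by (simp add: frac_add frac_eq_iff l_distr r_distr m_ac)

lemma frac_common_denominator:
  assumes "X \<in> carrier loc" "Y \<in> carrier loc"
  obtains a b s where "a \<in> carrier R" "b \<in> carrier R" "s \<in> S" "X = Frac a s" "Y = Frac b s"
proof -
  obtain a s where a: "a \<in> carrier R" "s \<in> S" "X = Frac a s" using assms(1) loc_cases by blast
  obtain b t where b: "b \<in> carrier R" "t \<in> S" "Y = Frac b t" using assms(2) loc_cases by blast
  have "X = Frac (a \<otimes> t) (s \<otimes> t)" "Y = Frac (b \<otimes> s) (s \<otimes> t)"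
    using a b by (simp_all add: frac_eq_iff m_ac)
  then show thesis using that[of "a \<otimes> t" "b \<otimes> s" "s \<otimes> t"] a b by auto
qed

lemma loc_one: "\<one>\<^bsub>loc\<^esub> = Frac \<one> \<one>" and loc_zero: "\<zero>\<^bsub>loc\<^esub> = Frac \<zero> \<one>"
  by (simp_all add: localization_def)

lemma frac_eq_zero_iff:
  "\<lbrakk>a \<in> carrier R; s \<in> S\<rbrakk> \<Longrightarrow> Frac a s = \<zero>\<^bsub>loc\<^esub> \<longleftrightarrow> a = \<zero>"
  by (simp add: loc_zero frac_eq_iff)

lemma loc_cring: "cring loc"
proof (rule cringI)
  show "abelian_group loc"
  proof (rule abelian_groupI)
    fix X Y Z assume XYZ: "X \<in> carrier loc" "Y \<in> carrier loc" "Z \<in> carrier loc"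
    obtain a s where a: "a \<in> carrier R" "s \<in> S" "X = Frac a s" using XYZ loc_cases by blast
    obtain b t where b: "b \<in> carrier R" "t \<in> S" "Y = Frac b t" using XYZ loc_cases by blast
    obtain c u where c: "c \<in> carrier R" "u \<in> S" "Z = Frac c u" using XYZ loc_cases by blast
    show "(X \<oplus>\<^bsub>loc\<^esub> Y) \<oplus>\<^bsub>loc\<^esub> Z = X \<oplus>\<^bsub>loc\<^esub> (Y \<oplus>\<^bsub>loc\<^esub> Z)"
      using a b c by (simp add: frac_add frac_eq_iff l_distr r_distr m_ac a_ac)
  next
    fix X Y assume XY: "X \<in> carrier loc" "Y \<in> carrier loc"
    then obtain a b s where "a \<in> carrier R" "b \<in> carrier R" "s \<in> S" "X = Frac a s" "Y = Frac b s"
      using frac_common_denominator by blast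
    then show "X \<oplus>\<^bsub>loc\<^esub> Y = Y \<oplus>\<^bsub>loc\<^esub> X" "X \<oplus>\<^bsub>loc\<^esub> Y \<in> carrier loc"
      by (simp_all add: frac_add_same a_comm)
  next
    fix X assume X: "X \<in> carrier loc"
    then obtain a s where a: "a \<in> carrier R" "s \<in> S" "X = Frac a s" using loc_cases by blast
    then show "\<zero>\<^bsub>loc\<^esub> \<oplus>\<^bsub>loc\<^esub> X = X"
      by (simp add: loc_zero frac_add frac_eq_iff)
    have "Frac (\<ominus> a) s \<oplus>\<^bsub>loc\<^esub> X = \<zero>\<^bsub>loc\<^esub>"
      using a by (simp add: frac_add_same frac_eq_zero_iff l_neg)
    then show "\<exists>Y\<in>carrier loc. Y \<oplus>\<^bsub>loc\<^esub> X = \<zero>\<^bsub>loc\<^esub>"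
      using a by (metis frac_closed a_inv_closed)
  qed (simp add: loc_zero)
next
  show "comm_monoid loc"
  proof (rule comm_monoidI)
    fix X Y Z assume XYZ: "X \<in> carrier loc" "Y \<in> carrier loc" "Z \<in> carrier loc"
    obtain a s where a: "a \<in> carrier R" "s \<in> S" "X = Frac a s" using XYZ loc_cases by blast
    obtain b t where b: "b \<in> carrier R" "t \<in> S" "Y = Frac b t" using XYZ loc_cases by blast
    obtain c u where c: "c \<in> carrier R" "u \<in> S" "Z = Frac c u" using XYZ loc_cases by blast
    show "(X \<otimes>\<^bsub>loc\<^esub> Y) \<otimes>\<^bsub>loc\<^esub> Z = X \<otimes>\<^bsub>loc\<^esub> (Y \<otimes>\<^bsub>loc\<^esub> Z)"
      using a b c by (simp add: frac_mult frac_eq_iff m_ac)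
  next
    fix X Y assume XY: "X \<in> carrier loc" "Y \<in> carrier loc"
    then obtain a b s where "a \<in> carrier R" "b \<in> carrier R" "s \<in> S" "X = Frac a s" "Y = Frac b s"
      using frac_common_denominator by blast
    then show "X \<otimes>\<^bsub>loc\<^esub> Y = Y \<otimes>\<^bsub>loc\<^esub> X" "X \<otimes>\<^bsub>loc\<^esub> Y \<in> carrier loc"
      by (simp_all add: frac_mult m_comm)
  next
    fix X assume X: "X \<in> carrier loc"
    then obtain a s where a: "a \<in> carrier R" "s \<in> S" "X = Frac a s" using loc_cases by blast
    then show "\<one>\<^bsub>loc\<^esub> \<otimes>\<^bsub>loc\<^esub> X = X" by (simp add: loc_one frac_mult)
  qed (simp add: loc_one)
next
  fix X Y Z assume XYZ: "X \<in> carrier loc" "Y \<in> carrier loc" "Z \<in> carrier loc"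
  obtain a b s where a: "a \<in> carrier R" "b \<in> carrier R" "s \<in> S" "X = Frac a s" "Y = Frac b s"
    using XYZ frac_common_denominator by blast
  obtain c u where c: "c \<in> carrier R" "u \<in> S" "Z = Frac c u" using XYZ loc_cases by blast
  show "(X \<oplus>\<^bsub>loc\<^esub> Y) \<otimes>\<^bsub>loc\<^esub> Z = X \<otimes>\<^bsub>loc\<^esub> Z \<oplus>\<^bsub>loc\<^esub> Y \<otimes>\<^bsub>loc\<^esub> Z"
    using a c by (simp add: frac_mult frac_add_same l_distr)
qed

lemma loc_domain: "domain loc"
proof -
  interpret T: cring loc by (rule loc_cring)
  show ?thesis
  proof
    show "\<one>\<^bsub>loc\<^esub> \<noteq> \<zero>\<^bsub>loc\<^esub>" by (simp add: loc_one frac_eq_zero_iff)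
    fix X Y assume *: "X \<otimes>\<^bsub>loc\<^esub> Y = \<zero>\<^bsub>loc\<^esub>" "X \<in> carrier loc" "Y \<in> carrier loc"
    obtain a b s where a: "a \<in> carrier R" "b \<in> carrier R" "s \<in> S" "X = Frac a s" "Y = Frac b s"
      using * frac_common_denominator by blast
    then show "X = \<zero>\<^bsub>loc\<^esub> \<or> Y = \<zero>\<^bsub>loc\<^esub>"
      using *(1) integral by (auto simp: frac_mult frac_eq_zero_iff)
  qed
qed

lemma frac_one_inj:
  "\<lbrakk>a \<in> carrier R; b \<in> carrier R\<rbrakk> \<Longrightarrow> Frac a \<one> = Frac b \<one> \<longleftrightarrow> a = b"
  by (simp add: frac_eq_iff)

lemma loc_valuation_ring:
  assumes "valuation_ring R"
  shows "valuation_ring loc"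
proof -
  interpret V: valuation_ring R by (rule assms)
  interpret T: "domain" loc by (rule loc_domain)
  have *: "\<exists>Z\<in>carrier loc. Frac (a \<otimes> c) s = Frac a s \<otimes>\<^bsub>loc\<^esub> Z"
    if "a \<in> carrier R" "c \<in> carrier R" "s \<in> S" for a c s
  proof
    show "Frac (a \<otimes> c) s = Frac a s \<otimes>\<^bsub>loc\<^esub> Frac c \<one>" using that by (simp add: frac_mult)
    show "Frac c \<one> \<in> carrier loc" using that by simp
  qed
  show ?thesis
  proof
    fix X Y assume "X \<in> carrier loc" "Y \<in> carrier loc"
    then obtain a b s where a: "a \<in> carrier R" "b \<in> carrier R" "s \<in> S" "X = Frac a s" "Y = Frac b s"
      using frac_common_denominator by blast
    show "(\<exists>c\<in>carrier loc. Y = X \<otimes>\<^bsub>loc\<^esub> c) \<or> (\<exists>c\<in>carrier loc. X = Y \<otimes>\<^bsub>loc\<^esub> c)"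
      using V.divides_total[OF a(1,2)] *[OF a(1) _ a(3)] *[OF a(2) _ a(3)] unfolding a(4,5)
      by blast
  qed
qed

end

lemma (in "domain") denominators_nonzero: "denominators R (carrier R - {\<zero>})"
  by unfold_locales (auto simp: integral_iff)

lemma (in "domain") denominators_prime:
  assumes "primeideal L R"
  shows "denominators R (carrier R - L)"
proof -
  interpret L: primeideal L R by (rule assms)
  show ?thesis
  proof unfold_locales
    show "\<one> \<in> carrier R - L" using L.I_notcarr L.one_imp_carrier by auto
    fix s t assume "s \<in> carrier R - L" "t \<in> carrier R - L"
    then show "s \<otimes> t \<in> carrier R - L" using L.I_prime by auto
  qed auto
qed

lemma (in "domain") fraction_field_field: "field (fraction_field R)"
proof -
  interpret D: denominators R "carrier R - {\<zero>}" by (rule denominators_nonzero)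
  interpret T: "domain" D.loc by (rule D.loc_domain)
  have "field D.loc"
  proof (rule T.cring_fieldI2)
    show "\<zero>\<^bsub>D.loc\<^esub> \<noteq> \<one>\<^bsub>D.loc\<^esub>" using T.one_not_zero by auto
    fix X assume X: "X \<in> carrier D.loc" "X \<noteq> \<zero>\<^bsub>D.loc\<^esub>"
    obtain a s where a: "a \<in> carrier R" "s \<in> carrier R - {\<zero>}" "X = D.Frac a s"
      using X D.loc_cases by blast
    have "a \<noteq> \<zero>" using X(2) a D.frac_eq_zero_iff by auto
    then have "X \<otimes>\<^bsub>D.loc\<^esub> D.Frac s a = \<one>\<^bsub>D.loc\<^esub>"
      using a by (simp add: D.frac_mult D.loc_one D.frac_eq_iff integral_iff m_comm)
    then show "\<exists>b\<in>carrier D.loc. X \<otimes>\<^bsub>D.loc\<^esub> b = \<one>\<^bsub>D.loc\<^esub>"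
      using a \<open>a \<noteq> \<zero>\<close> by (metis D.frac_closed DiffE DiffI singletonD)
  qed
  then show ?thesis by (simp add: fraction_field_def)
qed

section \<open>Quotient modules\<close>

lemma (in abelian_group) eq_add_iff_minus_eq:
  assumes "x \<in> carrier G" "y \<in> carrier G" "z \<in> carrier G"
  shows "x = y \<oplus> z \<longleftrightarrow> x \<ominus> y = z"
proof
  assume "x = y \<oplus> z"
  then show "x \<ominus> y = z" using assms r_neg1[of y z] by (simp add: minus_eq a_comm)
next
  assume "x \<ominus> y = z"
  then show "x = y \<oplus> z" using assms r_neg2[of y x] by (auto simp: minus_eq a_comm)
qed

lemma (in abelian_group) add_diff_cancel_left:
  assumes "x \<in> carrier G" "y \<in> carrier G" "z \<in> carrier G"
  shows "(x \<oplus> z) \<ominus> (x \<oplus> y) = z \<ominus> y"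
proof -
  have "z = y \<oplus> (z \<ominus> y)"
    using eq_add_iff_minus_eq[of z y "z \<ominus> y"] assms by simp
  then have "x \<oplus> z = (x \<oplus> y) \<oplus> (z \<ominus> y)"
    using a_assoc[of x y "z \<ominus> y"] assms by simp
  then show ?thesis
    using eq_add_iff_minus_eq[of "x \<oplus> z" "x \<oplus> y" "z \<ominus> y"] assms by simp
qed

text \<open>
  A submodule bundled with its ambient module, so that the cosets and the quotient can be
  named.
\<close>

locale submodule_of = module +
  fixes N
  assumes submodule: "LinearCombinations.submodule R N M"
begin

lemma N_subset: "N \<subseteq> carrier M"
  using submodule by (simp add: LinearCombinations.submodule_def)

lemma N_carrier [simp]: "x \<in> N \<Longrightarrow> x \<in> carrier M"
  using N_subset by blast

lemma N_zero [simp]: "\<zero>\<^bsub>M\<^esub> \<in> N"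
  using submodule by (simp add: LinearCombinations.submodule_def)

lemma N_add [simp]: "\<lbrakk>x \<in> N; y \<in> N\<rbrakk> \<Longrightarrow> x \<oplus>\<^bsub>M\<^esub> y \<in> N"
  using submodule by (simp add: LinearCombinations.submodule_def)

lemma N_smult [simp]: "\<lbrakk>r \<in> carrier R; x \<in> N\<rbrakk> \<Longrightarrow> r \<odot>\<^bsub>M\<^esub> x \<in> N"
  using submodule by (simp add: LinearCombinations.submodule_def)

lemma N_neg [simp]: "x \<in> N \<Longrightarrow> \<ominus>\<^bsub>M\<^esub> x \<in> N"
  using N_smult[of "\<ominus> \<one>" x] by (simp add: smult_l_minus)

lemma N_minus [simp]: "\<lbrakk>x \<in> N; y \<in> N\<rbrakk> \<Longrightarrow> x \<ominus>\<^bsub>M\<^esub> y \<in> N"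
  by (simp add: a_minus_def)

sublocale N: abelian_subgroup N M
proof (rule abelian_subgroupI3)
  show "additive_subgroup N M"
  proof (rule additive_subgroupI, rule subgroup.intro)
    fix x assume "x \<in> N"
    then show "inv\<^bsub>add_monoid M\<^esub> x \<in> N" using N_neg by (simp add: a_inv_def)
  qed auto
qed (rule M.abelian_group_axioms)

abbreviation "coset x \<equiv> N +>\<^bsub>M\<^esub> x"
abbreviation "quot \<equiv> quotient_module M N"

lemma mem_coset_iff: "\<lbrakk>x \<in> carrier M; y \<in> carrier M\<rbrakk> \<Longrightarrow> y \<in> coset x \<longleftrightarrow> y \<ominus>\<^bsub>M\<^esub> x \<in> N"
  by (simp add: N.a_rcos_module a_minus_def)

lemma coset_eq_iff:
  assumes "x \<in> carrier M" "y \<in> carrier M"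
  shows "coset x = coset y \<longleftrightarrow> x \<ominus>\<^bsub>M\<^esub> y \<in> N"
  using assms mem_coset_iff[of y x] N.a_repr_independence'[of x y] N.a_rcos_self[of x] by metis

lemma coset_eq_N_iff: "x \<in> carrier M \<Longrightarrow> coset x = N \<longleftrightarrow> x \<in> N"
  using N.a_rcos_self[of x] N.a_rcos_const[of x] by auto

lemma quot_carrier: "carrier quot = coset ` carrier M"
  by (auto simp: quotient_module_def A_RCOSETS_def')

lemma quot_zero: "\<zero>\<^bsub>quot\<^esub> = N"
  by (simp add: quotient_module_def)

lemma quot_add: "\<lbrakk>x \<in> carrier M; y \<in> carrier M\<rbrakk> \<Longrightarrow> coset x \<oplus>\<^bsub>quot\<^esub> coset y = coset (x \<oplus>\<^bsub>M\<^esub> y)"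
  by (simp add: quotient_module_def N.a_rcos_sum)

lemma quot_smult:
  assumes r: "r \<in> carrier R" and x: "x \<in> carrier M"
  shows "r \<odot>\<^bsub>quot\<^esub> coset x = coset (r \<odot>\<^bsub>M\<^esub> x)"
proof -
  have "coset (r \<odot>\<^bsub>M\<^esub> y) = coset (r \<odot>\<^bsub>M\<^esub> x)" if "y \<in> coset x" for y
  proof -
    have y: "y \<in> carrier M" using that x N.a_elemrcos_carrier by blast
    then have "y \<ominus>\<^bsub>M\<^esub> x \<in> N" using that x mem_coset_iff by blast
    then have "r \<odot>\<^bsub>M\<^esub> (y \<ominus>\<^bsub>M\<^esub> x) \<in> N" using r by simp
    then have "r \<odot>\<^bsub>M\<^esub> y \<ominus>\<^bsub>M\<^esub> r \<odot>\<^bsub>M\<^esub> x \<in> N"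
      using r x y by (simp add: a_minus_def smult_r_distr smult_r_minus)
    then show ?thesis using r x y by (simp add: coset_eq_iff)
  qed
  then have "(\<Union>y\<in>coset x. coset (r \<odot>\<^bsub>M\<^esub> y)) = coset (r \<odot>\<^bsub>M\<^esub> x)"
    using N.a_rcos_self[OF x] by blast
  then show ?thesis by (simp add: quotient_module_def)
qed

lemma coset_closed [simp]: "x \<in> carrier M \<Longrightarrow> coset x \<in> carrier quot"
  by (simp add: quot_carrier)

lemma quot_cases:
  assumes "X \<in> carrier quot" obtains x where "x \<in> carrier M" "X = coset x"
  using assms by (auto simp: quot_carrier)

lemma quot_module: "module R quot"
proof (rule moduleI)
  show "abelian_group quot"
  proof (rule abelian_groupI)
    fix X assume "X \<in> carrier quot"
    then obtain x where x: "x \<in> carrier M" "X = coset x" using quot_cases by blast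
    then show "\<zero>\<^bsub>quot\<^esub> \<oplus>\<^bsub>quot\<^esub> X = X"
      using quot_add[of "\<zero>\<^bsub>M\<^esub>" x] by (simp add: quot_zero coset_eq_N_iff N.a_rcos_const)
    have "coset (\<ominus>\<^bsub>M\<^esub> x) \<oplus>\<^bsub>quot\<^esub> X = \<zero>\<^bsub>quot\<^esub>"
      using x by (simp add: quot_add quot_zero coset_eq_N_iff M.l_neg)
    then show "\<exists>Y\<in>carrier quot. Y \<oplus>\<^bsub>quot\<^esub> X = \<zero>\<^bsub>quot\<^esub>"
      using x by (metis coset_closed M.a_inv_closed)
  next
    show "\<zero>\<^bsub>quot\<^esub> \<in> carrier quot"
      using coset_closed[of "\<zero>\<^bsub>M\<^esub>"] by (simp add: quot_zero coset_eq_N_iff N.a_rcos_const)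
  qed (auto simp: quot_carrier quot_add M.a_ac)
qed (auto simp: quot_carrier quot_add quot_smult smult_l_distr smult_r_distr smult_assoc1
      intro: R.is_cring)

end

lemma module_via_module:
  assumes "cring R" "cring B" "\<phi> \<in> ring_hom R B"
  shows "module R (module_via \<phi> B)"
proof -
  interpret R: cring R by (rule assms)
  interpret B: cring B by (rule assms)
  interpret ring_hom_cring R B \<phi>
    by (intro ring_hom_cring.intro ring_hom_cring_axioms.intro assms)
  show ?thesis
  proof (rule moduleI)
    show "abelian_group (module_via \<phi> B)"
    proof (rule abelian_groupI)
      fix x assume "x \<in> carrier (module_via \<phi> B)"
      then show "\<exists>y\<in>carrier (module_via \<phi> B). y \<oplus>\<^bsub>module_via \<phi> B\<^esub> x = \<zero>\<^bsub>module_via \<phi> B\<^esub>"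
        by (auto simp: module_via_def intro!: bexI[of _ "\<ominus>\<^bsub>B\<^esub> x"] B.l_neg)
    qed (auto simp: module_via_def B.a_ac)
  qed (auto simp: module_via_def B.l_distr B.r_distr B.m_assoc intro: R.is_cring)
qed

section \<open>Linear compactness\<close>

lemma (in ring_hom_ring) image_ideal:
  assumes "ideal D R" and surj: "h ` carrier R = carrier S"
  shows "ideal (h ` D) S"
proof -
  interpret D: ideal D R by (rule assms)
  show ?thesis
  proof (rule idealI)
    show "ring S" by (rule S.ring_axioms)
    show "subgroup (h ` D) (add_monoid S)"
    proof (rule subgroup.intro)
      show "h ` D \<subseteq> carrier (add_monoid S)" using D.a_subset by auto
      show "\<one>\<^bsub>add_monoid S\<^esub> \<in> h ` D" using hom_zero D.zero_closed by (metis imageI monoid.simps(2))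
      show "x \<otimes>\<^bsub>add_monoid S\<^esub> y \<in> h ` D" if xy: "x \<in> h ` D" "y \<in> h ` D" for x y
      proof -
        obtain a b where "a \<in> D" "b \<in> D" "x = h a" "y = h b" using xy by blast
        then show ?thesis by (auto intro!: image_eqI[of _ _ "a \<oplus> b"])
      qed
      show "inv\<^bsub>add_monoid S\<^esub> x \<in> h ` D" if x: "x \<in> h ` D" for x
      proof -
        obtain a where "a \<in> D" "x = h a" using x by blast
        then show ?thesis by (auto simp: a_inv_def[symmetric] intro!: image_eqI[of _ _ "\<ominus> a"])
      qed
    qed
    fix a x assume "a \<in> h ` D" "x \<in> carrier S"
    then obtain d t where "d \<in> D" "a = h d" "t \<in> carrier R" "x = h t" using surj by blast
    then show "x \<otimes>\<^bsub>S\<^esub> a \<in> h ` D" "a \<otimes>\<^bsub>S\<^esub> x \<in> h ` D"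
      using D.I_l_closed[of d t] D.I_r_closed[of d t] by (metis D.a_Hcarr hom_mult imageI)+
  qed
qed

text \<open>
  Linear compactness of \<open>W\<close> is used through a map \<open>\<pi>\<close> of \<open>T\<close> onto \<open>W\<close> that turns multiplication
  by \<open>t\<close> into the action of \<open>\<sigma> t\<close>.  Images of cosets of ideals are cosets of submodules, and a
  point of \<open>W\<close> in all images lifts to a point in all the cosets, because the ideals contain the
  kernel of \<open>\<pi>\<close>.
\<close>

lemma linearly_compact_chain_of_cosets:
  fixes T (structure) and W (structure)
  assumes cring: "cring T" and module: "module S W" and lc: "linearly_compact_discrete S W"
    and \<sigma>_surj: "carrier S = \<sigma> ` carrier T"
    and \<pi>_closed [simp]: "\<And>t. t \<in> carrier T \<Longrightarrow> \<pi> t \<in> carrier W"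
    and \<pi>_surj: "\<And>w. w \<in> carrier W \<Longrightarrow> \<exists>t\<in>carrier T. w = \<pi> t"
    and \<pi>_add: "\<And>x y. \<lbrakk>x \<in> carrier T; y \<in> carrier T\<rbrakk> \<Longrightarrow> \<pi> (x \<oplus>\<^bsub>T\<^esub> y) = \<pi> x \<oplus>\<^bsub>W\<^esub> \<pi> y"
    and \<pi>_smult: "\<And>t x. \<lbrakk>t \<in> carrier T; x \<in> carrier T\<rbrakk> \<Longrightarrow> \<pi> (t \<otimes>\<^bsub>T\<^esub> x) = \<sigma> t \<odot>\<^bsub>W\<^esub> \<pi> x"
    and \<pi>_zero: "\<pi> \<zero>\<^bsub>T\<^esub> = \<zero>\<^bsub>W\<^esub>"
    and \<pi>_eq: "\<And>x y. \<lbrakk>x \<in> carrier T; y \<in> carrier T; \<pi> x = \<pi> y\<rbrakk> \<Longrightarrow> x \<ominus>\<^bsub>T\<^esub> y \<in> D"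
    and cosets: "\<And>C. C \<in> \<C> \<Longrightarrow> \<exists>I. ideal I T \<and> D \<subseteq> I \<and> C \<in> a_rcosets I"
    and chain: "\<And>C C'. \<lbrakk>C \<in> \<C>; C' \<in> \<C>\<rbrakk> \<Longrightarrow> C \<subseteq> C' \<or> C' \<subseteq> C"
  shows "\<exists>z\<in>carrier T. \<forall>C\<in>\<C>. z \<in> C"
proof -
  interpret T: cring T by (rule cring)
  have coset_image: "\<exists>N. LinearCombinations.submodule S N W \<and> \<pi> ` C \<in> a_rcosets\<^bsub>W\<^esub> N"
    if C: "C \<in> \<C>" for C
  proof -
    obtain I where I: "ideal I T" "C \<in> a_rcosets I" using cosets[OF C] by blast
    interpret I: ideal I T by (rule I)
    obtain c where c: "c \<in> carrier T" "C = I +> c" using I by (auto simp: A_RCOSETS_def')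
    have "LinearCombinations.submodule S (\<pi> ` I) W"
      unfolding LinearCombinations.submodule_def
    proof (intro conjI allI impI)
      show "module S W" by (rule module)
      show "\<pi> ` I \<subseteq> carrier W" by auto
      show "v \<oplus>\<^bsub>W\<^esub> w \<in> \<pi> ` I" if "v \<in> \<pi> ` I" "w \<in> \<pi> ` I" for v w
        using that by (auto simp flip: \<pi>_add)
      show "\<zero>\<^bsub>W\<^esub> \<in> \<pi> ` I" using \<pi>_zero by (metis I.zero_closed imageI)
      show "s \<odot>\<^bsub>W\<^esub> v \<in> \<pi> ` I" if "s \<in> carrier S" "v \<in> \<pi> ` I" for s v
        using that by (auto simp: \<sigma>_surj I.I_l_closed simp flip: \<pi>_smult)
    qed
    moreover have "\<pi> ` C = \<pi> ` I +>\<^bsub>W\<^esub> \<pi> c"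
      using c I.a_subset by (force simp: a_r_coset_def' \<pi>_add image_iff)
    moreover have "\<pi> ` I +>\<^bsub>W\<^esub> \<pi> c \<in> a_rcosets\<^bsub>W\<^esub> (\<pi> ` I)"
      using c by (auto simp: A_RCOSETS_def')
    ultimately show ?thesis by metis
  qed
  \<comment> \<open>A finite chain has a least member, and all its elements witness the finite intersection.\<close>
  have fip: "carrier W \<inter> \<Inter>\<F> \<noteq> {}" if \<F>: "\<F> \<subseteq> (`) \<pi> ` \<C>" "finite \<F>" for \<F>
  proof (cases "\<F> = {}")
    case True
    then have "\<pi> \<zero> \<in> carrier W \<inter> \<Inter>\<F>" by simp
    then show ?thesis by blast
  next
    case False
    obtain \<F>' where \<F>': "\<F>' \<subseteq> \<C>" "finite \<F>'" "\<F> = (`) \<pi> ` \<F>'"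
      using finite_subset_image[OF \<F>(2,1)] by blast
    then obtain C where C: "C \<in> \<F>'" "\<And>C'. \<lbrakk>C' \<in> \<F>'; C' \<subseteq> C\<rbrakk> \<Longrightarrow> C = C'"
      using False finite_has_minimal[of \<F>'] by auto
    have least: "C \<subseteq> C'" if C': "C' \<in> \<F>'" for C'
      using chain[of C C'] C(1) C(2)[OF C'] \<F>'(1) C' by auto
    obtain I where I: "ideal I T" "C \<in> a_rcosets I" using cosets C \<F>'(1) by blast
    interpret I: ideal I T by (rule I)
    obtain c where c: "c \<in> carrier T" "c \<in> C"
      using I I.a_rcos_self by (auto simp: A_RCOSETS_def')
    then have "\<pi> c \<in> carrier W \<inter> \<Inter>\<F>" using least \<F>'(3) by auto
    then show ?thesis by blast
  qed
  have "carrier W \<inter> \<Inter>((`) \<pi> ` \<C>) \<noteq> {}"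
    using lc coset_image fip unfolding linearly_compact_discrete_def by (smt (verit) imageE)
  then obtain w where w: "w \<in> carrier W" "\<And>C. C \<in> \<C> \<Longrightarrow> w \<in> \<pi> ` C" by blast
  obtain z where z: "z \<in> carrier T" "w = \<pi> z" using \<pi>_surj w by blast
  have "z \<in> C" if C: "C \<in> \<C>" for C
  proof -
    obtain I where I: "ideal I T" "D \<subseteq> I" "C \<in> a_rcosets I" using cosets[OF C] by blast
    interpret I: ideal I T by (rule I)
    obtain c where c: "c \<in> carrier T" "C = I +> c" using I by (auto simp: A_RCOSETS_def')
    obtain c' where c': "c' \<in> C" "\<pi> z = \<pi> c'" using w(2)[OF C] z by auto
    have c'T: "c' \<in> carrier T" using c' c I.a_elemrcos_carrier by blast
    then have "z \<ominus> c' \<in> I" using \<pi>_eq z c' I by blast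
    then have "z \<in> I +> c'" using I.a_rcos_module_minus[OF T.ring_axioms c'T z(1)] by simp
    then show ?thesis using I.a_repr_independence'[of c' c] c c' by simp
  qed
  then show ?thesis using z by blast
qed

text \<open>
  For an ideal \<open>D\<close> that strictly contains \<open>K\<close>, the image of \<open>D\<close> in \<open>T / K\<close> is nonzero, so \<open>T / D\<close>,
  in the form \<open>(T / K) / (D / K)\<close>, is linearly compact.
\<close>

lemma almost_maximal_chain_of_cosets:
  fixes T (structure)
  assumes cring: "cring T" and K: "ideal K T" and am: "almost_maximal (T Quot K)"
    and D: "ideal D T" and KD: "K \<subset> D"
    and cosets: "\<And>C. C \<in> \<C> \<Longrightarrow> \<exists>I. ideal I T \<and> D \<subseteq> I \<and> C \<in> a_rcosets I"
    and chain: "\<And>C C'. \<lbrakk>C \<in> \<C>; C' \<in> \<C>\<rbrakk> \<Longrightarrow> C \<subseteq> C' \<or> C' \<subseteq> C"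
  shows "\<exists>z\<in>carrier T. \<forall>C\<in>\<C>. z \<in> C"
proof -
  define S where "S = T Quot K"
  define V where "V = module_via (\<lambda>s. s) S"
  define A where "A = (\<lambda>d. K +> d) ` D"
  interpret T: cring T by (rule cring)
  have S_carrier: "carrier S = (\<lambda>t. K +> t) ` carrier T"
    unfolding S_def FactRing_def A_RCOSETS_def' by auto
  have D_subset: "D \<subseteq> carrier T" using ideal.Icarr[OF D] by blast
  have q_eq: "K +> x = K +> y \<longleftrightarrow> x \<ominus> y \<in> K" if "x \<in> carrier T" "y \<in> carrier T" for x y
    using T.quotient_eq_iff_same_a_r_cos[OF K that] by blast
  interpret q: ring_hom_cring T S "\<lambda>t. K +> t"
    unfolding S_def by (rule ideal.rcos_ring_hom_cring[OF K cring])
  have idealA: "ideal A S"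
    unfolding A_def by (rule q.ring.image_ideal[OF D S_carrier[symmetric]])
  have A_nonzero: "A \<noteq> {\<zero>\<^bsub>S\<^esub>}"
  proof
    assume "A = {\<zero>\<^bsub>S\<^esub>}"
    then have "K +> d = K +> \<zero>" if "d \<in> D" for d using that by (auto simp: A_def)
    moreover have "d \<ominus> \<zero> = d" if "d \<in> D" for d using that D_subset by (auto simp: a_minus_def)
    ultimately have "D \<subseteq> K" using q_eq[OF _ T.zero_closed] D_subset by (metis subsetD subsetI)
    then show False using KD by blast
  qed
  have Vs: "carrier V = carrier S" "add V = add S" "\<zero>\<^bsub>V\<^esub> = \<zero>\<^bsub>S\<^esub>" "smult V = monoid.mult S"
    by (auto simp: V_def module_via_def)
  interpret V: module S V unfolding V_def
    by (rule module_via_module) (auto intro: q.S.is_cring simp: ring_hom_def)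
  have A_submodule: "LinearCombinations.submodule S A V"
    unfolding LinearCombinations.submodule_def
    using V.module_axioms ideal.Icarr[OF idealA] ideal.I_l_closed[OF idealA]
      additive_subgroup.a_closed[OF ideal.axioms(1)[OF idealA]]
      additive_subgroup.zero_closed[OF ideal.axioms(1)[OF idealA]] by (auto simp: Vs)
  interpret W: submodule_of S V A
    by (intro submodule_of.intro submodule_of_axioms.intro V.module_axioms A_submodule)
  define \<pi> where "\<pi> t = W.coset (K +> t)" for t
  let ?W = "W.quot"
  have lc: "linearly_compact_discrete S ?W"
    using am idealA A_nonzero unfolding almost_maximal_def S_def V_def by blast
  have \<pi>_closed [simp]: "\<pi> t \<in> carrier ?W" if "t \<in> carrier T" for t
    using that by (simp add: \<pi>_def Vs)
  have \<pi>_surj: "\<exists>t\<in>carrier T. w = \<pi> t" if "w \<in> carrier ?W" for w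
    using that by (auto simp: W.quot_carrier Vs S_carrier \<pi>_def)
  have \<pi>_add: "\<pi> (x \<oplus> y) = \<pi> x \<oplus>\<^bsub>?W\<^esub> \<pi> y" if "x \<in> carrier T" "y \<in> carrier T" for x y
    using that by (simp add: \<pi>_def W.quot_add Vs)
  have \<pi>_smult: "\<pi> (t \<otimes> x) = (K +> t) \<odot>\<^bsub>?W\<^esub> \<pi> x" if "t \<in> carrier T" "x \<in> carrier T" for t x
    using that by (simp add: \<pi>_def W.quot_smult Vs)
  have \<pi>_zero: "\<pi> \<zero> = \<zero>\<^bsub>?W\<^esub>"
    using W.N_zero by (simp add: \<pi>_def W.quot_zero W.coset_eq_N_iff Vs)
  have \<pi>_eq: "x \<ominus> y \<in> D" if "x \<in> carrier T" "y \<in> carrier T" "\<pi> x = \<pi> y" for x y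
  proof -
    have "(K +> x) \<ominus>\<^bsub>V\<^esub> (K +> y) \<in> A"
      using that by (simp add: \<pi>_def W.coset_eq_iff Vs)
    moreover have "a_inv V = a_inv S" by (rule ext) (simp add: a_inv_def m_inv_def Vs)
    then have "(K +> x) \<ominus>\<^bsub>V\<^esub> (K +> y) = K +> (x \<ominus> y)"
      using that by (simp add: a_minus_def Vs)
    ultimately obtain d where d: "d \<in> D" "K +> (x \<ominus> y) = K +> d" by (auto simp: A_def)
    have dT: "d \<in> carrier T" using d D_subset by blast
    have "(x \<ominus> y) \<ominus> d \<in> D" using that KD q_eq[of "x \<ominus> y" d] d dT by auto
    then have "((x \<ominus> y) \<ominus> d) \<oplus> d \<in> D"
      using d additive_subgroup.a_closed[OF ideal.axioms(1)[OF D]] by blast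
    moreover have "((x \<ominus> y) \<ominus> d) \<oplus> d = x \<ominus> y"
      using that dT by (simp add: a_minus_def T.a_assoc T.l_neg)
    ultimately show ?thesis by simp
  qed
  show ?thesis
    using linearly_compact_chain_of_cosets[OF cring W.quot_module lc S_carrier \<pi>_closed \<pi>_surj
        \<pi>_add \<pi>_smult \<pi>_zero \<pi>_eq cosets chain] .
qed

text \<open>
  Almost maximality only speaks about cosets of ideals that contain an ideal strictly larger than
  \<open>K\<close>, whereas the submodules \<open>r J\<close> of the ideal \<open>J\<close> may be contained in \<open>K\<close>.  If \<open>J\<close> is divisible
  outside \<open>K\<close>, each of the cosets is all of \<open>J\<close>.  Otherwise some \<open>b \<in> J\<close> lies outside \<open>t J\<close> with
  \<open>t \<notin> K\<close>; then \<open>t J\<close> lies in \<open>b R\<close>, and \<open>(t / b) J\<close> is an ideal of \<open>R\<close> that contains \<open>t\<close>.  In it,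
  every \<open>r (t / b) J\<close> with \<open>r\<close> a divisor of \<open>s\<close> contains \<open>t s\<close>, which is outside \<open>K\<close>.
\<close>

lemma (in valuation_ring) ideal_cosets_common_element:
  assumes J: "ideal J R" and K: "primeideal K R" and am: "almost_maximal (R Quot K)"
    and s: "s \<in> carrier R" "s \<notin> K"
    and \<Lambda>: "\<And>c r. (c, r) \<in> \<Lambda> \<Longrightarrow> c \<in> J \<and> r \<in> carrier R \<and> (\<exists>u\<in>carrier R. s = r \<otimes> u)"
    and compat: "\<And>c r c' r'. \<lbrakk>(c, r) \<in> \<Lambda>; (c', r') \<in> \<Lambda>\<rbrakk> \<Longrightarrow>
      (\<exists>j\<in>J. c' = c \<oplus> r \<otimes> j) \<or> (\<exists>j\<in>J. c' = c \<oplus> r' \<otimes> j)"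
  shows "\<exists>y\<in>J. \<forall>(c, r)\<in>\<Lambda>. \<exists>j\<in>J. y = c \<oplus> r \<otimes> j"
proof (cases "\<forall>t\<in>carrier R - K. \<forall>b\<in>J. \<exists>j\<in>J. b = t \<otimes> j")
  interpret J: ideal J R by (rule J)
  interpret K: primeideal K R by (rule K)
  case True
  have "\<exists>j\<in>J. \<zero> = c \<oplus> r \<otimes> j" if "(c, r) \<in> \<Lambda>" for c r
  proof -
    have c: "c \<in> J" "r \<in> carrier R" using \<Lambda>[OF that] by auto
    have "r \<notin> K" using \<Lambda>[OF that] s K.I_r_closed by blast
    then obtain j where j: "j \<in> J" "\<ominus> c = r \<otimes> j" using True c by blast
    then have "\<zero> = c \<oplus> r \<otimes> j" using c by (simp add: r_neg flip: j(2))
    then show ?thesis using j by blast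
  qed
  then show ?thesis using J.zero_closed by blast
next
  interpret J: ideal J R by (rule J)
  have K_ideal: "ideal K R" using K by (simp add: primeideal_def)
  case False
  then obtain t b where t: "t \<in> carrier R" "t \<notin> K" and b: "b \<in> J" "\<And>j. j \<in> J \<Longrightarrow> b \<noteq> t \<otimes> j"
    by blast
  have bR [simp]: "b \<in> carrier R" using b by simp
  have [simp]: "t \<in> carrier R" "s \<in> carrier R" using t s by auto
  have JR [simp]: "j \<in> carrier R" if "j \<in> J" for j using that by simp
  have b_dvd: "\<exists>w\<in>carrier R. t \<otimes> j = b \<otimes> w" if j: "j \<in> J" for j
  proof (rule ccontr)
    assume "\<not> ?thesis"
    then obtain w where w: "w \<in> carrier R" "b = t \<otimes> j \<otimes> w"
      using divides_total[of b "t \<otimes> j"] j t by auto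
    then have "b = t \<otimes> (j \<otimes> w)" using j t by (simp add: m_assoc)
    then show False using b(2) J.I_r_closed j w by blast
  qed
  \<comment> \<open>\<open>I r\<close> is \<open>r (t / b) J\<close>, and \<open>C c r\<close> is the image of \<open>c + r J\<close> under multiplication by
    \<open>t / b\<close>, both written without division.\<close>
  define I where "I r = {z \<in> carrier R. \<exists>j\<in>J. b \<otimes> z = t \<otimes> (r \<otimes> j)}" for r
  define C where "C c r = {z \<in> carrier R. \<exists>j\<in>J. b \<otimes> z = t \<otimes> (c \<oplus> r \<otimes> j)}" for c r
  define D where "D = PIdl (t \<otimes> s)"
  have D: "ideal D R" unfolding D_def by (rule cgenideal_ideal) simp
  have ts: "t \<otimes> s \<notin> K" using t s primeideal.I_prime[OF K] by blast
  have "K \<subset> D"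
  proof
    show "K \<subseteq> D"
    proof
      fix k assume k: "k \<in> K"
      have "t \<otimes> s \<noteq> k \<otimes> c" if "c \<in> carrier R" for c
        using ts ideal.I_r_closed[OF K_ideal k that] by auto
      then obtain c where "c \<in> carrier R" "k = (t \<otimes> s) \<otimes> c"
        using divides_total[of k "t \<otimes> s"] ideal.Icarr[OF K_ideal k] by auto
      then show "k \<in> D" unfolding D_def cgenideal_def by (auto simp: m_comm)
    qed
    show "K \<noteq> D" using ts cgenideal_self[of "t \<otimes> s"] by (auto simp: D_def)
  qed
  have I_ideal: "ideal (I r) R" if [simp]: "r \<in> carrier R" for r
  proof (rule idealI)
    show "ring R" by (rule ring_axioms)
    show "subgroup (I r) (add_monoid R)"
    proof (rule subgroup.intro)
      show "I r \<subseteq> carrier (add_monoid R)" by (auto simp: I_def)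
      show "\<one>\<^bsub>add_monoid R\<^esub> \<in> I r" by (auto simp: I_def intro!: bexI[of _ \<zero>])
      show "x \<otimes>\<^bsub>add_monoid R\<^esub> y \<in> I r" if x: "x \<in> I r" and y: "y \<in> I r" for x y
      proof -
        obtain i j where "i \<in> J" "j \<in> J" "b \<otimes> x = t \<otimes> (r \<otimes> i)" "b \<otimes> y = t \<otimes> (r \<otimes> j)"
          "x \<in> carrier R" "y \<in> carrier R"
          using x y by (auto simp: I_def)
        then show ?thesis by (auto simp: I_def r_distr intro!: bexI[of _ "i \<oplus> j"])
      qed
      show "inv\<^bsub>add_monoid R\<^esub> x \<in> I r" if x: "x \<in> I r" for x
      proof -
        obtain i where "i \<in> J" "b \<otimes> x = t \<otimes> (r \<otimes> i)" "x \<in> carrier R"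
          using x by (auto simp: I_def)
        then show ?thesis
          by (auto simp: I_def r_minus a_inv_def[symmetric] intro!: bexI[of _ "\<ominus> i"])
      qed
    qed
    fix a x assume a: "a \<in> I r" and x: "x \<in> carrier R"
    obtain i where "i \<in> J" "b \<otimes> a = t \<otimes> (r \<otimes> i)" "a \<in> carrier R"
      using a by (auto simp: I_def)
    moreover from this have "b \<otimes> (x \<otimes> a) = t \<otimes> (r \<otimes> (x \<otimes> i))"
      using x m_lcomm[of b x a] by (simp add: m_ac)
    ultimately show "x \<otimes> a \<in> I r" "a \<otimes> x \<in> I r"
      using x J.I_l_closed by (auto simp: I_def m_comm[of a x])
  qed
  have C_coset: "C c r \<in> a_rcosets (I r)" if c: "(c, r) \<in> \<Lambda>" for c r
  proof -
    have [simp]: "c \<in> J" "r \<in> carrier R" using \<Lambda>[OF c] by auto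
    obtain w where w: "w \<in> carrier R" "t \<otimes> c = b \<otimes> w" using b_dvd[of c] by auto
    have Ir: "ideal (I r) R" by (rule I_ideal) simp
    have Ir_sub: "abelian_subgroup (I r) R"
      by (rule abelian_subgroupI3[OF ideal.axioms(1)[OF Ir] is_abelian_group])
    have "z \<in> C c r \<longleftrightarrow> z \<in> I r +> w" if z: "z \<in> carrier R" for z
    proof -
      have "(b \<otimes> z = t \<otimes> (c \<oplus> r \<otimes> j)) = (b \<otimes> (z \<ominus> w) = t \<otimes> (r \<otimes> j))" if "j \<in> J" for j
      proof -
        have tc: "t \<otimes> (c \<oplus> r \<otimes> j) = b \<otimes> w \<oplus> t \<otimes> (r \<otimes> j)"
          using that w by (simp add: r_distr)
        have bz: "b \<otimes> (z \<ominus> w) = b \<otimes> z \<ominus> b \<otimes> w"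
          using z w by (simp add: r_distr a_minus_def r_minus)
        show ?thesis
          unfolding tc bz using that w(1) z by (intro eq_add_iff_minus_eq) simp_all
      qed
      then have "z \<in> C c r \<longleftrightarrow> (\<exists>j\<in>J. b \<otimes> (z \<ominus> w) = t \<otimes> (r \<otimes> j))"
        using z by (simp add: C_def cong: bex_cong)
      also have "\<dots> \<longleftrightarrow> z \<ominus> w \<in> I r" using z w(1) by (simp add: I_def)
      also have "\<dots> \<longleftrightarrow> z \<in> I r +> w"
        using abelian_subgroup.a_rcos_module_minus[OF Ir_sub ring_axioms w(1) z] by simp
      finally show ?thesis .
    qed
    moreover have "C c r \<subseteq> carrier R" by (auto simp: C_def)
    moreover have "I r +> w \<subseteq> carrier R" using abelian_subgroup.a_elemrcos_carrier[OF Ir_sub w(1)] by blast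
    ultimately have "C c r = I r +> w" by (intro subset_antisym subsetI) (metis subsetD)+
    then show ?thesis using w by (auto simp: A_RCOSETS_def')
  qed
  have C_sub: "C c' (r \<otimes> u) \<subseteq> C c r"
    if "c \<in> J" "c' \<in> J" "r \<in> carrier R" "u \<in> carrier R" "i \<in> J" "c' = c \<oplus> r \<otimes> i" for c c' r u i
  proof
    fix z assume "z \<in> C c' (r \<otimes> u)"
    then obtain j where j: "z \<in> carrier R" "j \<in> J" "b \<otimes> z = t \<otimes> (c' \<oplus> r \<otimes> u \<otimes> j)"
      by (auto simp: C_def)
    have "c' \<oplus> r \<otimes> u \<otimes> j = c \<oplus> r \<otimes> (i \<oplus> u \<otimes> j)"
      using that j by (simp add: r_distr m_assoc a_assoc)
    moreover have "i \<oplus> u \<otimes> j \<in> J" using that j by (simp add: J.I_l_closed)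
    ultimately show "z \<in> C c r" using j by (auto simp: C_def)
  qed
  have chain: "C c' r' \<subseteq> C c r \<or> C c r \<subseteq> C c' r'"
    if as: "(c, r) \<in> \<Lambda>" "(c', r') \<in> \<Lambda>" "u \<in> carrier R" "r' = r \<otimes> u" for c r c' r' u
  proof -
    have [simp]: "c \<in> J" "c' \<in> J" "r \<in> carrier R" using \<Lambda> as by auto
    have "\<exists>i\<in>J. c' = c \<oplus> r \<otimes> i"
    proof -
      consider "\<exists>i\<in>J. c' = c \<oplus> r \<otimes> i" | i where "i \<in> J" "c' = c \<oplus> r \<otimes> u \<otimes> i"
        using compat[OF as(1,2)] as(4) by blast
      then show ?thesis
      proof cases
        case 2
        then have "u \<otimes> i \<in> J" "c' = c \<oplus> r \<otimes> (u \<otimes> i)"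
          using as(3) by (simp_all add: J.I_l_closed m_assoc)
        then show ?thesis by blast
      qed
    qed
    then obtain i where "i \<in> J" "c' = c \<oplus> r \<otimes> i" by blast
    then show ?thesis
      using C_sub[OF \<open>c \<in> J\<close> \<open>c' \<in> J\<close> \<open>r \<in> carrier R\<close> as(3)] as(4) by blast
  qed
  have "\<exists>z\<in>carrier R. \<forall>X\<in>(\<lambda>(c, r). C c r) ` \<Lambda>. z \<in> X"
  proof (rule almost_maximal_chain_of_cosets[OF is_cring K_ideal am D \<open>K \<subset> D\<close>])
    fix X assume "X \<in> (\<lambda>(c, r). C c r) ` \<Lambda>"
    then obtain c r where c: "(c, r) \<in> \<Lambda>" "X = C c r" by auto
    then obtain u where u: "u \<in> carrier R" "s = r \<otimes> u" and [simp]: "r \<in> carrier R" using \<Lambda> by auto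
    have Ir: "ideal (I r) R" by (rule I_ideal) simp
    have "b \<otimes> (t \<otimes> s) = t \<otimes> (r \<otimes> (u \<otimes> b))" using u by (simp add: m_ac)
    then have "t \<otimes> s \<in> I r" using u b by (auto simp: I_def J.I_l_closed)
    then have "D \<subseteq> I r" unfolding D_def by (rule cgenideal_minimal[OF Ir])
    then show "\<exists>I. ideal I R \<and> D \<subseteq> I \<and> X \<in> a_rcosets I"
      using C_coset c Ir by blast
  next
    fix X X' assume "X \<in> (\<lambda>(c, r). C c r) ` \<Lambda>" "X' \<in> (\<lambda>(c, r). C c r) ` \<Lambda>"
    then obtain c r c' r' where c: "(c, r) \<in> \<Lambda>" "X = C c r" "(c', r') \<in> \<Lambda>" "X' = C c' r'" by auto
    have r: "r \<in> carrier R" "r' \<in> carrier R" using \<Lambda> c by auto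
    consider u where "u \<in> carrier R" "r' = r \<otimes> u" | u where "u \<in> carrier R" "r = r' \<otimes> u"
      using divides_total[OF r] by blast
    then show "X \<subseteq> X' \<or> X' \<subseteq> X"
    proof cases
      case 1 then show ?thesis using chain[OF c(1,3)] c(2,4) by blast
    next
      case 2 then show ?thesis using chain[OF c(3,1)] c(2,4) by blast
    qed
  qed
  then obtain z where z: "z \<in> carrier R" "\<And>c r. (c, r) \<in> \<Lambda> \<Longrightarrow> z \<in> C c r" by auto
  show ?thesis
  proof (cases "\<Lambda> = {}")
    case True
    then show ?thesis using J.zero_closed by blast
  next
    case False
    then obtain c r where c: "(c, r) \<in> \<Lambda>" by auto
    obtain j where j: "j \<in> J" "b \<otimes> z = t \<otimes> (c \<oplus> r \<otimes> j)" using z(2)[OF c] by (auto simp: C_def)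
    \<comment> \<open>Scaling back by \<open>b / t\<close>: \<open>y\<close> is \<open>(b / t) z\<close>, whichever coset is used to compute it.\<close>
    define y where "y = c \<oplus> r \<otimes> j"
    have yJ: "y \<in> J" using j \<Lambda>[OF c] by (auto simp: y_def J.I_l_closed)
    have t0: "t \<noteq> \<zero>"
      using t(2) additive_subgroup.zero_closed[OF ideal.axioms(1)[OF K_ideal]] by metis
    have "\<exists>j\<in>J. y = c' \<oplus> r' \<otimes> j" if c': "(c', r') \<in> \<Lambda>" for c' r'
    proof -
      obtain j' where j': "j' \<in> J" "b \<otimes> z = t \<otimes> (c' \<oplus> r' \<otimes> j')"
        using z(2)[OF c'] by (auto simp: C_def)
      then have "t \<otimes> y = t \<otimes> (c' \<oplus> r' \<otimes> j')" using j y_def by simp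
      moreover have "y \<in> carrier R" using yJ by simp
      moreover have "c' \<oplus> r' \<otimes> j' \<in> carrier R" using j'(1) \<Lambda>[OF c'] by simp
      ultimately have "y = c' \<oplus> r' \<otimes> j'"
        using m_lcancel[OF t0 t(1)] by simp
      then show ?thesis using j' by blast
    qed
    then show ?thesis using yJ by auto
  qed
qed

section \<open>Torsion-free modules over a valuation domain\<close>

text \<open>For a torsion-free module and a prime \<open>L\<close>, this says that \<open>R\<^sub>L\<close> acts on the module.\<close>

definition divisible_outside ::
  "('a, 'r) ring_scheme \<Rightarrow> 'a set \<Rightarrow> ('a, 'b, 'c) module_scheme \<Rightarrow> bool" where
  "divisible_outside R L M \<longleftrightarrow>
    (\<forall>s\<in>carrier R - L. \<forall>x\<in>carrier M. \<exists>y\<in>carrier M. x = s \<odot>\<^bsub>M\<^esub> y)"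

text \<open>
  Strict chains of pure submodules replace the rank in the induction: their length is bounded by
  the rank, and a chain in a quotient pulls back to a chain of the same length.
\<close>

definition pure_chain ::
  "('a, 'r) ring_scheme \<Rightarrow> ('a, 'b, 'c) module_scheme \<Rightarrow> nat \<Rightarrow> (nat \<Rightarrow> 'b set) \<Rightarrow> bool" where
  "pure_chain R M n C \<longleftrightarrow>
    (\<forall>i\<le>n. pure_submodule R (C i) M) \<and> (\<forall>i<n. C i \<subset> C (Suc i))"

abbreviation ideal_module ::
  "('a, 'r) ring_scheme \<Rightarrow> 'a set \<Rightarrow> ('a \<times> 'a) set set \<Rightarrow> ('a, ('a \<times> 'a) set) module" where
  "ideal_module R L I \<equiv>
    (module_via (to_localization_at R L) (localization_at R L))\<lparr>carrier := I\<rparr>"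

text \<open>The number \<open>n\<close> of summands is explicit because it is what a maximal sum maximizes.\<close>

definition ideal_sum_iso ::
  "('a, 'r) ring_scheme \<Rightarrow> 'a set \<Rightarrow> nat \<Rightarrow> ('a, 'b, 'c) module_scheme \<Rightarrow> bool" where
  "ideal_sum_iso R L n M \<longleftrightarrow>
    (\<exists>I. (\<forall>i<n. ideal (I i) (localization_at R L)) \<and>
       module_isomorphic R M (finite_direct_sum n (\<lambda>i. ideal_module R L (I i))))"

lemma finite_direct_sum_cong:
  assumes "\<And>i. i < n \<Longrightarrow> N i = N' i"
  shows "finite_direct_sum n N = finite_direct_sum n N'"
proof -
  have "(\<Pi>\<^sub>E i\<in>{..<n}. carrier (N i)) = (\<Pi>\<^sub>E i\<in>{..<n}. carrier (N' i))"
    using assms by (intro PiE_cong) simp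
  then show ?thesis
    using assms by (simp add: finite_direct_sum_def restrict_def fun_eq_iff)
qed

text \<open>
  The isomorphism sends \<open>b + z\<close> to the family \<open>f b\<close> extended by the entry \<open>g z\<close> at index \<open>n\<close>.
\<close>

lemma module_isomorphic_direct_sum_Suc:
  fixes M (structure)
  assumes B: "submodule_of R M B" and X: "submodule_of R M X" and BX: "B \<inter> X = {\<zero>\<^bsub>M\<^esub>}"
    and f: "f \<in> module_hom R (M\<lparr>carrier := B\<rparr>) (finite_direct_sum n N)"
      "bij_betw f B (carrier (finite_direct_sum n N))"
    and g: "g \<in> module_hom R (M\<lparr>carrier := X\<rparr>) (N n)" "bij_betw g X (carrier (N n))"
  shows "module_isomorphic R (M\<lparr>carrier := {b \<oplus> z | b z. b \<in> B \<and> z \<in> X}\<rparr>)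
    (finite_direct_sum (Suc n) N)"
proof -
  interpret B: submodule_of R M B by (rule B)
  interpret X: submodule_of R M X by (rule X)
  have uniq: "b = b' \<and> z = z'"
    if "b \<oplus> z = b' \<oplus> z'" "b \<in> B" "z \<in> X" "b' \<in> B" "z' \<in> X" for b z b' z'
  proof -
    have [simp]: "b \<in> carrier M" "b' \<in> carrier M" "z \<in> carrier M" "z' \<in> carrier M"
      using that B.N_subset X.N_subset by auto
    have "(b' \<oplus> z') \<ominus> z = b"
      using that(1) B.M.eq_add_iff_minus_eq[of "b' \<oplus> z'" z b] by (simp add: B.M.a_comm)
    then have "b = b' \<oplus> (z' \<ominus> z)" by (simp add: B.M.minus_eq B.M.a_assoc)
    then have "b \<ominus> b' = z' \<ominus> z" using B.M.eq_add_iff_minus_eq[of b b' "z' \<ominus> z"] by simp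
    then have "b \<ominus> b' \<in> B \<inter> X" using that B.N_minus[of b b'] X.N_minus[of z' z] by simp
    then have "b \<ominus> b' = \<zero>" "z' \<ominus> z = \<zero>" using BX \<open>b \<ominus> b' = z' \<ominus> z\<close> by auto
    then show ?thesis by simp
  qed
  define h where "h y = (let p = (SOME p. fst p \<in> B \<and> snd p \<in> X \<and> y = fst p \<oplus> snd p)
    in (f (fst p))(n := g (snd p)))" for y
  have h: "h (b \<oplus> z) = (f b)(n := g z)" if "b \<in> B" "z \<in> X" for b z
  proof -
    have "(SOME p. fst p \<in> B \<and> snd p \<in> X \<and> b \<oplus> z = fst p \<oplus> snd p) = (b, z)"
    proof (rule some_equality)
      fix p assume p: "fst p \<in> B \<and> snd p \<in> X \<and> b \<oplus> z = fst p \<oplus> snd p"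
      then have "b = fst p \<and> z = snd p" using uniq that by blast
      then show "p = (b, z)" by (simp add: prod_eq_iff)
    qed (simp add: that)
    then show ?thesis by (simp add: h_def)
  qed
  have f_mem: "f b \<in> (\<Pi>\<^sub>E i\<in>{..<n}. carrier (N i))" if "b \<in> B" for b
    using module_hom_closed[OF f(1)] that by (auto simp: finite_direct_sum_def)
  have g_mem: "g z \<in> carrier (N n)" if "z \<in> X" for z
    using module_hom_closed[OF g(1)] that by auto
  have f_add: "f (b \<oplus> b') = (\<lambda>i\<in>{..<n}. f b i \<oplus>\<^bsub>N i\<^esub> f b' i)" if "b \<in> B" "b' \<in> B" for b b'
    using module_hom_add[OF f(1)] that by (simp add: finite_direct_sum_def)
  have g_add: "g (z \<oplus> z') = g z \<oplus>\<^bsub>N n\<^esub> g z'" if "z \<in> X" "z' \<in> X" for z z'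
    using module_hom_add[OF g(1)] that by simp
  have f_smult: "f (r \<odot> b) = (\<lambda>i\<in>{..<n}. r \<odot>\<^bsub>N i\<^esub> f b i)" if "r \<in> carrier R" "b \<in> B" for r b
    using module_hom_smult[OF f(1)] that by (simp add: finite_direct_sum_def)
  have g_smult: "g (r \<odot> z) = r \<odot>\<^bsub>N n\<^esub> g z" if "r \<in> carrier R" "z \<in> X" for r z
    using module_hom_smult[OF g(1)] that by simp
  let ?BX = "{b \<oplus> z | b z. b \<in> B \<and> z \<in> X}"
  have h_hom: "h \<in> module_hom R (M\<lparr>carrier := ?BX\<rparr>) (finite_direct_sum (Suc n) N)"
    unfolding module_hom_def
  proof (intro CollectI conjI allI impI)
    show "h \<in> carrier (M\<lparr>carrier := ?BX\<rparr>) \<rightarrow> carrier (finite_direct_sum (Suc n) N)"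
      using f_mem g_mem by (fastforce simp: finite_direct_sum_def h PiE_iff extensional_def less_Suc_eq)
  next
    fix y y' assume "y \<in> carrier (M\<lparr>carrier := ?BX\<rparr>) \<and> y' \<in> carrier (M\<lparr>carrier := ?BX\<rparr>)"
    then obtain b z b' z' where y: "b \<in> B" "z \<in> X" "b' \<in> B" "z' \<in> X" "y = b \<oplus> z" "y' = b' \<oplus> z'"
      by auto
    have "y \<oplus> y' = (b \<oplus> b') \<oplus> (z \<oplus> z')" using y by (simp add: B.M.a_ac)
    then have "h (y \<oplus> y') = (f (b \<oplus> b'))(n := g (z \<oplus> z'))" using y by (simp add: h)
    also have "\<dots> = h y \<oplus>\<^bsub>finite_direct_sum (Suc n) N\<^esub> h y'"
      using y by (auto simp: finite_direct_sum_def h f_add g_add fun_eq_iff restrict_def)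
    finally show "h (y \<oplus>\<^bsub>M\<lparr>carrier := ?BX\<rparr>\<^esub> y') = h y \<oplus>\<^bsub>finite_direct_sum (Suc n) N\<^esub> h y'"
      by simp
  next
    fix r y assume ry: "r \<in> carrier R \<and> y \<in> carrier (M\<lparr>carrier := ?BX\<rparr>)"
    then obtain b z where y: "b \<in> B" "z \<in> X" "y = b \<oplus> z" by auto
    have "r \<odot> y = r \<odot> b \<oplus> r \<odot> z" using y ry by (simp add: B.smult_r_distr)
    then have "h (r \<odot> y) = (f (r \<odot> b))(n := g (r \<odot> z))" using y ry by (simp add: h)
    also have "\<dots> = r \<odot>\<^bsub>finite_direct_sum (Suc n) N\<^esub> h y"
      using y ry by (auto simp: finite_direct_sum_def h f_smult g_smult fun_eq_iff restrict_def)
    finally show "h (r \<odot>\<^bsub>M\<lparr>carrier := ?BX\<rparr>\<^esub> y) = r \<odot>\<^bsub>finite_direct_sum (Suc n) N\<^esub> h y"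
      by simp
  qed
  have h_bij: "bij_betw h ?BX (carrier (finite_direct_sum (Suc n) N))"
    unfolding bij_betw_def
  proof
    show "inj_on h ?BX"
    proof (rule inj_onI)
      fix y y' assume "y \<in> ?BX" "y' \<in> ?BX" and eq: "h y = h y'"
      then obtain b z b' z' where y: "b \<in> B" "z \<in> X" "b' \<in> B" "z' \<in> X" "y = b \<oplus> z" "y' = b' \<oplus> z'"
        by auto
      have *: "(f b)(n := g z) = (f b')(n := g z')" using eq y by (simp add: h)
      then have "g z = g z'" by (metis fun_upd_same)
      moreover have "f b = f b'"
      proof (rule PiE_ext[OF f_mem[OF y(1)] f_mem[OF y(3)]])
        fix i assume "i \<in> {..<n}"
        then show "f b i = f b' i" using fun_cong[OF *, of i] by auto
      qed
      ultimately show "y = y'"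
        using y f(2) g(2) by (metis bij_betw_imp_inj_on inj_onD)
    qed
    show "h ` ?BX = carrier (finite_direct_sum (Suc n) N)"
    proof
      show "h ` ?BX \<subseteq> carrier (finite_direct_sum (Suc n) N)"
        using f_mem g_mem by (fastforce simp: finite_direct_sum_def h PiE_iff extensional_def less_Suc_eq)
      show "carrier (finite_direct_sum (Suc n) N) \<subseteq> h ` ?BX"
      proof
        fix w assume "w \<in> carrier (finite_direct_sum (Suc n) N)"
        then have w: "w \<in> (\<Pi>\<^sub>E i\<in>{..<Suc n}. carrier (N i))" by (simp add: finite_direct_sum_def)
        have "restrict w {..<n} \<in> carrier (finite_direct_sum n N)"
          using w by (auto simp: finite_direct_sum_def PiE_iff)
        then obtain b where b: "b \<in> B" "f b = restrict w {..<n}"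
          using f(2) by (metis bij_betw_imp_surj_on imageE)
        have "w n \<in> carrier (N n)" using w by (auto simp: PiE_iff)
        then obtain z where z: "z \<in> X" "g z = w n" using g(2) by (metis bij_betw_imp_surj_on imageE)
        have "(f b)(n := g z) = w"
          using w unfolding b(2) z(2) by (auto simp: fun_eq_iff PiE_iff extensional_def restrict_def)
        then have "h (b \<oplus> z) = w" using b z by (simp add: h)
        then show "w \<in> h ` ?BX" using b z by blast
      qed
    qed
  qed
  show ?thesis unfolding module_isomorphic_def by (rule bexI[OF _ h_hom]) (use h_bij in simp)
qed

locale tf_module = valuation_ring R + module R M for R (structure) and M (structure) +
  assumes torsion_free: "torsion_free R M"
begin

abbreviation scale (infixl "\<cdot>" 70) where
  "r \<cdot> x \<equiv> r \<odot>\<^bsub>M\<^esub> x"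

lemma smult_eq_zero:
  "\<lbrakk>r \<cdot> x = \<zero>\<^bsub>M\<^esub>; r \<in> carrier R; x \<in> carrier M; r \<noteq> \<zero>\<rbrakk> \<Longrightarrow> x = \<zero>\<^bsub>M\<^esub>"
  using torsion_free unfolding torsion_free_def by blast

lemma smult_r_diff:
  "\<lbrakk>r \<in> carrier R; x \<in> carrier M; y \<in> carrier M\<rbrakk> \<Longrightarrow>
    r \<cdot> (x \<ominus>\<^bsub>M\<^esub> y) = r \<cdot> x \<ominus>\<^bsub>M\<^esub> r \<cdot> y"
  by (simp add: a_minus_def smult_r_distr smult_r_minus)

lemma smult_l_diff:
  "\<lbrakk>r \<in> carrier R; s \<in> carrier R; x \<in> carrier M\<rbrakk> \<Longrightarrow>
    (r \<ominus> s) \<cdot> x = r \<cdot> x \<ominus>\<^bsub>M\<^esub> s \<cdot> x"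
  by (simp add: a_minus_def smult_l_distr smult_l_minus)

lemma smult_cancel:
  assumes "r \<cdot> x = r \<cdot> y" "r \<in> carrier R" "x \<in> carrier M" "y \<in> carrier M" "r \<noteq> \<zero>"
  shows "x = y"
proof -
  have "r \<cdot> (x \<ominus>\<^bsub>M\<^esub> y) = \<zero>\<^bsub>M\<^esub>" using assms by (simp add: smult_r_diff)
  then have "x \<ominus>\<^bsub>M\<^esub> y = \<zero>\<^bsub>M\<^esub>" using assms smult_eq_zero by simp
  then show ?thesis using assms by simp
qed

lemma smult_cancel_right:
  assumes "r \<cdot> x = s \<cdot> x" "r \<in> carrier R" "s \<in> carrier R" "x \<in> carrier M" "x \<noteq> \<zero>\<^bsub>M\<^esub>"
  shows "r = s"
proof -
  have "(r \<ominus> s) \<cdot> x = \<zero>\<^bsub>M\<^esub>" using assms by (simp add: smult_l_diff)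
  then have "r \<ominus> s = \<zero>" using assms smult_eq_zero[of "r \<ominus> s" x] by blast
  then show ?thesis using assms by simp
qed

lemma smult_lcomm:
  "\<lbrakk>r \<in> carrier R; s \<in> carrier R; x \<in> carrier M\<rbrakk> \<Longrightarrow>
    r \<cdot> (s \<cdot> x) = s \<cdot> (r \<cdot> x)"
  by (metis m_comm smult_assoc1)

text \<open>
  In a torsion-free module purity says that the quotient is torsion-free.
\<close>

lemma pure_submodule_iff:
  "pure_submodule R N M \<longleftrightarrow> LinearCombinations.submodule R N M \<and>
    (\<forall>r\<in>carrier R - {\<zero>}. \<forall>y\<in>carrier M. r \<cdot> y \<in> N \<longrightarrow> y \<in> N)"
proof (cases "LinearCombinations.submodule R N M")
  case True
  interpret N: submodule_of R M N
    by (intro submodule_of.intro submodule_of_axioms.intro module_axioms True)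
  have "((\<lambda>x. r \<cdot> x) ` N = N \<inter> (\<lambda>x. r \<cdot> x) ` carrier M) \<longleftrightarrow>
    (\<forall>y\<in>carrier M. r \<cdot> y \<in> N \<longrightarrow> y \<in> N)" if r: "r \<in> carrier R" "r \<noteq> \<zero>" for r
  proof
    assume eq: "(\<lambda>x. r \<cdot> x) ` N = N \<inter> (\<lambda>x. r \<cdot> x) ` carrier M"
    show "\<forall>y\<in>carrier M. r \<cdot> y \<in> N \<longrightarrow> y \<in> N"
    proof (intro ballI impI)
      fix y assume y: "y \<in> carrier M" "r \<cdot> y \<in> N"
      then obtain x where x: "x \<in> N" "r \<cdot> y = r \<cdot> x" using eq by blast
      then have "y = x" using smult_cancel[OF x(2)] r y N.N_subset by blast
      then show "y \<in> N" using x by simp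
    qed
  next
    assume "\<forall>y\<in>carrier M. r \<cdot> y \<in> N \<longrightarrow> y \<in> N"
    then show "(\<lambda>x. r \<cdot> x) ` N = N \<inter> (\<lambda>x. r \<cdot> x) ` carrier M"
      using r N.N_subset N.N_smult by blast
  qed
  moreover have "(\<lambda>x. \<zero> \<cdot> x) ` N = N \<inter> (\<lambda>x. \<zero> \<cdot> x) ` carrier M"
  proof -
    have "(\<lambda>x. \<zero> \<cdot> x) ` N = {\<zero>\<^bsub>M\<^esub>}" "(\<lambda>x. \<zero> \<cdot> x) ` carrier M = {\<zero>\<^bsub>M\<^esub>}"
      using image_constant[OF N.N_zero, of "\<zero>\<^bsub>M\<^esub>"] image_constant[OF M.zero_closed, of "\<zero>\<^bsub>M\<^esub>"]
      by (simp_all cong: image_cong_simp)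
    then show ?thesis using N.N_zero by simp
  qed
  ultimately show ?thesis unfolding pure_submodule_def using True by (metis Diff_iff singletonD singletonI)
qed (simp add: pure_submodule_def)

lemma submodule_ofI:
  assumes "N \<subseteq> carrier M" "\<zero>\<^bsub>M\<^esub> \<in> N"
    "\<And>x y. \<lbrakk>x \<in> N; y \<in> N\<rbrakk> \<Longrightarrow> x \<oplus>\<^bsub>M\<^esub> y \<in> N"
    "\<And>r x. \<lbrakk>r \<in> carrier R; x \<in> N\<rbrakk> \<Longrightarrow> r \<cdot> x \<in> N"
  shows "submodule_of R M N"
  using assms
  by (intro submodule_of.intro submodule_of_axioms.intro module_axioms)
    (simp add: LinearCombinations.submodule_def module_axioms)

lemma pure_submodule_of: "pure_submodule R N M \<Longrightarrow> submodule_of R M N"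
  by (simp add: pure_submodule_def submodule_of_def submodule_of_axioms_def module_axioms)

lemma pureD:
  "\<lbrakk>pure_submodule R N M; r \<cdot> y \<in> N; r \<in> carrier R; r \<noteq> \<zero>; y \<in> carrier M\<rbrakk> \<Longrightarrow> y \<in> N"
  by (auto simp: pure_submodule_iff)

lemma pure_zero: "pure_submodule R {\<zero>\<^bsub>M\<^esub>} M"
  unfolding pure_submodule_iff
  using submodule_ofI[of "{\<zero>\<^bsub>M\<^esub>}"] smult_eq_zero by (auto simp: submodule_of_def submodule_of_axioms_def)

end

section \<open>Enlarging a pure sum of ideals\<close>

locale divisible_tf_module = tf_module +
  fixes L
  assumes prime: "primeideal L R" and divisible: "divisible_outside R L M"
begin

sublocale D: denominators R "carrier R - L"
  by (rule denominators_prime[OF prime])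

abbreviation "T \<equiv> localization_at R L"

lemma T_loc: "T = D.loc"
  by (simp add: localization_at_def)

lemma divisibleE:
  assumes "s \<in> carrier R" "s \<notin> L" "x \<in> carrier M"
  obtains y where "y \<in> carrier M" "x = s \<cdot> y"
  using divisible assms unfolding divisible_outside_def by blast

lemma outside_nonzero: "s \<in> carrier R - L \<Longrightarrow> s \<noteq> \<zero>"
  by (rule D.denominator_nonzero)

text \<open>
  The elements \<open>(a / q) (x / s)\<close> that exist in \<open>M\<close>, with \<open>a / q \<in> R\<^sub>L\<close>.  Dividing by \<open>s\<close> leaves room
  for the quotients of \<open>x\<close>: the pure closure of \<open>x\<close> is of this form if \<open>s\<close> does not divide \<open>x\<close>, and
  also, with \<open>s = 1\<close>, if \<open>L = 0\<close>.
\<close>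

definition cyclic_hull :: "'a \<Rightarrow> 'c \<Rightarrow> 'c set" where
  "cyclic_hull s x =
    {z \<in> carrier M. \<exists>q\<in>carrier R - L. \<exists>a\<in>carrier R. (q \<otimes> s) \<cdot> z = a \<cdot> x}"

lemma cyclic_hullI:
  "\<lbrakk>z \<in> carrier M; q \<in> carrier R - L; a \<in> carrier R; (q \<otimes> s) \<cdot> z = a \<cdot> x\<rbrakk>
    \<Longrightarrow> z \<in> cyclic_hull s x"
  unfolding cyclic_hull_def by blast

lemma coefficient_add:
  assumes "s \<in> carrier R" "x \<in> carrier M" "z \<in> carrier M" "z' \<in> carrier M"
    "q \<in> carrier R" "q' \<in> carrier R" "a \<in> carrier R" "a' \<in> carrier R"
    and eq: "(q \<otimes> s) \<cdot> z = a \<cdot> x" "(q' \<otimes> s) \<cdot> z' = a' \<cdot> x"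
  shows "((q \<otimes> q') \<otimes> s) \<cdot> (z \<oplus>\<^bsub>M\<^esub> z') = (a \<otimes> q' \<oplus> a' \<otimes> q) \<cdot> x"
proof -
  have "((q \<otimes> q') \<otimes> s) \<cdot> (z \<oplus>\<^bsub>M\<^esub> z') = q' \<cdot> ((q \<otimes> s) \<cdot> z) \<oplus>\<^bsub>M\<^esub> q \<cdot> ((q' \<otimes> s) \<cdot> z')"
    using assms(1-6) by (simp add: smult_r_distr m_ac flip: smult_assoc1)
  also have "\<dots> = (a \<otimes> q' \<oplus> a' \<otimes> q) \<cdot> x"
    unfolding eq using assms(2,5-8)
    by (simp add: smult_l_distr m_comm[of _ q] m_comm[of _ q'] smult_assoc1)
  finally show ?thesis .
qed

lemma coefficient_smult:
  assumes "s \<in> carrier R" "x \<in> carrier M" "z \<in> carrier M" "q \<in> carrier R" "r \<in> carrier R"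
    "a \<in> carrier R" "(q \<otimes> s) \<cdot> z = a \<cdot> x"
  shows "(q \<otimes> s) \<cdot> (r \<cdot> z) = (r \<otimes> a) \<cdot> x"
  using assms smult_lcomm[of "q \<otimes> s" r z] by (simp add: smult_assoc1)

lemma cyclic_hull_submodule:
  assumes [simp]: "s \<in> carrier R" "x \<in> carrier M"
  shows "submodule_of R M (cyclic_hull s x)"
proof (rule submodule_ofI)
  show "cyclic_hull s x \<subseteq> carrier M" by (auto simp: cyclic_hull_def)
  show "\<zero>\<^bsub>M\<^esub> \<in> cyclic_hull s x"
    using D.one_denominator by (intro cyclic_hullI[of _ \<one> \<zero>]) simp_all
next
  fix z z' assume "z \<in> cyclic_hull s x" "z' \<in> cyclic_hull s x"
  then obtain q a q' a' where *: "z \<in> carrier M" "z' \<in> carrier M" "q \<in> carrier R - L" "q' \<in> carrier R - L"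
    "a \<in> carrier R" "a' \<in> carrier R"
    "(q \<otimes> s) \<cdot> z = a \<cdot> x" "(q' \<otimes> s) \<cdot> z' = a' \<cdot> x" by (auto simp: cyclic_hull_def)
  have qR: "q \<in> carrier R" "q' \<in> carrier R" using * by auto
  show "z \<oplus>\<^bsub>M\<^esub> z' \<in> cyclic_hull s x"
    using *(1,2,5,6) qR D.mult_denominator[OF *(3,4)]
    by (intro cyclic_hullI[OF _ _ _ coefficient_add[OF _ _ _ _ _ _ _ _ *(7,8)]]) simp_all
next
  fix r z assume r: "r \<in> carrier R" and "z \<in> cyclic_hull s x"
  then obtain q a where *: "z \<in> carrier M" "q \<in> carrier R - L" "a \<in> carrier R"
    "(q \<otimes> s) \<cdot> z = a \<cdot> x" by (auto simp: cyclic_hull_def)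
  have "(q \<otimes> s) \<cdot> (r \<cdot> z) = (r \<otimes> a) \<cdot> x"
    using * r by (intro coefficient_smult) simp_all
  then show "r \<cdot> z \<in> cyclic_hull s x"
    using * r by (intro cyclic_hullI) simp_all
qed

text \<open>
  The coefficient \<open>a / q\<close> of an element \<open>(a / q) (x / s)\<close> is unique because \<open>M\<close> is torsion-free, and
  the coefficients form an ideal of \<open>R\<^sub>L\<close> because \<open>M\<close> is divisible outside \<open>L\<close>.
\<close>

lemma cyclic_hull_iso_ideal:
  assumes sR [simp]: "s \<in> carrier R" and s0: "s \<noteq> \<zero>"
    and xM [simp]: "x \<in> carrier M" and x0: "x \<noteq> \<zero>\<^bsub>M\<^esub>"
  shows "\<exists>I g. ideal I T \<and>
    g \<in> module_hom R (M\<lparr>carrier := cyclic_hull s x\<rparr>) (ideal_module R L I) \<and>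
    bij_betw g (cyclic_hull s x) I"
proof -
  let ?X = "cyclic_hull s x"
  interpret X: submodule_of R M ?X by (rule cyclic_hull_submodule) simp_all
  define g where "g z = (SOME t. \<exists>q a. q \<in> carrier R - L \<and> a \<in> carrier R \<and>
      (q \<otimes> s) \<cdot> z = a \<cdot> x \<and> t = D.Frac a q)" for z
  have cross: "a \<otimes> q' = a' \<otimes> q"
    if "z \<in> carrier M" "q \<in> carrier R" "q' \<in> carrier R" "a \<in> carrier R" "a' \<in> carrier R"
      "(q \<otimes> s) \<cdot> z = a \<cdot> x" "(q' \<otimes> s) \<cdot> z = a' \<cdot> x" for z q q' a a'
  proof (rule smult_cancel_right[OF _ _ _ xM x0])
    have "(a \<otimes> q') \<cdot> x = q' \<cdot> ((q \<otimes> s) \<cdot> z)"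
      unfolding that(6) using that(1-5) by (simp add: m_comm flip: smult_assoc1)
    also have "\<dots> = q \<cdot> ((q' \<otimes> s) \<cdot> z)"
      using that(1-5) by (simp add: m_ac flip: smult_assoc1)
    also have "\<dots> = (a' \<otimes> q) \<cdot> x"
      unfolding that(7) using that(1-5) by (simp add: m_comm flip: smult_assoc1)
    finally show "(a \<otimes> q') \<cdot> x = (a' \<otimes> q) \<cdot> x" .
  qed (simp_all add: that(2-5))
  have g: "g z = D.Frac a q"
    if z: "z \<in> carrier M" "q \<in> carrier R - L" "a \<in> carrier R" "(q \<otimes> s) \<cdot> z = a \<cdot> x" for z q a
    unfolding g_def
  proof (rule some_equality)
    show "\<exists>q' a'. q' \<in> carrier R - L \<and> a' \<in> carrier R \<and>
        (q' \<otimes> s) \<cdot> z = a' \<cdot> x \<and> D.Frac a q = D.Frac a' q'"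
      by (rule exI[of _ q], rule exI[of _ a]) (use z in simp)
    fix t assume "\<exists>q a. q \<in> carrier R - L \<and> a \<in> carrier R \<and> (q \<otimes> s) \<cdot> z = a \<cdot> x \<and> t = D.Frac a q"
    then obtain q' a' where q': "q' \<in> carrier R - L" "a' \<in> carrier R"
      "(q' \<otimes> s) \<cdot> z = a' \<cdot> x" "t = D.Frac a' q'" by auto
    have "q \<in> carrier R" "q' \<in> carrier R" using z(2) q'(1) by auto
    then have "a' \<otimes> q = a \<otimes> q'" using cross[OF z(1) _ _ q'(2) z(3) q'(3) z(4)] by blast
    then show "t = D.Frac a q"
      using z(2,3) q' D.frac_eq_iff[of a' q' a q] by simp
  qed
  have X_cases: "\<exists>q a. q \<in> carrier R - L \<and> a \<in> carrier R \<and> z \<in> carrier M \<and>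
      (q \<otimes> s) \<cdot> z = a \<cdot> x \<and> g z = D.Frac a q" if z: "z \<in> ?X" for z
  proof -
    obtain q a where q: "z \<in> carrier M" "q \<in> carrier R - L" "a \<in> carrier R"
      "(q \<otimes> s) \<cdot> z = a \<cdot> x" using z unfolding cyclic_hull_def by blast
    then show ?thesis using g[OF q] by blast
  qed
  interpret T: cring D.loc by (rule D.loc_cring)
  define I where "I = g ` ?X"
  have g_add: "g (z \<oplus>\<^bsub>M\<^esub> z') = g z \<oplus>\<^bsub>D.loc\<^esub> g z'" if z: "z \<in> ?X" "z' \<in> ?X" for z z'
  proof -
    obtain q a where q: "q \<in> carrier R - L" "a \<in> carrier R" "z \<in> carrier M"
      "(q \<otimes> s) \<cdot> z = a \<cdot> x" "g z = D.Frac a q" using X_cases[OF z(1)] by blast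
    obtain q' a' where q': "q' \<in> carrier R - L" "a' \<in> carrier R" "z' \<in> carrier M"
      "(q' \<otimes> s) \<cdot> z' = a' \<cdot> x" "g z' = D.Frac a' q'" using X_cases[OF z(2)] by blast
    have qR: "q \<in> carrier R" "q' \<in> carrier R" using q q' by auto
    have "((q \<otimes> q') \<otimes> s) \<cdot> (z \<oplus>\<^bsub>M\<^esub> z') = (a \<otimes> q' \<oplus> a' \<otimes> q) \<cdot> x"
      by (rule coefficient_add[OF sR xM q(3) q'(3) qR q(2) q'(2) q(4) q'(4)])
    then have "g (z \<oplus>\<^bsub>M\<^esub> z') = D.Frac (a \<otimes> q' \<oplus> a' \<otimes> q) (q \<otimes> q')"
      using q q' D.mult_denominator[OF q(1) q'(1)] qR by (intro g) simp_all
    then show ?thesis using q q' by (simp add: D.frac_add)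
  qed
  have T_smult: "\<exists>z'\<in>?X. g z' = t \<otimes>\<^bsub>D.loc\<^esub> g z" if z: "z \<in> ?X" "t \<in> carrier D.loc" for z t
  proof -
    obtain q a where q: "q \<in> carrier R - L" "a \<in> carrier R" "z \<in> carrier M"
      "(q \<otimes> s) \<cdot> z = a \<cdot> x" "g z = D.Frac a q" using X_cases[OF z(1)] by blast
    obtain c u where c: "c \<in> carrier R" "u \<in> carrier R - L" "t = D.Frac c u"
      using D.loc_cases[OF z(2)] by blast
    obtain y where y: "y \<in> carrier M" "z = u \<cdot> y" using divisibleE[of u z] c q by blast
    have qR: "q \<in> carrier R" "u \<in> carrier R" using q c by auto
    have "((u \<otimes> q) \<otimes> s) \<cdot> (c \<cdot> y) = c \<cdot> ((q \<otimes> s) \<cdot> (u \<cdot> y))"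
      using y c(1) qR by (simp add: m_ac flip: smult_assoc1)
    also have "\<dots> = (c \<otimes> a) \<cdot> x"
      unfolding y(2)[symmetric] q(4) using c q by (simp add: smult_assoc1)
    finally have *: "((u \<otimes> q) \<otimes> s) \<cdot> (c \<cdot> y) = (c \<otimes> a) \<cdot> x" .
    have uq: "u \<otimes> q \<in> carrier R - L" using D.mult_denominator[OF c(2) q(1)] .
    have "c \<cdot> y \<in> ?X"
      using * uq y c q by (intro cyclic_hullI) simp_all
    moreover have "g (c \<cdot> y) = D.Frac (c \<otimes> a) (u \<otimes> q)"
      using * uq y c q by (intro g) simp_all
    then have "g (c \<cdot> y) = t \<otimes>\<^bsub>D.loc\<^esub> g z" using c q by (simp add: D.frac_mult)
    ultimately show ?thesis by blast
  qed
  have g_smult: "g (r \<cdot> z) = D.Frac r \<one> \<otimes>\<^bsub>D.loc\<^esub> g z" if r: "r \<in> carrier R" and z: "z \<in> ?X" for r z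
  proof -
    obtain q a where q: "q \<in> carrier R - L" "a \<in> carrier R" "z \<in> carrier M"
      "(q \<otimes> s) \<cdot> z = a \<cdot> x" "g z = D.Frac a q" using X_cases[OF z] by blast
    have "(q \<otimes> s) \<cdot> (r \<cdot> z) = (r \<otimes> a) \<cdot> x"
      using q r by (intro coefficient_smult) simp_all
    then have "g (r \<cdot> z) = D.Frac (r \<otimes> a) q" using q r by (intro g) simp_all
    then show ?thesis using q r D.one_denominator by (simp add: D.frac_mult)
  qed
  have g_closed: "g z \<in> carrier D.loc" if "z \<in> ?X" for z
    using X_cases[OF that] by auto
  have I_ideal: "ideal I T"
    unfolding T_loc
  proof (rule idealI)
    show "ring D.loc" by (rule T.ring_axioms)
    show "subgroup I (add_monoid D.loc)"
    proof (rule group.subgroupI[OF T.a_group])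
      show "I \<subseteq> carrier (add_monoid D.loc)" using g_closed by (auto simp: I_def)
      show "I \<noteq> {}" unfolding I_def using X.N_zero by blast
      show "inv\<^bsub>add_monoid D.loc\<^esub> v \<in> I" if v: "v \<in> I" for v
      proof -
        obtain z where z: "z \<in> ?X" "v = g z" using v unfolding I_def by blast
        have "\<ominus>\<^bsub>D.loc\<^esub> \<one>\<^bsub>D.loc\<^esub> \<in> carrier D.loc" by simp
        then obtain z' where z': "z' \<in> ?X" "g z' = (\<ominus>\<^bsub>D.loc\<^esub> \<one>\<^bsub>D.loc\<^esub>) \<otimes>\<^bsub>D.loc\<^esub> g z"
          using T_smult[OF z(1)] by blast
        then have "g z' = \<ominus>\<^bsub>D.loc\<^esub> v"
          using g_closed[OF z(1)] by (simp add: z(2) T.l_minus)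
        then have inv: "inv\<^bsub>add_monoid D.loc\<^esub> v = g z'" by (simp only: a_inv_def)
        show ?thesis unfolding inv I_def using z'(1) by (rule imageI)
      qed
      show "v \<otimes>\<^bsub>add_monoid D.loc\<^esub> w \<in> I" if vw: "v \<in> I" "w \<in> I" for v w
      proof -
        obtain z z' where z: "z \<in> ?X" "z' \<in> ?X" "v = g z" "w = g z'"
          using vw unfolding I_def by blast
        then have "v \<otimes>\<^bsub>add_monoid D.loc\<^esub> w = g (z \<oplus>\<^bsub>M\<^esub> z')" by (simp add: g_add)
        then show ?thesis unfolding I_def using X.N_add[OF z(1,2)] by blast
      qed
    qed
    fix v t assume v: "v \<in> I" and t: "t \<in> carrier D.loc"
    obtain z where z: "z \<in> ?X" "v = g z" using v unfolding I_def by blast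
    show *: "t \<otimes>\<^bsub>D.loc\<^esub> v \<in> I"
    proof -
      obtain z' where z': "z' \<in> ?X" "g z' = t \<otimes>\<^bsub>D.loc\<^esub> g z" using T_smult[OF z(1) t] by blast
      show ?thesis unfolding z(2) z'(2)[symmetric] I_def using z'(1) by (rule imageI)
    qed
    show "v \<otimes>\<^bsub>D.loc\<^esub> t \<in> I"
      using * g_closed[OF z(1)] t by (simp add: z(2) T.m_comm)
  qed
  have g_hom: "g \<in> module_hom R (M\<lparr>carrier := ?X\<rparr>) (ideal_module R L I)"
    using g_add g_smult
    by (auto simp: module_hom_def module_via_def T_loc to_localization_at_def I_def)
  have g_bij: "bij_betw g ?X I"
    unfolding bij_betw_def I_def
  proof (intro conjI refl inj_onI)
    fix z z' assume z: "z \<in> ?X" "z' \<in> ?X" and eq: "g z = g z'"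
    obtain q a where q: "q \<in> carrier R - L" "a \<in> carrier R" "z \<in> carrier M"
      "(q \<otimes> s) \<cdot> z = a \<cdot> x" "g z = D.Frac a q" using X_cases[OF z(1)] by blast
    obtain q' a' where q': "q' \<in> carrier R - L" "a' \<in> carrier R" "z' \<in> carrier M"
      "(q' \<otimes> s) \<cdot> z' = a' \<cdot> x" "g z' = D.Frac a' q'" using X_cases[OF z(2)] by blast
    have qR: "q \<in> carrier R" "q' \<in> carrier R" using q q' by auto
    have aq: "a \<otimes> q' = a' \<otimes> q" using eq q q' by (simp add: D.frac_eq_iff)
    have "(q \<otimes> q' \<otimes> s) \<cdot> z = q' \<cdot> ((q \<otimes> s) \<cdot> z)"
      using q(3) qR by (simp add: m_ac flip: smult_assoc1)
    also have "\<dots> = (a \<otimes> q') \<cdot> x"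
      unfolding q(4) using q(2) qR by (simp add: m_comm flip: smult_assoc1)
    also have "\<dots> = q \<cdot> ((q' \<otimes> s) \<cdot> z')"
      unfolding q'(4) aq using q'(2) qR by (simp add: m_comm flip: smult_assoc1)
    also have "\<dots> = (q \<otimes> q' \<otimes> s) \<cdot> z'"
      using q'(3) qR by (simp add: m_ac flip: smult_assoc1)
    finally have eq: "(q \<otimes> q' \<otimes> s) \<cdot> z = (q \<otimes> q' \<otimes> s) \<cdot> z'" .
    have qqs: "q \<otimes> q' \<otimes> s \<in> carrier R" using qR by simp
    have nz: "q \<otimes> q' \<otimes> s \<noteq> \<zero>"
      using s0 outside_nonzero[OF q(1)] outside_nonzero[OF q'(1)] qR by (simp add: integral_iff)
    show "z = z'" by (rule smult_cancel[OF eq qqs q(3) q'(3) nz])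
  qed
  show ?thesis by (intro exI conjI) (rule I_ideal g_hom g_bij)+
qed

lemma cyclic_hullE:
  assumes "z \<in> cyclic_hull s x"
  obtains q a where "q \<in> carrier R - L" "a \<in> carrier R" "(q \<otimes> s) \<cdot> z = a \<cdot> x"
  using assms unfolding cyclic_hull_def by blast

lemma cyclic_hull_closed_under_division:
  assumes x: "x \<in> carrier M" and s: "s \<in> carrier R" "s \<noteq> \<zero>"
    and full: "\<And>p z b. \<lbrakk>p \<in> carrier R; p \<noteq> \<zero>; z \<in> carrier M; b \<in> carrier R;
      p \<cdot> z = b \<cdot> x\<rbrakk> \<Longrightarrow> z \<in> cyclic_hull s x"
    and r: "r \<in> carrier R" "r \<noteq> \<zero>" and y: "y \<in> carrier M" "r \<cdot> y \<in> cyclic_hull s x"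
  shows "y \<in> cyclic_hull s x"
proof -
  obtain q a where q: "q \<in> carrier R - L" "a \<in> carrier R" "(q \<otimes> s) \<cdot> (r \<cdot> y) = a \<cdot> x"
    using y(2) unfolding cyclic_hull_def by blast
  have qR: "q \<in> carrier R" using q(1) by simp
  have "(q \<otimes> s \<otimes> r) \<cdot> y = a \<cdot> x"
    using q(3) qR s r y(1) by (simp add: smult_assoc1)
  moreover have "q \<otimes> s \<otimes> r \<noteq> \<zero>"
    using outside_nonzero[OF q(1)] qR s r by (simp add: integral_iff)
  moreover have "q \<otimes> s \<otimes> r \<in> carrier R" using qR s r by simp
  ultimately show ?thesis using full[of "q \<otimes> s \<otimes> r" y a] y(1) q(2) by blast
qed

lemma cyclic_hull_mem:
  assumes "x \<in> carrier M" "s \<in> carrier R" shows "x \<in> cyclic_hull s x"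
  using assms D.one_denominator by (intro cyclic_hullI[of _ \<one> s]) simp_all

text \<open>
  The hypothesis on division says that passing from \<open>x\<close> to \<open>x + b\<close> with \<open>b \<in> B\<close> does not gain
  divisors; it keeps \<open>B\<close> together with the pure closure of \<open>x\<close> pure.  The last hypothesis says that
  the cyclic hull is this pure closure.
\<close>

lemma extend_pure_sum_of_ideals:
  assumes B: "pure_submodule R B M" and iso: "ideal_sum_iso R L n (M\<lparr>carrier := B\<rparr>)"
    and x: "x \<in> carrier M" "x \<notin> B" and s: "s \<in> carrier R" "s \<noteq> \<zero>"
    and division: "\<And>u b y. \<lbrakk>u \<in> carrier R; u \<noteq> \<zero>; b \<in> B; y \<in> carrier M; u \<cdot> y = x \<oplus>\<^bsub>M\<^esub> b\<rbrakk>
      \<Longrightarrow> \<exists>y\<in>carrier M. u \<cdot> y = x"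
    and full: "\<And>p z b. \<lbrakk>p \<in> carrier R; p \<noteq> \<zero>; z \<in> carrier M; b \<in> carrier R;
      p \<cdot> z = b \<cdot> x\<rbrakk> \<Longrightarrow> z \<in> cyclic_hull s x"
  shows "\<exists>B'. pure_submodule R B' M \<and> B \<subset> B' \<and> ideal_sum_iso R L (Suc n) (M\<lparr>carrier := B'\<rparr>)"
proof -
  let ?X = "cyclic_hull s x"
  define B' where "B' = {b \<oplus>\<^bsub>M\<^esub> z | b z. b \<in> B \<and> z \<in> ?X}"
  have subB: "submodule_of R M B" by (rule pure_submodule_of[OF B])
  have subX: "submodule_of R M ?X" by (rule cyclic_hull_submodule[OF s(1) x(1)])
  interpret B: submodule_of R M B by (rule subB)
  interpret X: submodule_of R M ?X by (rule subX)
  have x0: "x \<noteq> \<zero>\<^bsub>M\<^esub>" using x(2) B.N_zero by metis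
  have hull_cases: "\<exists>p a. p \<in> carrier R \<and> p \<noteq> \<zero> \<and> a \<in> carrier R \<and> p \<cdot> z = a \<cdot> x"
    if hz: "z \<in> ?X" for z
  proof -
    obtain q a where q: "q \<in> carrier R - L" "a \<in> carrier R" "(q \<otimes> s) \<cdot> z = a \<cdot> x"
      using hz by (rule cyclic_hullE)
    have "q \<otimes> s \<noteq> \<zero>" using outside_nonzero[OF q(1)] q(1) s by (simp add: integral_iff)
    moreover have "q \<otimes> s \<in> carrier R" using q(1) s by simp
    ultimately show ?thesis using q(2,3) by blast
  qed
  have disjoint: "B \<inter> ?X = {\<zero>\<^bsub>M\<^esub>}"
  proof
    show "{\<zero>\<^bsub>M\<^esub>} \<subseteq> B \<inter> ?X" using B.N_zero X.N_zero by blast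
    show "B \<inter> ?X \<subseteq> {\<zero>\<^bsub>M\<^esub>}"
    proof
      fix w assume w: "w \<in> B \<inter> ?X"
      then have wM: "w \<in> carrier M" and wB: "w \<in> B" using B.N_subset by auto
      obtain p a where p: "p \<in> carrier R" "p \<noteq> \<zero>" "a \<in> carrier R" "p \<cdot> w = a \<cdot> x"
        using hull_cases w by blast
      have "a \<cdot> x \<in> B" using B.N_smult[OF p(1) wB] p(4) by simp
      then have "a = \<zero>" using pureD[OF B _ p(3)] x by blast
      then have "p \<cdot> w = \<zero>\<^bsub>M\<^esub>" using p(4) x(1) by simp
      then show "w \<in> {\<zero>\<^bsub>M\<^esub>}" using smult_eq_zero[OF _ p(1) wM p(2)] by simp
    qed
  qed
  have B'I: "b \<oplus>\<^bsub>M\<^esub> z \<in> B'" if "b \<in> B" "z \<in> ?X" for b z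
    unfolding B'_def using that by blast
  have B'E: "\<exists>b z. b \<in> B \<and> z \<in> ?X \<and> y = b \<oplus>\<^bsub>M\<^esub> z" if "y \<in> B'" for y
    using that unfolding B'_def by blast
  have subB': "submodule_of R M B'"
  proof (rule submodule_ofI)
    show "B' \<subseteq> carrier M" using B'E by fastforce
    show "\<zero>\<^bsub>M\<^esub> \<in> B'" using B'I[OF B.N_zero X.N_zero] by simp
    show "y \<oplus>\<^bsub>M\<^esub> y' \<in> B'" if yy: "y \<in> B'" "y' \<in> B'" for y y'
    proof -
      obtain b z where 1: "b \<in> B" "z \<in> ?X" "y = b \<oplus>\<^bsub>M\<^esub> z" using B'E yy(1) by blast
      obtain b' z' where 2: "b' \<in> B" "z' \<in> ?X" "y' = b' \<oplus>\<^bsub>M\<^esub> z'" using B'E yy(2) by blast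
      have "y \<oplus>\<^bsub>M\<^esub> y' = (b \<oplus>\<^bsub>M\<^esub> b') \<oplus>\<^bsub>M\<^esub> (z \<oplus>\<^bsub>M\<^esub> z')"
        unfolding 1(3) 2(3) using 1(1,2) 2(1,2) by (simp add: M.a_ac)
      then show ?thesis using B'I[OF B.N_add[OF 1(1) 2(1)] X.N_add[OF 1(2) 2(2)]] by simp
    qed
    show "r \<cdot> y \<in> B'" if r: "r \<in> carrier R" and y: "y \<in> B'" for r y
    proof -
      obtain b z where 1: "b \<in> B" "z \<in> ?X" "y = b \<oplus>\<^bsub>M\<^esub> z" using B'E y by blast
      have "r \<cdot> y = r \<cdot> b \<oplus>\<^bsub>M\<^esub> r \<cdot> z"
        unfolding 1(3) using r 1(1,2) by (simp add: smult_r_distr)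
      then show ?thesis using B'I[OF B.N_smult[OF r 1(1)] X.N_smult[OF r 1(2)]] by simp
    qed
  qed
  interpret B': submodule_of R M B' by (rule subB')
  \<comment> \<open>The heart of purity: if \<open>r\<close> divides \<open>b + z\<close>, it divides \<open>b\<close>.  Here \<open>p z = a x\<close>, and the two cases
    compare \<open>a\<close> with \<open>p r\<close>.  If \<open>a\<close> is the divisor, \<open>p r = a u\<close>, then \<open>u\<close> divides \<open>x\<close> modulo
    \<open>B\<close>, hence divides \<open>x\<close> itself.\<close>
  have divide: "\<exists>w\<in>carrier M. b = r \<cdot> w"
    if r: "r \<in> carrier R" "r \<noteq> \<zero>" and y: "y \<in> carrier M" and b: "b \<in> B" and z: "z \<in> ?X"
      and eq: "r \<cdot> y = b \<oplus>\<^bsub>M\<^esub> z" for r y b z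
  proof -
    have bM: "b \<in> carrier M" and zM: "z \<in> carrier M" using b z by simp_all
    obtain p a where p: "p \<in> carrier R" "p \<noteq> \<zero>" "a \<in> carrier R" "p \<cdot> z = a \<cdot> x"
      using hull_cases[OF z] by blast
    have pr: "p \<otimes> r \<in> carrier R" "p \<otimes> r \<noteq> \<zero>" using p r by (simp_all add: integral_iff)
    have eq': "(p \<otimes> r) \<cdot> y = a \<cdot> x \<oplus>\<^bsub>M\<^esub> p \<cdot> b"
    proof -
      have "(p \<otimes> r) \<cdot> y = p \<cdot> (b \<oplus>\<^bsub>M\<^esub> z)" using p r y by (simp add: smult_assoc1 eq)
      then show ?thesis using p bM zM x(1) by (simp add: smult_r_distr M.a_comm)
    qed
    have pb: "(p \<otimes> r) \<cdot> y \<ominus>\<^bsub>M\<^esub> a \<cdot> x = p \<cdot> b"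
      using M.eq_add_iff_minus_eq[THEN iffD1, OF _ _ _ eq'] pr p y x bM by simp
    have cancel: "b = r \<cdot> w" if w: "w \<in> carrier M" "p \<cdot> b = (p \<otimes> r) \<cdot> w" for w
    proof (rule smult_cancel[OF _ p(1) bM _ p(2)])
      show "p \<cdot> b = p \<cdot> (r \<cdot> w)" using w p r by (simp add: smult_assoc1)
      show "r \<cdot> w \<in> carrier M" using w r by simp
    qed
    consider v where "v \<in> carrier R" "a = (p \<otimes> r) \<otimes> v" | u where "u \<in> carrier R" "p \<otimes> r = a \<otimes> u"
      using divides_total[OF pr(1) p(3)] by blast
    then show ?thesis
    proof cases
      case (1 v)
      have "p \<cdot> b = (p \<otimes> r) \<cdot> (y \<ominus>\<^bsub>M\<^esub> v \<cdot> x)"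
        unfolding pb[symmetric] 1(2) using 1(1) pr y x(1) by (simp add: smult_r_diff smult_assoc1[of "p \<otimes> r" v])
      then show ?thesis using cancel[of "y \<ominus>\<^bsub>M\<^esub> v \<cdot> x"] 1(1) y x(1) by blast
    next
      case (2 u)
      have a0: "a \<noteq> \<zero>" using pr(2) 2 by auto
      have u0: "u \<noteq> \<zero>" using pr(2) 2 p(3) by auto
      define b1 where "b1 = u \<cdot> y \<ominus>\<^bsub>M\<^esub> x"
      have uy: "u \<cdot> y \<in> carrier M" using 2 y by simp
      have b1M: "b1 \<in> carrier M" using uy x(1) by (simp add: b1_def)
      have ab1: "a \<cdot> b1 = p \<cdot> b"
        unfolding pb[symmetric] 2(2) b1_def using 2(1) uy p(3) y x(1) by (simp add: smult_r_diff smult_assoc1)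
      then have "a \<cdot> b1 \<in> B" using B.N_smult[OF p(1) b] by simp
      then have b1: "b1 \<in> B" using pureD[OF B _ p(3) a0 b1M] by blast
      have uy_eq: "u \<cdot> y = x \<oplus>\<^bsub>M\<^esub> b1"
        using M.eq_add_iff_minus_eq[OF uy x(1) b1M] b1_def by simp
      then obtain y0 where y0: "y0 \<in> carrier M" "u \<cdot> y0 = x"
        using division[OF 2(1) u0 b1 y] by blast
      have "b1 = u \<cdot> (y \<ominus>\<^bsub>M\<^esub> y0)"
        unfolding b1_def y0(2)[symmetric] using 2(1) y y0(1) by (simp add: smult_r_diff)
      then have "p \<cdot> b = (p \<otimes> r) \<cdot> (y \<ominus>\<^bsub>M\<^esub> y0)"
        unfolding ab1[symmetric] 2(2) using 2(1) p(3) y y0(1) by (simp add: smult_assoc1)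
      then show ?thesis using cancel[of "y \<ominus>\<^bsub>M\<^esub> y0"] y y0(1) by blast
    qed
  qed
  have "pure_submodule R B' M"
    unfolding pure_submodule_iff
  proof (intro conjI ballI impI)
    show "LinearCombinations.submodule R B' M" by (rule B'.submodule)
    fix r y assume "r \<in> carrier R - {\<zero>}" and y: "y \<in> carrier M" "r \<cdot> y \<in> B'"
    then have r: "r \<in> carrier R" "r \<noteq> \<zero>" by auto
    obtain b z where bz: "b \<in> B" "z \<in> ?X" "r \<cdot> y = b \<oplus>\<^bsub>M\<^esub> z" using B'E y(2) by blast
    have bM: "b \<in> carrier M" and zM: "z \<in> carrier M" using bz by simp_all
    obtain w where w: "w \<in> carrier M" "b = r \<cdot> w" using divide[OF r y(1) bz] by blast
    then have wB: "w \<in> B" using pureD[OF B _ r w(1)] bz(1) by simp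
    have z_eq: "z = r \<cdot> (y \<ominus>\<^bsub>M\<^esub> w)"
    proof -
      have "r \<cdot> y \<ominus>\<^bsub>M\<^esub> b = z"
        using M.eq_add_iff_minus_eq[THEN iffD1, OF _ _ _ bz(3)] r y(1) bM zM by simp
      then show ?thesis using r y(1) w by (simp add: smult_r_diff)
    qed
    have yw: "y \<ominus>\<^bsub>M\<^esub> w \<in> carrier M" using y(1) w(1) by simp
    have ryw: "r \<cdot> (y \<ominus>\<^bsub>M\<^esub> w) \<in> ?X" using bz(2) unfolding z_eq .
    have "y \<ominus>\<^bsub>M\<^esub> w \<in> ?X"
      by (rule cyclic_hull_closed_under_division[OF x(1) s _ r yw ryw]) (rule full)
    then have "w \<oplus>\<^bsub>M\<^esub> (y \<ominus>\<^bsub>M\<^esub> w) \<in> B'" by (rule B'I[OF wB])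
    moreover have "y = w \<oplus>\<^bsub>M\<^esub> (y \<ominus>\<^bsub>M\<^esub> w)"
      using M.eq_add_iff_minus_eq[of y w "y \<ominus>\<^bsub>M\<^esub> w"] y(1) w(1) by simp
    ultimately show "y \<in> B'" by simp
  qed
  moreover have "B \<subset> B'"
  proof
    show "B \<subseteq> B'"
    proof
      fix b assume b: "b \<in> B"
      show "b \<in> B'" using B'I[OF b X.N_zero] b by simp
    qed
    have "x \<in> B'" using B'I[OF B.N_zero cyclic_hull_mem[OF x(1) s(1)]] x(1) by simp
    then show "B \<noteq> B'" using x(2) by blast
  qed
  moreover have "ideal_sum_iso R L (Suc n) (M\<lparr>carrier := B'\<rparr>)"
  proof -
    obtain I f where I: "\<And>i. i < n \<Longrightarrow> ideal (I i) T"
      and f: "f \<in> module_hom R (M\<lparr>carrier := B\<rparr>) (finite_direct_sum n (\<lambda>i. ideal_module R L (I i)))"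
        "bij_betw f B (carrier (finite_direct_sum n (\<lambda>i. ideal_module R L (I i))))"
      using iso unfolding ideal_sum_iso_def module_isomorphic_def by auto
    obtain J g where J: "ideal J T"
      and g: "g \<in> module_hom R (M\<lparr>carrier := ?X\<rparr>) (ideal_module R L J)" "bij_betw g ?X J"
      using cyclic_hull_iso_ideal[OF s x(1) x0] by blast
    define I' where "I' = I(n := J)"
    have eq: "finite_direct_sum n (\<lambda>i. ideal_module R L (I i))
        = finite_direct_sum n (\<lambda>i. ideal_module R L (I' i))"
      by (rule finite_direct_sum_cong) (simp add: I'_def)
    have I'n: "I' n = J" by (simp add: I'_def)
    have "module_isomorphic R (M\<lparr>carrier := B'\<rparr>) (finite_direct_sum (Suc n) (\<lambda>i. ideal_module R L (I' i)))"
      unfolding B'_def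
      by (rule module_isomorphic_direct_sum_Suc[OF subB subX disjoint f[unfolded eq]])
        (use g in \<open>simp_all add: I'n\<close>)
    moreover have "\<And>i. i < Suc n \<Longrightarrow> ideal (I' i) T"
      using I J by (auto simp: I'_def less_Suc_eq)
    ultimately show ?thesis unfolding ideal_sum_iso_def by blast
  qed
  ultimately show ?thesis by blast
qed

text \<open>
  For \<open>l \<in> L'\<close> and \<open>t \<notin> L\<close> the valuation gives \<open>l = t l'\<close>, with \<open>l' \<in> L'\<close> by primality; so \<open>L'\<close> is
  already closed under multiplication by \<open>1 / t\<close>.
\<close>

lemma image_prime_localization:
  assumes L': "primeideal L' R" and sub: "L' \<subseteq> L"
  shows "primeideal (to_localization_at R L ` L') T"
proof -
  have L'_ideal: "ideal L' R" using L' by (simp add: primeideal_def)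
  have L'R [simp]: "l \<in> carrier R" if "l \<in> L'" for l using that ideal.Icarr[OF L'_ideal] by blast
  let ?K = "(\<lambda>l. D.Frac l \<one>) ` L'"
  interpret loc: cring D.loc by (rule D.loc_cring)
  have mult: "X \<otimes>\<^bsub>D.loc\<^esub> D.Frac l \<one> \<in> ?K" if l: "l \<in> L'" and X: "X \<in> carrier D.loc" for l X
  proof -
    obtain c t where c: "c \<in> carrier R" "t \<in> carrier R - L" "X = D.Frac c t"
      using D.loc_cases[OF X] by blast
    have tR: "t \<in> carrier R" using c(2) by simp
    have "t \<noteq> l \<otimes> w" if "w \<in> carrier R" for w
      using c(2) sub ideal.I_r_closed[OF L'_ideal l that] by blast
    then obtain l' where l': "l' \<in> carrier R" "l = t \<otimes> l'"
      using divides_total[OF tR L'R[OF l]] by blast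
    then have "t \<in> L' \<or> l' \<in> L'" using primeideal.I_prime[OF L' tR l'(1)] l by simp
    then have l'L: "l' \<in> L'" using c(2) sub by blast
    have cl: "c \<otimes> l' \<in> L'" by (rule ideal.I_l_closed[OF L'_ideal l'L c(1)])
    have "X \<otimes>\<^bsub>D.loc\<^esub> D.Frac l \<one> = D.Frac (c \<otimes> l) t"
      unfolding c(3) using c(1,2) tR l D.one_denominator by (simp add: D.frac_mult)
    also have "\<dots> = D.Frac (c \<otimes> l') \<one>"
      using c(1,2) tR l l'(1) D.one_denominator by (simp add: D.frac_eq_iff l'(2) m_ac)
    finally show ?thesis using cl by blast
  qed
  have K_ideal: "ideal ?K D.loc"
  proof (rule idealI)
    show "ring D.loc" by (rule loc.ring_axioms)
    show "subgroup ?K (add_monoid D.loc)"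
    proof (rule group.subgroupI[OF loc.a_group])
      show "?K \<subseteq> carrier (add_monoid D.loc)" using D.one_denominator by auto
      show "?K \<noteq> {}" using additive_subgroup.zero_closed[OF ideal.axioms(1)[OF L'_ideal]] by blast
      fix v assume v: "v \<in> ?K"
      then obtain l where l: "l \<in> L'" "v = D.Frac l \<one>" by blast
      have "inv\<^bsub>add_monoid D.loc\<^esub> v = \<ominus>\<^bsub>D.loc\<^esub> v" by (simp only: a_inv_def)
      also have "\<dots> = (\<ominus>\<^bsub>D.loc\<^esub> \<one>\<^bsub>D.loc\<^esub>) \<otimes>\<^bsub>D.loc\<^esub> v"
        using l D.one_denominator by (simp add: loc.l_minus)
      finally show "inv\<^bsub>add_monoid D.loc\<^esub> v \<in> ?K"
        using mult[OF l(1), of "\<ominus>\<^bsub>D.loc\<^esub> \<one>\<^bsub>D.loc\<^esub>"] l(2) by simp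
      fix w assume "w \<in> ?K"
      then obtain k where k: "k \<in> L'" "w = D.Frac k \<one>" by blast
      have "v \<otimes>\<^bsub>add_monoid D.loc\<^esub> w = D.Frac (l \<oplus> k) \<one>"
        using l k D.one_denominator by (simp add: D.frac_add_same)
      then show "v \<otimes>\<^bsub>add_monoid D.loc\<^esub> w \<in> ?K"
        using additive_subgroup.a_closed[OF ideal.axioms(1)[OF L'_ideal] l(1) k(1)] by blast
    qed
    fix v X assume "v \<in> ?K" and X: "X \<in> carrier D.loc"
    then obtain l where l: "l \<in> L'" "v = D.Frac l \<one>" by blast
    show "X \<otimes>\<^bsub>D.loc\<^esub> v \<in> ?K" using mult[OF l(1) X] l(2) by simp
    moreover have "v \<in> carrier D.loc" using l D.one_denominator by simp
    ultimately show "v \<otimes>\<^bsub>D.loc\<^esub> X \<in> ?K" using loc.m_comm[OF _ X] by simp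
  qed
  have "primeideal ?K D.loc"
  proof (rule primeidealI[OF K_ideal loc.is_cring])
    show "carrier D.loc \<noteq> ?K"
    proof
      assume "carrier D.loc = ?K"
      then have "D.Frac \<one> \<one> \<in> ?K" using D.one_denominator D.frac_closed by blast
      then obtain l where l: "l \<in> L'" "D.Frac \<one> \<one> = D.Frac l \<one>" by blast
      then have "\<one> \<in> L'" using D.frac_one_inj[of \<one> l] by simp
      then show False
        using ideal.one_imp_carrier[OF L'_ideal] primeideal.I_notcarr[OF L'] by blast
    qed
    fix X Y assume XY: "X \<in> carrier D.loc" "Y \<in> carrier D.loc" "X \<otimes>\<^bsub>D.loc\<^esub> Y \<in> ?K"
    obtain a b t where a: "a \<in> carrier R" "b \<in> carrier R" "t \<in> carrier R - L" "X = D.Frac a t" "Y = D.Frac b t"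
      using D.frac_common_denominator[OF XY(1,2)] by blast
    have tR: "t \<in> carrier R" using a(3) by simp
    obtain l where l: "l \<in> L'" "X \<otimes>\<^bsub>D.loc\<^esub> Y = D.Frac l \<one>" using XY(3) by blast
    have tt: "t \<otimes> t \<in> carrier R - L" by (rule D.mult_denominator[OF a(3) a(3)])
    have "D.Frac (a \<otimes> b) (t \<otimes> t) = D.Frac l \<one>" using l(2) a by (simp add: D.frac_mult)
    then have "(a \<otimes> b) \<otimes> \<one> = l \<otimes> (t \<otimes> t)"
      using D.frac_eq_iff[OF _ tt L'R[OF l(1)] D.one_denominator] a(1,2) by blast
    then have "a \<otimes> b \<in> L'" using ideal.I_r_closed[OF L'_ideal l(1), of "t \<otimes> t"] a(1,2) tR by simp
    then have "a \<in> L' \<or> b \<in> L'" using primeideal.I_prime[OF L' a(1,2)] by blast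
    moreover have "D.Frac c t \<in> ?K" if "c \<in> L'" for c
    proof -
      have "D.Frac c t = D.Frac \<one> t \<otimes>\<^bsub>D.loc\<^esub> D.Frac c \<one>"
        using that a(3) tR D.one_denominator by (simp add: D.frac_mult)
      then show ?thesis using mult[OF that, of "D.Frac \<one> t"] a(3) by simp
    qed
    ultimately show "X \<in> ?K \<or> Y \<in> ?K" using a(4,5) by blast
  qed
  then show ?thesis by (simp add: T_loc to_localization_at_def)
qed

text \<open>
  The element \<open>x + c\<close> has all divisors that \<open>x\<close> has modulo \<open>B\<close>.  The pairs \<open>(r, b)\<close> with
  \<open>x + b \<in> r M\<close> prescribe the coset \<open>b + r B\<close> for \<open>c\<close>.  Under an isomorphism of \<open>B\<close> with a sum of
  ideals these cosets are products of cosets in the summands, so that \<open>c\<close> can be found one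
  coordinate at a time.
\<close>

lemma divisible_representative:
  assumes L': "primeideal L' R" "L' \<subseteq> L" and am: "almost_maximal (localization_quotient R L L')"
    and B: "pure_submodule R B M" and iso: "ideal_sum_iso R L n (M\<lparr>carrier := B\<rparr>)"
    and s: "s \<in> carrier R" "s \<notin> L'" and x: "x \<in> carrier M"
    and not_divisible: "\<And>y b. \<lbrakk>y \<in> carrier M; b \<in> B\<rbrakk> \<Longrightarrow> x \<noteq> s \<cdot> y \<oplus>\<^bsub>M\<^esub> b"
  shows "\<exists>c\<in>B. \<forall>r\<in>carrier R. \<forall>b\<in>B. (\<exists>y\<in>carrier M. r \<cdot> y = x \<oplus>\<^bsub>M\<^esub> b) \<longrightarrow>
    (\<exists>y\<in>carrier M. r \<cdot> y = x \<oplus>\<^bsub>M\<^esub> c)"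
proof -
  have subB: "submodule_of R M B" by (rule pure_submodule_of[OF B])
  note B_sub = submodule_of.N_subset[OF subB]
  note B_smult = submodule_of.N_smult[OF subB]
  note B_add = submodule_of.N_add[OF subB]
  note B_neg = submodule_of.N_neg[OF subB]
  note B_minus = submodule_of.N_minus[OF subB]
  have L'_ideal: "ideal L' R" using L'(1) by (simp add: primeideal_def)
  have s0: "s \<noteq> \<zero>"
    using s(2) additive_subgroup.zero_closed[OF ideal.axioms(1)[OF L'_ideal]] by metis
  define \<Lambda> where "\<Lambda> = {(r, b). r \<in> carrier R \<and> b \<in> B \<and> (\<exists>y\<in>carrier M. r \<cdot> y = x \<oplus>\<^bsub>M\<^esub> b)}"
  have \<Lambda>E: "\<exists>y. r \<in> carrier R \<and> b \<in> B \<and> b \<in> carrier M \<and> y \<in> carrier M \<and> r \<cdot> y = x \<oplus>\<^bsub>M\<^esub> b"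
    if "(r, b) \<in> \<Lambda>" for r b
    using that B_sub unfolding \<Lambda>_def by blast
  have dvd_s: "\<exists>u\<in>carrier R. s = r \<otimes> u" if \<Lambda>: "(r, b) \<in> \<Lambda>" for r b
  proof -
    obtain y where y: "r \<in> carrier R" "b \<in> B" "b \<in> carrier M" "y \<in> carrier M"
      "r \<cdot> y = x \<oplus>\<^bsub>M\<^esub> b" using \<Lambda>E[OF \<Lambda>] by blast
    have "r \<noteq> s \<otimes> w" if w: "w \<in> carrier R" for w
    proof
      assume "r = s \<otimes> w"
      then have "s \<cdot> (w \<cdot> y) = b \<oplus>\<^bsub>M\<^esub> x"
        using y s w x by (simp add: smult_assoc1 M.a_comm)
      then have "x = s \<cdot> (w \<cdot> y) \<ominus>\<^bsub>M\<^esub> b"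
        using M.eq_add_iff_minus_eq[of "s \<cdot> (w \<cdot> y)" b x] x y(3,4) s(1) w by simp
      then show False
        using not_divisible[of "w \<cdot> y" "\<ominus>\<^bsub>M\<^esub> b"] w y(4) B_neg[OF y(2)] by (simp add: a_minus_def)
    qed
    then show ?thesis using divides_total[OF y(1) s(1)] by blast
  qed
  have compatible: "\<exists>b1\<in>B. b' = b \<oplus>\<^bsub>M\<^esub> r \<cdot> b1"
    if \<Lambda>: "(r, b) \<in> \<Lambda>" and \<Lambda>': "(r', b') \<in> \<Lambda>" and u: "u \<in> carrier R" "r' = r \<otimes> u" for r b r' b' u
  proof -
    obtain y where y: "r \<in> carrier R" "b \<in> B" "b \<in> carrier M" "y \<in> carrier M"
      "r \<cdot> y = x \<oplus>\<^bsub>M\<^esub> b" using \<Lambda>E[OF \<Lambda>] by blast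
    obtain y' where y': "b' \<in> B" "b' \<in> carrier M" "y' \<in> carrier M"
      "r' \<cdot> y' = x \<oplus>\<^bsub>M\<^esub> b'" using \<Lambda>E[OF \<Lambda>'] by blast
    define w where "w = u \<cdot> y' \<ominus>\<^bsub>M\<^esub> y"
    have wM: "w \<in> carrier M" using u(1) y(4) y'(3) by (simp add: w_def)
    obtain v where v: "v \<in> carrier R" "s = r \<otimes> v" using dvd_s[OF \<Lambda>] by blast
    have r0: "r \<noteq> \<zero>" using v s0 by auto
    have "r \<cdot> w = r' \<cdot> y' \<ominus>\<^bsub>M\<^esub> r \<cdot> y"
      unfolding w_def u(2) using u(1) y(1,4) y'(3) by (simp add: smult_r_diff smult_assoc1)
    also have "\<dots> = b' \<ominus>\<^bsub>M\<^esub> b"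
      unfolding y(5) y'(4) using x y(3) y'(2) by (simp add: M.add_diff_cancel_left)
    finally have rw: "r \<cdot> w = b' \<ominus>\<^bsub>M\<^esub> b" .
    have "r \<cdot> w \<in> B" unfolding rw by (rule B_minus[OF y'(1) y(2)])
    then have "w \<in> B" using pureD[OF B _ y(1) r0 wM] by blast
    moreover have "b' = b \<oplus>\<^bsub>M\<^esub> r \<cdot> w"
      using M.eq_add_iff_minus_eq[of b' b "r \<cdot> w"] rw y'(2) y(1,3) wM by simp
    ultimately show ?thesis by blast
  qed
  let ?\<phi> = "to_localization_at R L"
  have \<phi>: "?\<phi> r = D.Frac r \<one>" for r by (simp add: to_localization_at_def)
  have \<phi>_closed: "?\<phi> r \<in> carrier T" if "r \<in> carrier R" for r
    using that D.one_denominator by (simp add: \<phi> T_loc)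
  have \<phi>_mult: "?\<phi> (r \<otimes> u) = ?\<phi> r \<otimes>\<^bsub>T\<^esub> ?\<phi> u" if "r \<in> carrier R" "u \<in> carrier R" for r u
    using that D.one_denominator by (simp add: \<phi> T_loc D.frac_mult)
  obtain I f where I: "\<And>i. i < n \<Longrightarrow> ideal (I i) T"
    and f: "f \<in> module_hom R (M\<lparr>carrier := B\<rparr>) (finite_direct_sum n (\<lambda>i. ideal_module R L (I i)))"
      "bij_betw f B (carrier (finite_direct_sum n (\<lambda>i. ideal_module R L (I i))))"
    using iso unfolding ideal_sum_iso_def module_isomorphic_def by auto
  have carrier_sum: "carrier (finite_direct_sum n (\<lambda>i. ideal_module R L (I i))) = (\<Pi>\<^sub>E i\<in>{..<n}. I i)"
    by (simp add: finite_direct_sum_def)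
  have f_mem: "f b \<in> (\<Pi>\<^sub>E i\<in>{..<n}. I i)" if "b \<in> B" for b
    using module_hom_closed[OF f(1)] that unfolding carrier_sum by auto
  have f_surj: "\<exists>b\<in>B. f b = w" if w: "w \<in> (\<Pi>\<^sub>E i\<in>{..<n}. I i)" for w
  proof -
    have "f ` B = (\<Pi>\<^sub>E i\<in>{..<n}. I i)"
      using bij_betw_imp_surj_on[OF f(2)] unfolding carrier_sum .
    then have "w \<in> f ` B" using w by simp
    then show ?thesis by (elim imageE) (rule bexI, simp_all)
  qed
  have f_inj: "b = b'" if "f b = f b'" "b \<in> B" "b' \<in> B" for b b'
    by (rule inj_onD[OF bij_betw_imp_inj_on[OF f(2)] that])
  have f_lin: "f (b \<oplus>\<^bsub>M\<^esub> r \<cdot> b') i = f b i \<oplus>\<^bsub>T\<^esub> ?\<phi> r \<otimes>\<^bsub>T\<^esub> f b' i"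
    if "b \<in> B" "b' \<in> B" "r \<in> carrier R" "i < n" for b b' r i
  proof -
    have "f (b \<oplus>\<^bsub>M\<^esub> r \<cdot> b') i = f b i \<oplus>\<^bsub>T\<^esub> f (r \<cdot> b') i"
      using module_hom_add[OF f(1), of b "r \<cdot> b'"] that B_smult[OF that(3,2)]
      by (simp add: finite_direct_sum_def module_via_def)
    also have "f (r \<cdot> b') i = ?\<phi> r \<otimes>\<^bsub>T\<^esub> f b' i"
      using module_hom_smult[OF f(1), of r b'] that by (simp add: finite_direct_sum_def module_via_def)
    finally show ?thesis .
  qed
  let ?K = "?\<phi> ` L'"
  have K: "primeideal ?K T" by (rule image_prime_localization[OF L'])
  have T_val: "valuation_ring T"
    unfolding T_loc by (rule D.loc_valuation_ring) (rule valuation_ring_axioms)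
  have am': "almost_maximal (T Quot ?K)" using am by (simp add: localization_quotient_def)
  have sK: "?\<phi> s \<notin> ?K"
  proof
    assume "?\<phi> s \<in> ?K"
    then obtain l where l: "l \<in> L'" "D.Frac s \<one> = D.Frac l \<one>" by (auto simp: \<phi>)
    then have "s = l" using D.frac_one_inj[OF s(1) ideal.Icarr[OF L'_ideal l(1)]] by blast
    then show False using l(1) s(2) by blast
  qed
  have "\<exists>Y\<in>I i. \<forall>(r, b)\<in>\<Lambda>. \<exists>j\<in>I i. Y = f b i \<oplus>\<^bsub>T\<^esub> ?\<phi> r \<otimes>\<^bsub>T\<^esub> j" if i: "i < n" for i
  proof -
    have f_memi: "f b i \<in> I i" if "b \<in> B" for b using PiE_mem[OF f_mem[OF that], of i] i by simp
    have "\<exists>Y\<in>I i. \<forall>(c, \<rho>)\<in>(\<lambda>(r, b). (f b i, ?\<phi> r)) ` \<Lambda>. \<exists>j\<in>I i. Y = c \<oplus>\<^bsub>T\<^esub> \<rho> \<otimes>\<^bsub>T\<^esub> j"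
    proof (rule valuation_ring.ideal_cosets_common_element[OF T_val I[OF i] K am' \<phi>_closed[OF s(1)] sK])
      fix c \<rho> assume "(c, \<rho>) \<in> (\<lambda>(r, b). (f b i, ?\<phi> r)) ` \<Lambda>"
      then obtain r b where rb: "(r, b) \<in> \<Lambda>" "c = f b i" "\<rho> = ?\<phi> r" by auto
      obtain y where y: "r \<in> carrier R" "b \<in> B" using \<Lambda>E[OF rb(1)] by blast
      obtain u where u: "u \<in> carrier R" "s = r \<otimes> u" using dvd_s[OF rb(1)] by blast
      show "c \<in> I i \<and> \<rho> \<in> carrier T \<and> (\<exists>u\<in>carrier T. ?\<phi> s = \<rho> \<otimes>\<^bsub>T\<^esub> u)"
      proof (intro conjI bexI)
        show "c \<in> I i" unfolding rb(2) by (rule f_memi[OF y(2)])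
        show "\<rho> \<in> carrier T" unfolding rb(3) by (rule \<phi>_closed[OF y(1)])
        show "?\<phi> s = \<rho> \<otimes>\<^bsub>T\<^esub> ?\<phi> u" unfolding rb(3) u(2) by (rule \<phi>_mult[OF y(1) u(1)])
        show "?\<phi> u \<in> carrier T" by (rule \<phi>_closed[OF u(1)])
      qed
    next
      fix c \<rho> c' \<rho>' assume "(c, \<rho>) \<in> (\<lambda>(r, b). (f b i, ?\<phi> r)) ` \<Lambda>" "(c', \<rho>') \<in> (\<lambda>(r, b). (f b i, ?\<phi> r)) ` \<Lambda>"
      then obtain r b r' b' where rb: "(r, b) \<in> \<Lambda>" "c = f b i" "\<rho> = ?\<phi> r"
        and rb': "(r', b') \<in> \<Lambda>" "c' = f b' i" "\<rho>' = ?\<phi> r'" by auto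
      have y: "r \<in> carrier R" "b \<in> B" using \<Lambda>E[OF rb(1)] by blast+
      have y': "r' \<in> carrier R" "b' \<in> B" using \<Lambda>E[OF rb'(1)] by blast+
      consider u where "u \<in> carrier R" "r' = r \<otimes> u" | u where "u \<in> carrier R" "r = r' \<otimes> u"
        using divides_total[OF y(1) y'(1)] by blast
      then show "(\<exists>j\<in>I i. c' = c \<oplus>\<^bsub>T\<^esub> \<rho> \<otimes>\<^bsub>T\<^esub> j) \<or> (\<exists>j\<in>I i. c' = c \<oplus>\<^bsub>T\<^esub> \<rho>' \<otimes>\<^bsub>T\<^esub> j)"
      proof cases
        case (1 u)
        obtain b1 where b1: "b1 \<in> B" "b' = b \<oplus>\<^bsub>M\<^esub> r \<cdot> b1"
          using compatible[OF rb(1) rb'(1) 1] by blast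
        have "c' = c \<oplus>\<^bsub>T\<^esub> \<rho> \<otimes>\<^bsub>T\<^esub> f b1 i"
          unfolding rb(2,3) rb'(2) b1(2) by (rule f_lin[OF y(2) b1(1) y(1) i])
        then show ?thesis using f_memi[OF b1(1)] by blast
      next
        case (2 u)
        obtain b1 where b1: "b1 \<in> B" "b = b' \<oplus>\<^bsub>M\<^esub> r' \<cdot> b1"
          using compatible[OF rb'(1) rb(1) 2] by blast
        have M: "b \<in> carrier M" "b' \<in> carrier M" "b1 \<in> carrier M" using B_sub y(2) y'(2) b1(1) by auto
        have "b = r' \<cdot> b1 \<oplus>\<^bsub>M\<^esub> b'" using b1(2) M y'(1) by (simp add: M.a_comm)
        then have "b' = b \<ominus>\<^bsub>M\<^esub> r' \<cdot> b1"
          using M.eq_add_iff_minus_eq[of b "r' \<cdot> b1" b'] M y'(1) by simp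
        then have b': "b' = b \<oplus>\<^bsub>M\<^esub> r' \<cdot> (\<ominus>\<^bsub>M\<^esub> b1)"
          using M y'(1) by (simp add: a_minus_def smult_r_minus)
        have "f b' i = f b i \<oplus>\<^bsub>T\<^esub> ?\<phi> r' \<otimes>\<^bsub>T\<^esub> f (\<ominus>\<^bsub>M\<^esub> b1) i"
          by (subst b') (rule f_lin[OF y(2) B_neg[OF b1(1)] y'(1) i])
        then have "c' = c \<oplus>\<^bsub>T\<^esub> \<rho>' \<otimes>\<^bsub>T\<^esub> f (\<ominus>\<^bsub>M\<^esub> b1) i"
          unfolding rb(2) rb'(2,3) .
        then show ?thesis using f_memi[OF B_neg[OF b1(1)]] by blast
      qed
    qed
    then show ?thesis by (simp add: case_prod_unfold)
  qed
  then have "\<forall>i\<in>{..<n}. \<exists>Y. Y \<in> I i \<and> (\<forall>(r, b)\<in>\<Lambda>. \<exists>j\<in>I i. Y = f b i \<oplus>\<^bsub>T\<^esub> ?\<phi> r \<otimes>\<^bsub>T\<^esub> j)"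
    by (simp add: Bex_def)
  then obtain Y where Y: "\<And>i. i < n \<Longrightarrow> Y i \<in> I i"
    "\<And>i r b. \<lbrakk>i < n; (r, b) \<in> \<Lambda>\<rbrakk> \<Longrightarrow> \<exists>j\<in>I i. Y i = f b i \<oplus>\<^bsub>T\<^esub> ?\<phi> r \<otimes>\<^bsub>T\<^esub> j"
    unfolding bchoice_iff by fastforce
  obtain c where c: "c \<in> B" "f c = restrict Y {..<n}"
    using f_surj[of "restrict Y {..<n}"] Y(1) by auto
  have "\<exists>y\<in>carrier M. r \<cdot> y = x \<oplus>\<^bsub>M\<^esub> c" if \<Lambda>: "(r, b) \<in> \<Lambda>" for r b
  proof -
    obtain y where y: "r \<in> carrier R" "b \<in> B" "b \<in> carrier M" "y \<in> carrier M"
      "r \<cdot> y = x \<oplus>\<^bsub>M\<^esub> b" using \<Lambda>E[OF \<Lambda>] by blast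
    have "\<forall>i\<in>{..<n}. \<exists>j. j \<in> I i \<and> Y i = f b i \<oplus>\<^bsub>T\<^esub> ?\<phi> r \<otimes>\<^bsub>T\<^esub> j"
      using Y(2)[OF _ \<Lambda>] by (simp add: Bex_def)
    then obtain j where j: "\<And>i. i < n \<Longrightarrow> j i \<in> I i \<and> Y i = f b i \<oplus>\<^bsub>T\<^esub> ?\<phi> r \<otimes>\<^bsub>T\<^esub> j i"
      unfolding bchoice_iff by auto
    obtain b1 where b1: "b1 \<in> B" "f b1 = restrict j {..<n}"
      using f_surj[of "restrict j {..<n}"] j by auto
    have rb1: "r \<cdot> b1 \<in> B" by (rule B_smult[OF y(1) b1(1)])
    have "f c = f (b \<oplus>\<^bsub>M\<^esub> r \<cdot> b1)"
    proof (rule PiE_ext[OF f_mem[OF c(1)] f_mem[OF B_add[OF y(2) rb1]]])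
      fix i assume "i \<in> {..<n}"
      then have i: "i < n" by simp
      show "f c i = f (b \<oplus>\<^bsub>M\<^esub> r \<cdot> b1) i"
        unfolding f_lin[OF y(2) b1(1) y(1) i] c(2) b1(2) using j[OF i] i by simp
    qed
    then have c_eq: "c = b \<oplus>\<^bsub>M\<^esub> r \<cdot> b1" by (rule f_inj[OF _ c(1) B_add[OF y(2) rb1]])
    have b1M: "b1 \<in> carrier M" using b1(1) B_sub by blast
    have "r \<cdot> (y \<oplus>\<^bsub>M\<^esub> b1) = x \<oplus>\<^bsub>M\<^esub> c"
      using y(1,3,4) b1M x by (simp add: c_eq smult_r_distr y(5) M.a_assoc)
    then show ?thesis using M.a_closed[OF y(4) b1M] by blast
  qed
  then show ?thesis using c(1) unfolding \<Lambda>_def by blast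
qed

text \<open>
  With \<open>c\<close> as above, \<open>s\<close> does not divide \<open>x + c\<close>.  So if \<open>p z = b (x + c)\<close> with \<open>p \<noteq> 0\<close>, then \<open>p\<close>
  divides \<open>b s\<close>, say \<open>b s = p a\<close>, and \<open>s z = a (x + c)\<close> places \<open>z\<close> in the cyclic hull.
\<close>

lemma extend_unless_divisible:
  assumes L': "primeideal L' R" "L' \<subseteq> L" and am: "almost_maximal (localization_quotient R L L')"
    and B: "pure_submodule R B M" and iso: "ideal_sum_iso R L n (M\<lparr>carrier := B\<rparr>)"
    and s: "s \<in> carrier R" "s \<notin> L'" and x: "x \<in> carrier M"
    and not_divisible: "\<And>y b. \<lbrakk>y \<in> carrier M; b \<in> B\<rbrakk> \<Longrightarrow> x \<noteq> s \<cdot> y \<oplus>\<^bsub>M\<^esub> b"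
  shows "\<exists>B'. pure_submodule R B' M \<and> B \<subset> B' \<and> ideal_sum_iso R L (Suc n) (M\<lparr>carrier := B'\<rparr>)"
proof -
  have subB: "submodule_of R M B" by (rule pure_submodule_of[OF B])
  note B_sub = submodule_of.N_subset[OF subB]
  note B_add = submodule_of.N_add[OF subB]
  note B_neg = submodule_of.N_neg[OF subB]
  have L'_ideal: "ideal L' R" using L'(1) by (simp add: primeideal_def)
  have s0: "s \<noteq> \<zero>"
    using s(2) additive_subgroup.zero_closed[OF ideal.axioms(1)[OF L'_ideal]] by metis
  obtain c where c: "c \<in> B" and c_best: "\<And>r b y. \<lbrakk>r \<in> carrier R; b \<in> B; y \<in> carrier M;
      r \<cdot> y = x \<oplus>\<^bsub>M\<^esub> b\<rbrakk> \<Longrightarrow> \<exists>y\<in>carrier M. r \<cdot> y = x \<oplus>\<^bsub>M\<^esub> c"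
    using divisible_representative[OF L' am B iso s x not_divisible] by metis
  define x' where "x' = x \<oplus>\<^bsub>M\<^esub> c"
  have cM: "c \<in> carrier M" using c B_sub by blast
  have x': "x' \<in> carrier M" using x cM by (simp add: x'_def)
  have x_eq: "x = x' \<oplus>\<^bsub>M\<^esub> (\<ominus>\<^bsub>M\<^esub> c)"
    using M.eq_add_iff_minus_eq[of x' c x] x' x cM by (simp add: x'_def a_minus_def M.a_comm)
  have s_not_dvd: "s \<cdot> y \<noteq> x'" if "y \<in> carrier M" for y
    using not_divisible[OF that B_neg[OF c]] x_eq by metis
  have "x' \<notin> B"
  proof
    assume "x' \<in> B"
    then have "x \<in> B" by (subst x_eq) (rule B_add[OF _ B_neg[OF c]])
    then show False using not_divisible[OF M.zero_closed, of x] s(1) x by simp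
  qed
  show ?thesis
  proof (rule extend_pure_sum_of_ideals[OF B iso x' \<open>x' \<notin> B\<close> s(1) s0])
    fix u b y assume u: "u \<in> carrier R" "b \<in> B" "y \<in> carrier M" "u \<cdot> y = x' \<oplus>\<^bsub>M\<^esub> b"
    then have "u \<cdot> y = x \<oplus>\<^bsub>M\<^esub> (c \<oplus>\<^bsub>M\<^esub> b)"
      using x cM B_sub by (auto simp: x'_def M.a_assoc)
    then show "\<exists>y\<in>carrier M. u \<cdot> y = x'"
      unfolding x'_def by (rule c_best[OF u(1) B_add[OF c u(2)] u(3)])
  next
    fix p z b assume p: "p \<in> carrier R" "p \<noteq> \<zero>" and z: "z \<in> carrier M" and b: "b \<in> carrier R"
      and eq: "p \<cdot> z = b \<cdot> x'"
    have bs: "b \<otimes> s \<in> carrier R" using b s by simp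
    have "p \<noteq> (b \<otimes> s) \<otimes> w" if w: "w \<in> carrier R" for w
    proof
      assume pw: "p = (b \<otimes> s) \<otimes> w"
      have b0: "b \<noteq> \<zero>" using p(2) pw s(1) w by auto
      have wz: "w \<cdot> z \<in> carrier M" using w z by simp
      have "b \<cdot> (s \<cdot> (w \<cdot> z)) = b \<cdot> x'"
        unfolding eq[symmetric] pw using b s(1) w z by (simp add: smult_assoc1)
      then have "s \<cdot> (w \<cdot> z) = x'"
        by (rule smult_cancel[OF _ b _ x' b0]) (use s(1) wz in simp)
      then show False using s_not_dvd[OF wz] by blast
    qed
    then obtain a where a: "a \<in> carrier R" "b \<otimes> s = p \<otimes> a"
      using divides_total[OF p(1) bs] by blast
    have "p \<cdot> (s \<cdot> z) = s \<cdot> (b \<cdot> x')"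
      unfolding eq[symmetric] by (rule smult_lcomm[OF p(1) s(1) z])
    also have "\<dots> = (b \<otimes> s) \<cdot> x'" using b s(1) x' by (simp add: m_comm flip: smult_assoc1)
    also have "\<dots> = p \<cdot> (a \<cdot> x')" unfolding a(2) using a(1) p(1) x' by (simp add: smult_assoc1)
    finally have sz: "s \<cdot> z = a \<cdot> x'"
      by (rule smult_cancel[OF _ p(1) _ _ p(2)]) (use s(1) z a(1) x' in simp_all)
    show "z \<in> cyclic_hull s x'"
      by (rule cyclic_hullI[OF z D.one_denominator a(1)]) (use sz s(1) in simp)
  qed
qed

lemma ideal_sum_iso_zero: "ideal_sum_iso R L 0 (M\<lparr>carrier := {\<zero>\<^bsub>M\<^esub>}\<rparr>)"
proof -
  have "module_isomorphic R (M\<lparr>carrier := {\<zero>\<^bsub>M\<^esub>}\<rparr>) (finite_direct_sum 0 N)" for N :: "nat \<Rightarrow> ('a, ('a \<times> 'a) set) module"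
    unfolding module_isomorphic_def
    by (intro bexI[of _ "\<lambda>_ _. undefined"])
      (auto simp: module_hom_def finite_direct_sum_def bij_betw_def restrict_def)
  then show ?thesis unfolding ideal_sum_iso_def by blast
qed

text \<open>
  \<open>Q\<close> stands for what maximality is to give: that the quotient by \<open>B\<close> is divisible outside the
  next prime, or, over the field of quotients, that \<open>B\<close> is the whole module.
\<close>

lemma exists_pure_sum_of_ideals:
  assumes bounded: "\<And>n C. pure_chain R M n C \<Longrightarrow> n \<le> d"
    and extend: "\<And>B n. \<lbrakk>pure_submodule R B M; ideal_sum_iso R L n (M\<lparr>carrier := B\<rparr>); \<not> Q B\<rbrakk> \<Longrightarrow>
      \<exists>B'. pure_submodule R B' M \<and> B \<subset> B' \<and> ideal_sum_iso R L (Suc n) (M\<lparr>carrier := B'\<rparr>)"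
  shows "\<exists>B n. pure_submodule R B M \<and> ideal_sum_iso R L n (M\<lparr>carrier := B\<rparr>) \<and> Q B"
proof -
  define P where "P n \<longleftrightarrow> (\<exists>C. pure_chain R M n C \<and> ideal_sum_iso R L n (M\<lparr>carrier := C n\<rparr>))" for n
  have "P 0"
    unfolding P_def pure_chain_def using pure_zero ideal_sum_iso_zero
    by (intro exI[of _ "\<lambda>_. {\<zero>\<^bsub>M\<^esub>}"]) simp
  moreover have "\<And>n. P n \<Longrightarrow> n \<le> d" using bounded unfolding P_def by blast
  ultimately obtain n where n: "P n" "\<And>k. P k \<Longrightarrow> k \<le> n"
    using GreatestI_nat[of P 0 d] Greatest_le_nat[of P _ d] by blast
  obtain C where C: "pure_chain R M n C" "ideal_sum_iso R L n (M\<lparr>carrier := C n\<rparr>)"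
    using n(1) unfolding P_def by blast
  have pure: "pure_submodule R (C n) M" using C(1) by (simp add: pure_chain_def)
  have "Q (C n)"
  proof (rule ccontr)
    assume "\<not> Q (C n)"
    then obtain B' where B': "pure_submodule R B' M" "C n \<subset> B'"
      "ideal_sum_iso R L (Suc n) (M\<lparr>carrier := B'\<rparr>)"
      using extend[OF pure C(2)] by blast
    have "pure_chain R M (Suc n) (C(Suc n := B'))"
      using C(1) B'(1,2) unfolding pure_chain_def by (auto simp: less_Suc_eq le_Suc_eq)
    then have "P (Suc n)" unfolding P_def using B'(3) by (intro exI[of _ "C(Suc n := B')"]) simp
    then show False using n(2)[of "Suc n"] by simp
  qed
  then show ?thesis using pure C(2) by blast
qed

lemma basic_submodule:
  assumes bounded: "\<And>n C. pure_chain R M n C \<Longrightarrow> n \<le> d"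
    and L': "primeideal L' R" "L' \<subseteq> L" and am: "almost_maximal (localization_quotient R L L')"
  shows "\<exists>B n. pure_submodule R B M \<and> ideal_sum_iso R L n (M\<lparr>carrier := B\<rparr>) \<and>
    (\<forall>s\<in>carrier R - L'. \<forall>x\<in>carrier M. \<exists>y\<in>carrier M. \<exists>b\<in>B. x = s \<cdot> y \<oplus>\<^bsub>M\<^esub> b)"
proof (rule exists_pure_sum_of_ideals[OF bounded])
  fix B n assume B: "pure_submodule R B M" "ideal_sum_iso R L n (M\<lparr>carrier := B\<rparr>)"
    and "\<not> (\<forall>s\<in>carrier R - L'. \<forall>x\<in>carrier M. \<exists>y\<in>carrier M. \<exists>b\<in>B. x = s \<cdot> y \<oplus>\<^bsub>M\<^esub> b)"
  then obtain s x where "s \<in> carrier R" "s \<notin> L'" "x \<in> carrier M"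
    "\<And>y b. \<lbrakk>y \<in> carrier M; b \<in> B\<rbrakk> \<Longrightarrow> x \<noteq> s \<cdot> y \<oplus>\<^bsub>M\<^esub> b" by blast
  then show "\<exists>B'. pure_submodule R B' M \<and> B \<subset> B' \<and> ideal_sum_iso R L (Suc n) (M\<lparr>carrier := B'\<rparr>)"
    by (rule extend_unless_divisible[OF L' am B])
qed

text \<open>
  Here \<open>R\<^sub>L\<close> is the field of quotients, and its ideals \<open>0\<close> and \<open>R\<^sub>L\<close> make this the existence of a
  basis.
\<close>

lemma divisible_imp_sum_of_ideals:
  assumes bounded: "\<And>n C. pure_chain R M n C \<Longrightarrow> n \<le> d" and L: "L = {\<zero>}"
  shows "\<exists>n. ideal_sum_iso R L n M"
proof -
  have "\<exists>B n. pure_submodule R B M \<and> ideal_sum_iso R L n (M\<lparr>carrier := B\<rparr>) \<and> B = carrier M"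
  proof (rule exists_pure_sum_of_ideals[OF bounded])
    fix B n assume B: "pure_submodule R B M" "ideal_sum_iso R L n (M\<lparr>carrier := B\<rparr>)" "B \<noteq> carrier M"
    then obtain x where x: "x \<in> carrier M" "x \<notin> B"
      using submodule_of.N_subset[OF pure_submodule_of[OF B(1)]] by blast
    show "\<exists>B'. pure_submodule R B' M \<and> B \<subset> B' \<and> ideal_sum_iso R L (Suc n) (M\<lparr>carrier := B'\<rparr>)"
    proof (rule extend_pure_sum_of_ideals[OF B(1,2) x one_closed one_not_zero])
      fix u assume "u \<in> carrier R" "u \<noteq> \<zero>"
      then show "\<exists>y\<in>carrier M. u \<cdot> y = x" using divisibleE[of u x] x(1) L by (metis singletonD)
    next
      fix p z b assume "p \<in> carrier R" "p \<noteq> \<zero>" "z \<in> carrier M" "b \<in> carrier R"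
        "p \<cdot> z = b \<cdot> x"
      then show "z \<in> cyclic_hull \<one> x" using L by (intro cyclic_hullI[of z p b]) simp_all
    qed
  qed
  then obtain n where "ideal_sum_iso R L n (M\<lparr>carrier := carrier M\<rparr>)" by blast
  moreover have "M\<lparr>carrier := carrier M\<rparr> = M" by (cases M) simp
  ultimately show ?thesis by auto
qed

end

section \<open>Finite rank\<close>

text \<open>
  One vector from each step of the chain gives an independent set.
\<close>

lemma (in vectorspace) chain_of_subspaces_le_dim:
  assumes fin_dim and W: "\<And>i. i \<le> n \<Longrightarrow> LinearCombinations.submodule K (W i) V"
    and strict: "\<And>i. i < n \<Longrightarrow> W i \<subset> W (Suc i)"
  shows "n \<le> dim"
proof -
  have "\<exists>A. finite A \<and> A \<subseteq> W k \<and> lin_indpt A \<and> card A = k" if "k \<le> n" for k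
    using that
  proof (induction k)
    case 0
    show ?case by (intro exI[of _ "{}"]) (simp add: lin_dep_def)
  next
    case (Suc k)
    then obtain A where A: "finite A" "A \<subseteq> W k" "lin_indpt A" "card A = k" by auto
    have Wk: "LinearCombinations.submodule K (W k) V" using W Suc.prems by simp
    have Wk_sub: "W k \<subseteq> carrier V" using Wk by (simp add: LinearCombinations.submodule_def)
    have WSk_sub: "W (Suc k) \<subseteq> carrier V"
      using W[OF Suc.prems] by (simp add: LinearCombinations.submodule_def)
    obtain v where v: "v \<in> W (Suc k)" "v \<notin> W k" using strict[of k] Suc.prems by auto
    have "v \<notin> span A" using span_is_subset[OF A(2) Wk] v(2) by blast
    then have "lin_indpt (A \<union> {v})"
      using lin_dep_iff_in_span[of A v] A Wk_sub WSk_sub v by blast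
    moreover have "A \<union> {v} \<subseteq> W (Suc k)" using A(2) v(1) strict[of k] Suc.prems by auto
    moreover have "v \<notin> A" using A(2) v(2) by blast
    then have "card (A \<union> {v}) = Suc k" using A(1,4) by simp
    ultimately show ?case using A(1) by (intro exI[of _ "A \<union> {v}"]) simp
  qed
  then obtain A where A: "finite A" "A \<subseteq> W n" "lin_indpt A" "card A = n" by blast
  have "W n \<subseteq> carrier V" using W[of n] by (simp add: LinearCombinations.submodule_def)
  then have "card A \<le> dim" using A by (intro li_le_dim(2) assms(1)) auto
  then show ?thesis using A(4) by simp
qed

text \<open>
  Working in \<open>Q \<otimes> M\<close> through representatives in the free abelian group reduces its operations to
  sums of symbols, with equality decided by membership in the relations.
\<close>

locale base_change_to_fractions = tf_module
begin

abbreviation "nonzero \<equiv> carrier R - {\<zero>}"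
abbreviation "keys \<equiv> Poly_Mapping.keys"

sublocale D: denominators R nonzero
  by (rule denominators_nonzero)

abbreviation "Q \<equiv> D.loc"
abbreviation "emb r \<equiv> D.Frac r \<one>"
abbreviation "S \<equiv> carrier Q \<times> carrier M"
abbreviation "Fr \<equiv> free_Abelian_group S"
abbreviation "Rel \<equiv> tensor_relations R (module_via emb Q) M"
abbreviation "V \<equiv> base_change R emb Q M"
abbreviation "cls z \<equiv> Rel #>\<^bsub>Fr\<^esub> z"
abbreviation "act b \<equiv> frag_extend (\<lambda>(q, x). frag_of (b \<otimes>\<^bsub>Q\<^esub> q, x))"
abbreviation "tens q x \<equiv> cls (frag_of (q, x))"

definition generators where
  "generators =
    {frag_of (p \<oplus>\<^bsub>Q\<^esub> q, x) - frag_of (p, x) - frag_of (q, x) | p q x.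
        p \<in> carrier Q \<and> q \<in> carrier Q \<and> x \<in> carrier M} \<union>
    {frag_of (p, x \<oplus>\<^bsub>M\<^esub> y) - frag_of (p, x) - frag_of (p, y) | p x y.
        p \<in> carrier Q \<and> x \<in> carrier M \<and> y \<in> carrier M} \<union>
    {frag_of (emb r \<otimes>\<^bsub>Q\<^esub> p, x) - frag_of (p, r \<cdot> x) | r p x.
        r \<in> carrier R \<and> p \<in> carrier Q \<and> x \<in> carrier M}"

lemma Rel_generate: "Rel = generate Fr generators"
  by (simp add: tensor_relations_def generators_def module_via_def)

lemma Q_field: "field Q"
  using fraction_field_field by (simp add: fraction_field_def)

sublocale Q: field Q
  by (rule Q_field)

lemma emb_closed [simp]: "r \<in> carrier R \<Longrightarrow> emb r \<in> carrier Q"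
  using D.one_denominator by simp

lemma keys_diff_subset:
  "\<lbrakk>keys a \<subseteq> X; keys b \<subseteq> X\<rbrakk> \<Longrightarrow> keys (a - b) \<subseteq> X"
  using keys_diff[of a b] by blast

lemma generators_cases [consumes 1, case_names add_left add_right balanced]:
  assumes "h \<in> generators"
  obtains p q x where "h = frag_of (p \<oplus>\<^bsub>Q\<^esub> q, x) - frag_of (p, x) - frag_of (q, x)"
      "p \<in> carrier Q" "q \<in> carrier Q" "x \<in> carrier M"
    | p x y where "h = frag_of (p, x \<oplus>\<^bsub>M\<^esub> y) - frag_of (p, x) - frag_of (p, y)"
      "p \<in> carrier Q" "x \<in> carrier M" "y \<in> carrier M"
    | r p x where "h = frag_of (emb r \<otimes>\<^bsub>Q\<^esub> p, x) - frag_of (p, r \<cdot> x)"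
      "r \<in> carrier R" "p \<in> carrier Q" "x \<in> carrier M"
  using assms unfolding generators_def by blast

lemma generators_carrier: "generators \<subseteq> carrier Fr"
proof
  fix h assume "h \<in> generators"
  then have "keys h \<subseteq> S"
  proof (cases rule: generators_cases)
    case (add_left p q x)
    show ?thesis unfolding add_left(1) by (intro keys_diff_subset) (use add_left in simp_all)
  next
    case (add_right p x y)
    show ?thesis unfolding add_right(1) by (intro keys_diff_subset) (use add_right in simp_all)
  next
    case (balanced r p x)
    show ?thesis unfolding balanced(1)
      by (intro keys_diff_subset) (use balanced Q.m_closed[OF emb_closed[OF balanced(2)] balanced(3)] in simp_all)
  qed
  then show "h \<in> carrier Fr" by simp
qed

lemma Rel_subgroup: "subgroup Rel Fr"
  unfolding Rel_generate by (rule group.generate_is_subgroup[OF group_free_Abelian_group generators_carrier])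

lemma Rel_zero: "0 \<in> Rel"
  using subgroup.one_closed[OF Rel_subgroup] by simp

lemma Rel_add: "\<lbrakk>a \<in> Rel; b \<in> Rel\<rbrakk> \<Longrightarrow> a + b \<in> Rel"
  using subgroup.m_closed[OF Rel_subgroup] by simp

lemma Rel_carrier: "a \<in> Rel \<Longrightarrow> keys a \<subseteq> S"
  using subsetD[OF subgroup.subset[OF Rel_subgroup], of a]
  by (simp only: carrier_free_Abelian_group_iff)

lemma Rel_uminus: "a \<in> Rel \<Longrightarrow> - a \<in> Rel"
  using subgroup.m_inv_closed[OF Rel_subgroup, of a] Rel_carrier[of a] by simp

lemma Rel_diff: "\<lbrakk>a \<in> Rel; b \<in> Rel\<rbrakk> \<Longrightarrow> a - b \<in> Rel"
  using Rel_add[of a "- b"] Rel_uminus[of b] by simp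

lemma Rel_generators: "g \<in> generators \<Longrightarrow> g \<in> Rel"
  unfolding Rel_generate by (rule generate.incl)

lemma Rel_add_left:
  "\<lbrakk>p \<in> carrier Q; q \<in> carrier Q; x \<in> carrier M\<rbrakk> \<Longrightarrow>
    frag_of (p \<oplus>\<^bsub>Q\<^esub> q, x) - frag_of (p, x) - frag_of (q, x) \<in> Rel"
  by (rule Rel_generators) (unfold generators_def, blast)

lemma Rel_add_right:
  "\<lbrakk>p \<in> carrier Q; x \<in> carrier M; y \<in> carrier M\<rbrakk> \<Longrightarrow>
    frag_of (p, x \<oplus>\<^bsub>M\<^esub> y) - frag_of (p, x) - frag_of (p, y) \<in> Rel"
  by (rule Rel_generators) (unfold generators_def, blast)

lemma Rel_balanced:
  "\<lbrakk>r \<in> carrier R; p \<in> carrier Q; x \<in> carrier M\<rbrakk> \<Longrightarrow>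
    frag_of (emb r \<otimes>\<^bsub>Q\<^esub> p, x) - frag_of (p, r \<cdot> x) \<in> Rel"
  by (rule Rel_generators) (unfold generators_def, blast)

lemma cls_def': "cls z = (\<lambda>k. k + z) ` Rel"
  by (auto simp: r_coset_def)

lemma cls_eq_iff: "cls z = cls z' \<longleftrightarrow> z - z' \<in> Rel"
proof
  assume "cls z = cls z'"
  then have "z \<in> cls z'" using Rel_zero unfolding cls_def' by force
  then show "z - z' \<in> Rel" unfolding cls_def' by auto
next
  assume d: "z - z' \<in> Rel"
  show "cls z = cls z'"
  proof
    show "cls z \<subseteq> cls z'"
      using Rel_add[OF _ d] unfolding cls_def' by (force simp: image_iff intro: bexI[of _ "_ + (z - z')"])
    show "cls z' \<subseteq> cls z"
      using Rel_diff[OF _ d] unfolding cls_def' by (force simp: image_iff intro: bexI[of _ "_ - (z - z')"])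
  qed
qed

lemma V_carrier: "carrier V = cls ` {z. keys z \<subseteq> S}"
  by (auto simp: base_change_def Let_def RCOSETS_def)

lemma V_zero: "\<zero>\<^bsub>V\<^esub> = cls 0"
  by (simp add: base_change_def Let_def cls_def')

lemma V_add: "cls a \<oplus>\<^bsub>V\<^esub> cls b = cls (a + b)"
proof -
  have "cls a <#>\<^bsub>Fr\<^esub> cls b = cls (a + b)"
  proof
    show "cls a <#>\<^bsub>Fr\<^esub> cls b \<subseteq> cls (a + b)"
    proof
      fix w assume "w \<in> cls a <#>\<^bsub>Fr\<^esub> cls b"
      then obtain k l where "k \<in> Rel" "l \<in> Rel" "w = (k + a) + (l + b)"
        unfolding set_mult_def cls_def' by auto
      then show "w \<in> cls (a + b)"
        using Rel_add[of k l] unfolding cls_def' by (intro image_eqI[of _ _ "k + l"]) simp_all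
    qed
    show "cls (a + b) \<subseteq> cls a <#>\<^bsub>Fr\<^esub> cls b"
    proof
      fix w assume "w \<in> cls (a + b)"
      then obtain k where k: "k \<in> Rel" "w = (k + a) + (0 + b)"
        unfolding cls_def' by (auto simp: add.assoc)
      have "k + a \<in> cls a" "0 + b \<in> cls b"
        unfolding cls_def' using imageI[OF k(1), of "\<lambda>k. k + a"] imageI[OF Rel_zero, of "\<lambda>k. k + b"]
        by simp_all
      then show "w \<in> cls a <#>\<^bsub>Fr\<^esub> cls b"
        unfolding set_mult_def k(2) by (simp, blast)
    qed
  qed
  then show ?thesis by (simp add: base_change_def Let_def)
qed

lemma act_keys:
  assumes "b \<in> carrier Q" "keys z \<subseteq> S"
  shows "keys (act b z) \<subseteq> S"
  using keys_frag_extend[of "\<lambda>(q, x). frag_of (b \<otimes>\<^bsub>Q\<^esub> q, x)" z] assms by force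

lemma act_generators:
  assumes b: "b \<in> carrier Q" and h: "h \<in> generators"
  shows "act b h \<in> Rel"
proof -
  show ?thesis
    using h
  proof (cases rule: generators_cases)
    case (add_left p q x)
    then show ?thesis using Rel_add_left[of "b \<otimes>\<^bsub>Q\<^esub> p" "b \<otimes>\<^bsub>Q\<^esub> q" x] b
      by (simp add: frag_extend_diff Q.r_distr)
  next
    case (add_right p x y)
    then show ?thesis using Rel_add_right[of "b \<otimes>\<^bsub>Q\<^esub> p" x y] b by (simp add: frag_extend_diff)
  next
    case (balanced r p x)
    have "b \<otimes>\<^bsub>Q\<^esub> (emb r \<otimes>\<^bsub>Q\<^esub> p) = emb r \<otimes>\<^bsub>Q\<^esub> (b \<otimes>\<^bsub>Q\<^esub> p)"
      using b emb_closed[OF balanced(2)] balanced(3) by (rule Q.m_lcomm)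
    then show ?thesis using Rel_balanced[OF balanced(2) Q.m_closed[OF b balanced(3)] balanced(4)]
      by (simp add: frag_extend_diff balanced(1))
  qed
qed

text \<open>
  Multiplication by \<open>b\<close> on classes is well defined because it maps each defining relation to a
  relation of the same kind.
\<close>

lemma act_Rel:
  assumes b: "b \<in> carrier Q" and k: "k \<in> Rel"
  shows "act b k \<in> Rel"
proof -
  have "k \<in> generate Fr generators" using k by (simp only: Rel_generate)
  then show ?thesis
  proof (induction rule: generate.induct)
    case one
    show ?case using Rel_zero by simp
  next
    case (incl h)
    then show ?case by (rule act_generators[OF b])
  next
    case (inv h)
    have "inv\<^bsub>Fr\<^esub> h = - h"
      using subsetD[OF generators_carrier inv]
      by (intro inv_free_Abelian_group) (simp only: carrier_free_Abelian_group_iff)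
    then show ?case using Rel_uminus[OF act_generators[OF b inv]] by (simp add: frag_extend_minus)
  next
    case (eng h1 h2)
    then show ?case using Rel_add by (simp add: frag_extend_add)
  qed
qed

lemma V_smult:
  assumes b: "b \<in> carrier Q"
  shows "b \<odot>\<^bsub>V\<^esub> cls z = cls (act b z)"
proof -
  have "cls (act b w) = cls (act b z)" if w: "w \<in> cls z" for w
  proof -
    have "w - z \<in> Rel" using w unfolding cls_def' by auto
    then have "act b w - act b z \<in> Rel" using act_Rel[OF b] by (simp flip: frag_extend_diff)
    then show ?thesis by (simp only: cls_eq_iff)
  qed
  moreover have "z \<in> cls z" using imageI[OF Rel_zero, of "\<lambda>k. k + z"] unfolding cls_def' by simp
  ultimately have "(\<Union>w\<in>cls z. cls (act b w)) = cls (act b z)" by blast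
  then show ?thesis by (simp add: base_change_def Let_def)
qed

lemma V_cases:
  assumes "X \<in> carrier V" obtains z where "keys z \<subseteq> S" "X = cls z"
  using assms unfolding V_carrier by blast

lemma cls_closed: "keys z \<subseteq> S \<Longrightarrow> cls z \<in> carrier V"
  unfolding V_carrier by blast

lemma keys_add_subset:
  "\<lbrakk>keys a \<subseteq> X; keys b \<subseteq> X\<rbrakk> \<Longrightarrow> keys (a + b) \<subseteq> X"
  using keys_add[of a b] by blast

lemma act_add:
  assumes "a \<in> carrier Q" "b \<in> carrier Q" "keys z \<subseteq> S"
  shows "act (a \<oplus>\<^bsub>Q\<^esub> b) z - (act a z + act b z) \<in> Rel"
  using assms(3)
proof (induction z rule: frag_induction)
  case zero
  show ?case using Rel_zero by simp
next
  case (one qx)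
  obtain q x where qx: "qx = (q, x)" "q \<in> carrier Q" "x \<in> carrier M" using one by auto
  then show ?case
    using Rel_add_left[of "a \<otimes>\<^bsub>Q\<^esub> q" "b \<otimes>\<^bsub>Q\<^esub> q" x] assms(1,2)
    by (simp add: Q.l_distr diff_diff_eq)
next
  case (diff z w)
  have "act (a \<oplus>\<^bsub>Q\<^esub> b) (z - w) - (act a (z - w) + act b (z - w)) =
    (act (a \<oplus>\<^bsub>Q\<^esub> b) z - (act a z + act b z)) - (act (a \<oplus>\<^bsub>Q\<^esub> b) w - (act a w + act b w))"
    by (simp add: frag_extend_diff)
  then show ?case using Rel_diff[OF diff] by simp
qed

lemma act_act:
  assumes "a \<in> carrier Q" "b \<in> carrier Q" "keys z \<subseteq> S"
  shows "act (a \<otimes>\<^bsub>Q\<^esub> b) z = act a (act b z)"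
  using assms(3)
proof (induction z rule: frag_induction)
  case (one qx)
  obtain q x where "qx = (q, x)" "q \<in> carrier Q" "x \<in> carrier M" using one by auto
  then show ?case using assms(1,2) by (simp add: Q.m_assoc)
qed (simp_all add: frag_extend_diff)

lemma act_one:
  assumes "keys z \<subseteq> S"
  shows "act \<one>\<^bsub>Q\<^esub> z = z"
  using assms
proof (induction z rule: frag_induction)
  case (one qx)
  obtain q x where "qx = (q, x)" "q \<in> carrier Q" using one by auto
  then show ?case by simp
qed (simp_all add: frag_extend_diff)

lemma V_module: "module Q V"
proof (rule moduleI)
  show "cring Q" by (rule Q.is_cring)
  show "abelian_group V"
  proof (rule abelian_groupI)
    fix X Y Z assume "X \<in> carrier V" "Y \<in> carrier V" "Z \<in> carrier V"
    then obtain a b c where "X = cls a" "Y = cls b" "Z = cls c" unfolding V_carrier by blast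
    then show "(X \<oplus>\<^bsub>V\<^esub> Y) \<oplus>\<^bsub>V\<^esub> Z = X \<oplus>\<^bsub>V\<^esub> (Y \<oplus>\<^bsub>V\<^esub> Z)" by (simp only: V_add add.assoc)
  next
    fix X Y assume "X \<in> carrier V" "Y \<in> carrier V"
    then obtain a b where "keys a \<subseteq> S" "keys b \<subseteq> S" "X = cls a" "Y = cls b"
      unfolding V_carrier by blast
    then show "X \<oplus>\<^bsub>V\<^esub> Y = Y \<oplus>\<^bsub>V\<^esub> X" "X \<oplus>\<^bsub>V\<^esub> Y \<in> carrier V"
      by (simp_all only: V_add add.commute cls_closed keys_add_subset)
  next
    show "\<zero>\<^bsub>V\<^esub> \<in> carrier V" unfolding V_zero by (rule cls_closed) simp
  next
    fix X assume "X \<in> carrier V"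
    then obtain a where a: "keys a \<subseteq> S" "X = cls a" by (rule V_cases)
    show "\<zero>\<^bsub>V\<^esub> \<oplus>\<^bsub>V\<^esub> X = X" unfolding V_zero a(2) V_add by simp
    have "cls (- a) \<in> carrier V" using a(1) by (intro cls_closed) simp
    moreover have "cls (- a) \<oplus>\<^bsub>V\<^esub> X = \<zero>\<^bsub>V\<^esub>" unfolding V_zero a(2) V_add by simp
    ultimately show "\<exists>Y\<in>carrier V. Y \<oplus>\<^bsub>V\<^esub> X = \<zero>\<^bsub>V\<^esub>" by blast
  qed
next
  fix a X assume a: "a \<in> carrier Q" and "X \<in> carrier V"
  then obtain z where z: "keys z \<subseteq> S" "X = cls z" using V_cases by metis
  show "a \<odot>\<^bsub>V\<^esub> X \<in> carrier V" unfolding z(2) V_smult[OF a] by (rule cls_closed[OF act_keys[OF a z(1)]])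
next
  fix a b X assume a: "a \<in> carrier Q" and b: "b \<in> carrier Q" and "X \<in> carrier V"
  then obtain z where z: "keys z \<subseteq> S" "X = cls z" using V_cases by metis
  show "(a \<oplus>\<^bsub>Q\<^esub> b) \<odot>\<^bsub>V\<^esub> X = a \<odot>\<^bsub>V\<^esub> X \<oplus>\<^bsub>V\<^esub> b \<odot>\<^bsub>V\<^esub> X"
    unfolding z(2) V_smult[OF a] V_smult[OF b] V_smult[OF Q.a_closed[OF a b]] V_add cls_eq_iff
    by (rule act_add[OF a b z(1)])
  show "(a \<otimes>\<^bsub>Q\<^esub> b) \<odot>\<^bsub>V\<^esub> X = a \<odot>\<^bsub>V\<^esub> (b \<odot>\<^bsub>V\<^esub> X)"
    unfolding z(2) V_smult[OF a] V_smult[OF b] V_smult[OF Q.m_closed[OF a b]] act_act[OF a b z(1)] ..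
next
  fix a X Y assume a: "a \<in> carrier Q" and "X \<in> carrier V" "Y \<in> carrier V"
  then obtain z w where z: "X = cls z" "Y = cls w" unfolding V_carrier by blast
  show "a \<odot>\<^bsub>V\<^esub> (X \<oplus>\<^bsub>V\<^esub> Y) = a \<odot>\<^bsub>V\<^esub> X \<oplus>\<^bsub>V\<^esub> a \<odot>\<^bsub>V\<^esub> Y"
    unfolding z V_add V_smult[OF a] frag_extend_add ..
next
  fix X assume "X \<in> carrier V"
  then obtain z where z: "keys z \<subseteq> S" "X = cls z" by (rule V_cases)
  show "\<one>\<^bsub>Q\<^esub> \<odot>\<^bsub>V\<^esub> X = X" unfolding z(2) V_smult[OF Q.one_closed] act_one[OF z(1)] ..
qed

lemma V_vectorspace: "vectorspace Q V"
  by (intro vectorspace.intro V_module Q_field)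

lemma tens_closed: "\<lbrakk>q \<in> carrier Q; x \<in> carrier M\<rbrakk> \<Longrightarrow> tens q x \<in> carrier V"
  by (rule cls_closed) simp

lemma tens_balanced:
  "\<lbrakk>r \<in> carrier R; q \<in> carrier Q; x \<in> carrier M\<rbrakk> \<Longrightarrow> tens (emb r \<otimes>\<^bsub>Q\<^esub> q) x = tens q (r \<cdot> x)"
  unfolding cls_eq_iff by (rule Rel_balanced)

lemma tens_add_right:
  assumes "q \<in> carrier Q" "x \<in> carrier M" "y \<in> carrier M"
  shows "tens q (x \<oplus>\<^bsub>M\<^esub> y) = tens q x \<oplus>\<^bsub>V\<^esub> tens q y"
  using Rel_add_right[OF assms] unfolding V_add cls_eq_iff by (simp add: diff_diff_eq)

lemma tens_smult:
  "\<lbrakk>b \<in> carrier Q; q \<in> carrier Q\<rbrakk> \<Longrightarrow> b \<odot>\<^bsub>V\<^esub> tens q x = tens (b \<otimes>\<^bsub>Q\<^esub> q) x"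
  by (simp add: V_smult)

lemma tens_zero_right:
  assumes "q \<in> carrier Q" shows "tens q \<zero>\<^bsub>M\<^esub> = \<zero>\<^bsub>V\<^esub>"
  using Rel_uminus[OF Rel_add_right[OF assms M.zero_closed M.zero_closed]]
  unfolding V_zero cls_eq_iff by simp

text \<open>
  Numerators move across the tensor sign, so every elementary tensor can be written with a
  coefficient \<open>1 / s\<close>; sums of two of them over a common \<open>s\<close> are again elementary.
\<close>

lemma tens_common_denominator:
  assumes "a \<in> carrier R" "s \<in> nonzero" "x \<in> carrier M"
  shows "tens (D.Frac a s) x = tens (D.Frac \<one> s) (a \<cdot> x)"
proof -
  have "D.Frac a s = emb a \<otimes>\<^bsub>Q\<^esub> D.Frac \<one> s"
    using assms(1,2) D.one_denominator by (simp add: D.frac_mult)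
  then show ?thesis using tens_balanced[OF assms(1) _ assms(3), of "D.Frac \<one> s"] assms(2) by simp
qed

definition span_tens :: "'c set \<Rightarrow> _" where
  "span_tens N = {tens q x | q x. q \<in> carrier Q \<and> x \<in> N}"

lemma span_tens_submodule:
  assumes "submodule_of R M N"
  shows "LinearCombinations.submodule Q (span_tens N) V"
  unfolding LinearCombinations.submodule_def
proof (intro conjI allI impI)
  note N_sub = submodule_of.N_subset[OF assms]
  show "module Q V" by (rule V_module)
  show "span_tens N \<subseteq> carrier V" using tens_closed N_sub unfolding span_tens_def by blast
  show "\<zero>\<^bsub>V\<^esub> \<in> span_tens N"
    using tens_zero_right[OF Q.zero_closed] submodule_of.N_zero[OF assms] Q.zero_closed
    unfolding span_tens_def by (metis (mono_tags, lifting) mem_Collect_eq)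
  show "v \<oplus>\<^bsub>V\<^esub> w \<in> span_tens N" if v: "v \<in> span_tens N" and w: "w \<in> span_tens N" for v w
  proof -
    obtain p x where p: "p \<in> carrier Q" "x \<in> N" "v = tens p x" using v unfolding span_tens_def by blast
    obtain q y where q: "q \<in> carrier Q" "y \<in> N" "w = tens q y" using w unfolding span_tens_def by blast
    obtain a b s where s: "a \<in> carrier R" "b \<in> carrier R" "s \<in> nonzero" "p = D.Frac a s" "q = D.Frac b s"
      using D.frac_common_denominator[OF p(1) q(1)] by blast
    have xy: "x \<in> carrier M" "y \<in> carrier M" using p(2) q(2) N_sub by auto
    have s1: "D.Frac \<one> s \<in> carrier Q" using s(3) by simp
    have "v \<oplus>\<^bsub>V\<^esub> w = tens (D.Frac \<one> s) (a \<cdot> x \<oplus>\<^bsub>M\<^esub> b \<cdot> y)"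
      unfolding p(3) q(3) s(4,5) tens_common_denominator[OF s(1,3) xy(1)] tens_common_denominator[OF s(2,3) xy(2)]
      using s(1,2) xy by (intro tens_add_right[OF s1, symmetric]) simp_all
    moreover have "a \<cdot> x \<oplus>\<^bsub>M\<^esub> b \<cdot> y \<in> N"
      using submodule_of.N_add[OF assms] submodule_of.N_smult[OF assms] s(1,2) p(2) q(2) by blast
    ultimately show ?thesis using s1 unfolding span_tens_def by blast
  qed
  show "b \<odot>\<^bsub>V\<^esub> v \<in> span_tens N" if b: "b \<in> carrier Q" and v: "v \<in> span_tens N" for b v
  proof -
    obtain p x where p: "p \<in> carrier Q" "x \<in> N" "v = tens p x" using v unfolding span_tens_def by blast
    show ?thesis unfolding p(3) tens_smult[OF b p(1)] span_tens_def using Q.m_closed[OF b p(1)] p(2) by blast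
  qed
qed

text \<open>
  The homomorphism \<open>h s\<close> sends the symbol \<open>(q, x)\<close> to \<open>(s q) x\<close> if \<open>s q \<in> R\<close>.  It must be defined on
  all symbols and sends the others to \<open>0\<close>.
\<close>

lemma clearing_homs:
  "\<exists>h. (\<forall>s\<in>nonzero. h s \<in> hom Fr (add_monoid M) \<and>
    (\<forall>r\<in>carrier R. \<forall>x\<in>carrier M. h s (frag_of (D.Frac r s, x)) = r \<cdot> x))"
proof -
  have "\<exists>h. h \<in> hom Fr (add_monoid M) \<and>
    (\<forall>r\<in>carrier R. \<forall>x\<in>carrier M. h (frag_of (D.Frac r s, x)) = r \<cdot> x)"
    if s: "s \<in> nonzero" for s
  proof -
    define num where "num X = (THE r. r \<in> carrier R \<and> X = D.Frac r s)" for X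
    have num: "num (D.Frac r s) = r" if "r \<in> carrier R" for r
      unfolding num_def
    proof (rule the_equality)
      fix r' assume r': "r' \<in> carrier R \<and> D.Frac r s = D.Frac r' s"
      then have "r \<otimes> s = r' \<otimes> s" using that s D.frac_eq_iff by blast
      then show "r' = r" using that s r' by (auto simp: m_rcancel)
    qed (simp add: that)
    define clear where "clear p = (if fst p \<in> (\<lambda>r. D.Frac r s) ` carrier R
      then num (fst p) \<cdot> snd p else \<zero>\<^bsub>M\<^esub>)" for p :: "('a \<times> 'a) set \<times> 'c"
    have "clear ` S \<subseteq> carrier (add_monoid M)"
    proof (rule image_subsetI)
      fix p assume "p \<in> S"
      then have "snd p \<in> carrier M" by auto
      then show "clear p \<in> carrier (add_monoid M)" by (auto simp: clear_def num)
    qed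
    then obtain h where h: "h \<in> hom Fr (add_monoid M)" "\<And>p. p \<in> S \<Longrightarrow> h (frag_of p) = clear p"
      using comm_group.free_Abelian_group_universal[OF M.a_comm_group] by blast
    have "h (frag_of (D.Frac r s, x)) = r \<cdot> x" if r: "r \<in> carrier R" and x: "x \<in> carrier M" for r x
    proof -
      have "(D.Frac r s, x) \<in> S" using r x s by simp
      then have "h (frag_of (D.Frac r s, x)) = clear (D.Frac r s, x)" by (rule h(2))
      also have "\<dots> = r \<cdot> x" using r by (simp add: clear_def num)
      finally show ?thesis .
    qed
    then show ?thesis using h(1) by blast
  qed
  then show ?thesis by metis
qed

text \<open>
  The embedding of \<open>M\<close> into \<open>Q \<otimes> M\<close>.  Because of its default value, \<open>h s\<close> does not respect all
  relations, but it kills a given relation once \<open>s\<close> is a multiple of a common denominator of the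
  fractions in it.  The elements that are killed by all multiples of some \<open>s\<close> therefore form a
  subgroup that contains the relations, and a symbol \<open>(1, y)\<close> in it satisfies \<open>s y = 0\<close> for
  some \<open>s \<noteq> 0\<close>.
\<close>

lemma tens_one_eq_zero:
  assumes y: "y \<in> carrier M" and zero: "tens \<one>\<^bsub>Q\<^esub> y = \<zero>\<^bsub>V\<^esub>"
  shows "y = \<zero>\<^bsub>M\<^esub>"
proof -
  obtain h where hom: "\<And>s. s \<in> nonzero \<Longrightarrow> h s \<in> hom Fr (add_monoid M)"
    and h: "\<And>s r x. \<lbrakk>s \<in> nonzero; r \<in> carrier R; x \<in> carrier M\<rbrakk> \<Longrightarrow>
      h s (frag_of (D.Frac r s, x)) = r \<cdot> x"
    using clearing_homs by blast
  have h_closed: "h s a \<in> carrier M" if "s \<in> nonzero" "keys a \<subseteq> S" for s a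
    using hom_in_carrier[OF hom[OF that(1)], of a] that(2) by simp
  have h_add: "h s (a + b) = h s a \<oplus>\<^bsub>M\<^esub> h s b"
    if "s \<in> nonzero" "keys a \<subseteq> S" "keys b \<subseteq> S" for s a b
    using hom_mult[OF hom[OF that(1)], of a b] that(2,3) by simp
  have h_diff: "h s (a - b) = h s a \<ominus>\<^bsub>M\<^esub> h s b"
    if s: "s \<in> nonzero" and ab: "keys a \<subseteq> S" "keys b \<subseteq> S" for s a b
  proof -
    note d = keys_diff_subset[OF ab]
    have "h s a = h s b \<oplus>\<^bsub>M\<^esub> h s (a - b)" using h_add[OF s ab(2) d] by simp
    then show ?thesis
      using M.eq_add_iff_minus_eq[OF h_closed[OF s ab(1)] h_closed[OF s ab(2)] h_closed[OF s d]] by simp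
  qed
  have h_zero: "h s 0 = \<zero>\<^bsub>M\<^esub>" if s: "s \<in> nonzero" for s
    using h_diff[OF s, of 0 0] h_closed[OF s, of 0] by (simp add: a_minus_def M.r_neg)
  have h_uminus: "h s (- a) = \<ominus>\<^bsub>M\<^esub> h s a" if s: "s \<in> nonzero" and a: "keys a \<subseteq> S" for s a
    using h_diff[OF s, of 0 a] a h_zero[OF s] h_closed[OF s a] by (simp add: a_minus_def)
  have rescale: "D.Frac a s = D.Frac (a \<otimes> r) (s \<otimes> r)"
    if "a \<in> carrier R" "s \<in> nonzero" "r \<in> nonzero" for a s r
    using that D.mult_denominator[OF that(2,3)] by (simp add: D.frac_eq_iff m_ac)
  have h_rescale: "h (s \<otimes> r) (frag_of (D.Frac a s, x)) = (a \<otimes> r) \<cdot> x"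
    if "a \<in> carrier R" "s \<in> nonzero" "r \<in> nonzero" "x \<in> carrier M" for a s r x
    unfolding rescale[OF that(1-3)] using that by (intro h D.mult_denominator) simp_all
  define killed where "killed z \<longleftrightarrow> (\<exists>s\<in>nonzero. \<forall>r\<in>nonzero. h (s \<otimes> r) z = \<zero>\<^bsub>M\<^esub>)" for z
  have killed_generator: "killed z" if z: "z \<in> generators" for z
    using z
  proof (cases rule: generators_cases)
    case (add_left p q x)
    obtain a b s where s: "a \<in> carrier R" "b \<in> carrier R" "s \<in> nonzero" "p = D.Frac a s" "q = D.Frac b s"
      using D.frac_common_denominator[OF add_left(2,3)] by blast
    have pq: "p \<oplus>\<^bsub>Q\<^esub> q = D.Frac (a \<oplus> b) s" unfolding s(4,5) by (rule D.frac_add_same[OF s(1,2,3)])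
    have "h (s \<otimes> r) z = \<zero>\<^bsub>M\<^esub>" if r: "r \<in> nonzero" for r
    proof -
      have sr: "s \<otimes> r \<in> nonzero" by (rule D.mult_denominator[OF s(3) r])
      have "h (s \<otimes> r) z = ((a \<oplus> b) \<otimes> r) \<cdot> x \<ominus>\<^bsub>M\<^esub> (a \<otimes> r) \<cdot> x \<ominus>\<^bsub>M\<^esub> (b \<otimes> r) \<cdot> x"
        unfolding add_left(1) pq using s(1-3) r add_left(2-4) sr
        by (simp add: h_diff keys_diff_subset h_rescale s(4,5))
      also have "\<dots> = \<zero>\<^bsub>M\<^esub>"
        using s(1,2) r add_left(4) M.eq_add_iff_minus_eq[of "((a \<oplus> b) \<otimes> r) \<cdot> x" "(a \<otimes> r) \<cdot> x" "(b \<otimes> r) \<cdot> x"]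
        by (simp add: l_distr smult_l_distr)
      finally show ?thesis .
    qed
    then show ?thesis unfolding killed_def using s(3) by blast
  next
    case (add_right p x x')
    obtain a s where s: "a \<in> carrier R" "s \<in> nonzero" "p = D.Frac a s"
      using D.loc_cases[OF add_right(2)] by blast
    have "h (s \<otimes> r) z = \<zero>\<^bsub>M\<^esub>" if r: "r \<in> nonzero" for r
    proof -
      have sr: "s \<otimes> r \<in> nonzero" by (rule D.mult_denominator[OF s(2) r])
      have "h (s \<otimes> r) z = (a \<otimes> r) \<cdot> (x \<oplus>\<^bsub>M\<^esub> x') \<ominus>\<^bsub>M\<^esub> (a \<otimes> r) \<cdot> x \<ominus>\<^bsub>M\<^esub> (a \<otimes> r) \<cdot> x'"
        unfolding add_right(1) using s(1,2) r add_right(2-4) sr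
        by (simp add: h_diff keys_diff_subset h_rescale s(3))
      also have "\<dots> = \<zero>\<^bsub>M\<^esub>"
        using s(1) r add_right(3,4) M.eq_add_iff_minus_eq[of "(a \<otimes> r) \<cdot> (x \<oplus>\<^bsub>M\<^esub> x')" "(a \<otimes> r) \<cdot> x" "(a \<otimes> r) \<cdot> x'"]
        by (simp add: smult_r_distr)
      finally show ?thesis .
    qed
    then show ?thesis unfolding killed_def using s(2) by blast
  next
    case (balanced c p x)
    obtain a s where s: "a \<in> carrier R" "s \<in> nonzero" "p = D.Frac a s"
      using D.loc_cases[OF balanced(3)] by blast
    have cp: "emb c \<otimes>\<^bsub>Q\<^esub> p = D.Frac (c \<otimes> a) s"
      unfolding s(3) using D.frac_mult[OF balanced(2) D.one_denominator s(1,2)] s(2) by simp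
    have cpS: "D.Frac (c \<otimes> a) s \<in> carrier Q" using s(1,2) balanced(2) by simp
    have "h (s \<otimes> r) z = \<zero>\<^bsub>M\<^esub>" if r: "r \<in> nonzero" for r
    proof -
      have sr: "s \<otimes> r \<in> nonzero" by (rule D.mult_denominator[OF s(2) r])
      have "h (s \<otimes> r) z = ((c \<otimes> a) \<otimes> r) \<cdot> x \<ominus>\<^bsub>M\<^esub> (a \<otimes> r) \<cdot> (c \<cdot> x)"
        unfolding balanced(1) cp using s(1,2) r balanced(2-4) sr cpS
        by (simp add: h_diff h_rescale s(3))
      also have "((c \<otimes> a) \<otimes> r) \<cdot> x = (a \<otimes> r) \<cdot> (c \<cdot> x)"
        using s(1) r balanced(2,4) by (simp add: m_ac flip: smult_assoc1)
      finally show ?thesis using s(1) r balanced(2,4) by (simp add: a_minus_def M.r_neg)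
    qed
    then show ?thesis unfolding killed_def using s(2) by blast
  qed
  have killed_Rel: "killed z \<and> keys z \<subseteq> S" if z: "z \<in> generate Fr generators" for z
    using z
  proof (induction rule: generate.induct)
    case one
    have "h (\<one> \<otimes> r) 0 = \<zero>\<^bsub>M\<^esub>" if "r \<in> nonzero" for r
      using h_zero[OF D.mult_denominator[OF D.one_denominator that]] .
    then have "killed 0" unfolding killed_def by (intro bexI[OF _ D.one_denominator] ballI)
    then show ?case by simp
  next
    case (incl z)
    then have "keys z \<subseteq> S"
      using subsetD[OF generators_carrier incl] by (simp only: carrier_free_Abelian_group_iff)
    then show ?case using killed_generator[OF incl] by simp
  next
    case (inv z)
    have k: "keys z \<subseteq> S" using subsetD[OF generators_carrier inv] by (simp only: carrier_free_Abelian_group_iff)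
    obtain s where s: "s \<in> nonzero" "\<And>r. r \<in> nonzero \<Longrightarrow> h (s \<otimes> r) z = \<zero>\<^bsub>M\<^esub>"
      using killed_generator[OF inv] unfolding killed_def by blast
    have "h (s \<otimes> r) (- z) = \<zero>\<^bsub>M\<^esub>" if r: "r \<in> nonzero" for r
      using h_uminus[OF D.mult_denominator[OF s(1) r] k] s(2)[OF r] by simp
    then show ?case unfolding killed_def using s(1) k by (auto simp del: Diff_iff)
  next
    case (eng z w)
    obtain s where s: "s \<in> nonzero" "\<And>r. r \<in> nonzero \<Longrightarrow> h (s \<otimes> r) z = \<zero>\<^bsub>M\<^esub>"
      using eng(3) unfolding killed_def by blast
    obtain t where t: "t \<in> nonzero" "\<And>r. r \<in> nonzero \<Longrightarrow> h (t \<otimes> r) w = \<zero>\<^bsub>M\<^esub>"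
      using eng(4) unfolding killed_def by blast
    have st: "s \<otimes> t \<in> nonzero" by (rule D.mult_denominator[OF s(1) t(1)])
    have "h (s \<otimes> t \<otimes> r) (z + w) = \<zero>\<^bsub>M\<^esub>" if r: "r \<in> nonzero" for r
    proof -
      have "s \<otimes> t \<otimes> r = s \<otimes> (t \<otimes> r)" "s \<otimes> t \<otimes> r = t \<otimes> (s \<otimes> r)"
        using s(1) t(1) r by (simp_all add: m_ac)
      then have "h (s \<otimes> t \<otimes> r) z = \<zero>\<^bsub>M\<^esub>" "h (s \<otimes> t \<otimes> r) w = \<zero>\<^bsub>M\<^esub>"
        using s(2)[OF D.mult_denominator[OF t(1) r]] t(2)[OF D.mult_denominator[OF s(1) r]] by simp_all
      then show ?thesis
        using h_add[OF D.mult_denominator[OF st r], of z w] eng(3,4) by simp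
    qed
    then have "killed (z + w)" unfolding killed_def using st by blast
    then show ?case using eng(3,4) keys_add_subset[of z S w] by simp
  qed
  have "frag_of (\<one>\<^bsub>Q\<^esub>, y) \<in> Rel"
    using zero unfolding V_zero cls_eq_iff by simp
  then have "frag_of (\<one>\<^bsub>Q\<^esub>, y) \<in> generate Fr generators" by (simp only: Rel_generate)
  then have "killed (frag_of (\<one>\<^bsub>Q\<^esub>, y))" by (rule killed_Rel[THEN conjunct1])
  then obtain s where s: "s \<in> nonzero"
    and kill: "\<And>r. r \<in> nonzero \<Longrightarrow> h (s \<otimes> r) (frag_of (\<one>\<^bsub>Q\<^esub>, y)) = \<zero>\<^bsub>M\<^esub>"
    unfolding killed_def by blast
  have sR: "s \<in> carrier R" "s \<noteq> \<zero>" using s by auto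
  have "\<one>\<^bsub>Q\<^esub> = D.Frac s s"
    unfolding D.loc_one using s D.one_denominator by (subst D.frac_eq_iff) simp_all
  then have "h s (frag_of (\<one>\<^bsub>Q\<^esub>, y)) = s \<cdot> y" using h[OF s sR(1) y] by simp
  then have "s \<cdot> y = \<zero>\<^bsub>M\<^esub>" using kill[OF D.one_denominator] sR(1) by simp
  then show ?thesis using smult_eq_zero[OF _ sR(1) y sR(2)] by blast
qed

text \<open>
  If \<open>1 \<otimes> x = (a / s) \<otimes> b\<close> with \<open>b \<in> B\<close>, then \<open>s x = a b\<close> in \<open>M\<close>, and \<open>x \<in> B\<close> by purity.
\<close>

lemma span_tens_mono_strict:
  assumes B: "pure_submodule R B M" and B': "submodule_of R M B'" and sub: "B \<subset> B'"
  shows "span_tens B \<subset> span_tens B'"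
proof
  show "span_tens B \<subseteq> span_tens B'" unfolding span_tens_def using sub by blast
  note B_sub = submodule_of.N_subset[OF pure_submodule_of[OF B]]
  obtain x where x: "x \<in> B'" "x \<notin> B" using sub by blast
  have xM: "x \<in> carrier M" using x(1) submodule_of.N_subset[OF B'] by blast
  have "tens \<one>\<^bsub>Q\<^esub> x \<notin> span_tens B"
  proof
    assume "tens \<one>\<^bsub>Q\<^esub> x \<in> span_tens B"
    then obtain q b where q: "q \<in> carrier Q" "b \<in> B" "tens \<one>\<^bsub>Q\<^esub> x = tens q b"
      unfolding span_tens_def by blast
    have bM: "b \<in> carrier M" using q(2) B_sub by blast
    obtain a s where s: "a \<in> carrier R" "s \<in> nonzero" "q = D.Frac a s"
      using D.loc_cases[OF q(1)] by blast
    have sR: "s \<in> carrier R" "s \<noteq> \<zero>" using s(2) by auto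
    have sx: "s \<cdot> x \<in> carrier M" and ab: "a \<cdot> b \<in> carrier M" using sR s(1) xM bM by simp_all
    have "emb s \<otimes>\<^bsub>Q\<^esub> q = emb a"
      unfolding s(3) using s(1,2) sR D.one_denominator by (simp add: D.frac_mult D.frac_eq_iff m_comm)
    then have "emb s \<odot>\<^bsub>V\<^esub> tens q b = tens (emb a \<otimes>\<^bsub>Q\<^esub> \<one>\<^bsub>Q\<^esub>) b"
      using tens_smult[OF emb_closed[OF sR(1)] q(1)] emb_closed[OF s(1)] by simp
    also have "\<dots> = tens \<one>\<^bsub>Q\<^esub> (a \<cdot> b)" by (rule tens_balanced[OF s(1) Q.one_closed bM])
    finally have 1: "emb s \<odot>\<^bsub>V\<^esub> tens q b = tens \<one>\<^bsub>Q\<^esub> (a \<cdot> b)" .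
    have 2: "emb s \<odot>\<^bsub>V\<^esub> tens \<one>\<^bsub>Q\<^esub> x = tens \<one>\<^bsub>Q\<^esub> (s \<cdot> x)"
      unfolding tens_smult[OF emb_closed[OF sR(1)] Q.one_closed] by (rule tens_balanced[OF sR(1) Q.one_closed xM])
    have eq: "tens \<one>\<^bsub>Q\<^esub> (s \<cdot> x) = tens \<one>\<^bsub>Q\<^esub> (a \<cdot> b)" using 1 2 q(3) by simp
    define y where "y = s \<cdot> x \<ominus>\<^bsub>M\<^esub> a \<cdot> b"
    have yM: "y \<in> carrier M" using sx ab by (simp add: y_def)
    have "s \<cdot> x = a \<cdot> b \<oplus>\<^bsub>M\<^esub> y"
      using M.eq_add_iff_minus_eq[OF sx ab yM] by (simp add: y_def)
    then have "cls (frag_of (\<one>\<^bsub>Q\<^esub>, a \<cdot> b) + frag_of (\<one>\<^bsub>Q\<^esub>, y)) = tens \<one>\<^bsub>Q\<^esub> (a \<cdot> b)"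
      using tens_add_right[OF Q.one_closed ab yM] eq by (simp only: V_add)
    then have "tens \<one>\<^bsub>Q\<^esub> y = \<zero>\<^bsub>V\<^esub>" unfolding V_zero cls_eq_iff by simp
    then have "y = \<zero>\<^bsub>M\<^esub>" by (rule tens_one_eq_zero[OF yM])
    then have "s \<cdot> x = a \<cdot> b" using \<open>s \<cdot> x = a \<cdot> b \<oplus>\<^bsub>M\<^esub> y\<close> ab by simp
    then have "s \<cdot> x \<in> B"
      using submodule_of.N_smult[OF pure_submodule_of[OF B] s(1) q(2)] by simp
    then show False using pureD[OF B _ sR xM] x(2) by blast
  qed
  moreover have "tens \<one>\<^bsub>Q\<^esub> x \<in> span_tens B'" unfolding span_tens_def using x(1) Q.one_closed by blast
  ultimately show "span_tens B \<noteq> span_tens B'" by blast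
qed

lemma finite_rank_bounds_pure_chains:
  assumes "finite_rank R M"
  shows "\<exists>d. \<forall>n C. pure_chain R M n C \<longrightarrow> n \<le> d"
proof -
  interpret V: vectorspace Q V by (rule V_vectorspace)
  have emb: "to_fraction_field R = (\<lambda>r. emb r)" by (rule ext) (simp add: to_fraction_field_def)
  have fin: "V.fin_dim"
    using assms by (simp add: finite_rank_def emb fraction_field_def)
  have "n \<le> V.dim" if C: "pure_chain R M n C" for n C
  proof (rule V.chain_of_subspaces_le_dim[OF fin, of n "\<lambda>i. span_tens (C i)"])
    fix i assume "i \<le> n"
    then show "LinearCombinations.submodule Q (span_tens (C i)) V"
      using C unfolding pure_chain_def by (intro span_tens_submodule pure_submodule_of) blast
  next
    fix i assume "i < n"
    then have "pure_submodule R (C i) M" "pure_submodule R (C (Suc i)) M" "C i \<subset> C (Suc i)"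
      using C unfolding pure_chain_def by auto
    then show "span_tens (C i) \<subset> span_tens (C (Suc i))"
      by (intro span_tens_mono_strict pure_submodule_of)
  qed
  then show ?thesis by blast
qed

end

section \<open>Pulling submodules back from quotients\<close>

locale pure_quotient = tf_module +
  fixes N
  assumes pure: "pure_submodule R N M"
begin

sublocale submodule_of R M N
  by (rule pure_submodule_of[OF pure])

lemma quot_tf_module: "tf_module R quot"
proof (intro tf_module.intro tf_module_axioms.intro valuation_ring_axioms quot_module)
  show "Defs.torsion_free R quot"
    unfolding torsion_free_def
  proof (intro ballI impI)
    fix r X assume r: "r \<in> carrier R" and X: "X \<in> carrier quot" and eq: "r \<odot>\<^bsub>quot\<^esub> X = \<zero>\<^bsub>quot\<^esub>"
    obtain x where x: "x \<in> carrier M" "X = coset x" using X by (rule quot_cases)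
    have rx: "r \<cdot> x \<in> carrier M" using r x(1) by simp
    have "coset (r \<cdot> x) = N" using eq unfolding x(2) quot_smult[OF r x(1)] quot_zero .
    then have "r \<cdot> x \<in> N" using coset_eq_N_iff[OF rx] by blast
    then have "r = \<zero> \<or> x \<in> N" using pureD[OF pure _ r _ x(1)] by blast
    then show "r = \<zero> \<or> X = \<zero>\<^bsub>quot\<^esub>" unfolding x(2) quot_zero using coset_eq_N_iff[OF x(1)] by blast
  qed
qed

lemma quot_divisible_outside:
  assumes "\<And>s x. \<lbrakk>s \<in> carrier R - L; x \<in> carrier M\<rbrakk> \<Longrightarrow>
    \<exists>y\<in>carrier M. \<exists>b\<in>N. x = s \<cdot> y \<oplus>\<^bsub>M\<^esub> b"
  shows "divisible_outside R L quot"
  unfolding divisible_outside_def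
proof (intro ballI)
  fix s X assume s: "s \<in> carrier R - L" and X: "X \<in> carrier quot"
  obtain x where x: "x \<in> carrier M" "X = coset x" using X by (rule quot_cases)
  obtain y b where y: "y \<in> carrier M" "b \<in> N" "x = s \<cdot> y \<oplus>\<^bsub>M\<^esub> b" using assms[OF s x(1)] by blast
  have sR: "s \<in> carrier R" using s by simp
  have sy: "s \<cdot> y \<in> carrier M" using sR y(1) by simp
  have bM: "b \<in> carrier M" using y(2) by simp
  have "x \<ominus>\<^bsub>M\<^esub> s \<cdot> y = b" using M.eq_add_iff_minus_eq[OF x(1) sy bM] y(3) by blast
  then have "X = s \<odot>\<^bsub>quot\<^esub> coset y"
    unfolding x(2) quot_smult[OF sR y(1)] coset_eq_iff[OF x(1) sy] using y(2) by simp
  then show "\<exists>Y\<in>carrier quot. X = s \<odot>\<^bsub>quot\<^esub> Y" using coset_closed[OF y(1)] by blast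
qed

definition pullback where
  "pullback B = {x \<in> carrier M. coset x \<in> B}"

lemma pure_pullback:
  assumes B: "pure_submodule R B quot"
  shows "pure_submodule R (pullback B) M"
proof -
  interpret q: tf_module R quot by (rule quot_tf_module)
  have subB: "submodule_of R quot B" by (rule q.pure_submodule_of[OF B])
  have "submodule_of R M (pullback B)"
  proof (rule submodule_ofI)
    show "pullback B \<subseteq> carrier M" by (auto simp: pullback_def)
    have "coset \<zero>\<^bsub>M\<^esub> = \<zero>\<^bsub>quot\<^esub>" unfolding quot_zero by (simp add: coset_eq_N_iff)
    then show "\<zero>\<^bsub>M\<^esub> \<in> pullback B" using submodule_of.N_zero[OF subB] by (simp add: pullback_def)
    show "x \<oplus>\<^bsub>M\<^esub> y \<in> pullback B" if "x \<in> pullback B" "y \<in> pullback B" for x y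
      using that submodule_of.N_add[OF subB, of "coset x" "coset y"] quot_add[of x y]
      by (simp add: pullback_def)
    show "r \<cdot> x \<in> pullback B" if "r \<in> carrier R" "x \<in> pullback B" for r x
      using that submodule_of.N_smult[OF subB, of r "coset x"] quot_smult[of r x]
      by (simp add: pullback_def)
  qed
  moreover have "y \<in> pullback B"
    if r: "r \<in> carrier R" "r \<noteq> \<zero>" and y: "y \<in> carrier M" "r \<cdot> y \<in> pullback B" for r y
  proof -
    have "r \<odot>\<^bsub>quot\<^esub> coset y \<in> B" using y(2) quot_smult[OF r(1) y(1)] by (simp add: pullback_def)
    then have "coset y \<in> B" by (rule q.pureD[OF B _ r coset_closed[OF y(1)]])
    then show ?thesis using y(1) by (simp add: pullback_def)
  qed
  ultimately show ?thesis
    unfolding pure_submodule_iff submodule_of_def submodule_of_axioms_def by blast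
qed

lemma subset_pullback:
  assumes B: "pure_submodule R B quot"
  shows "N \<subseteq> pullback B"
proof
  interpret q: tf_module R quot by (rule quot_tf_module)
  fix x assume x: "x \<in> N"
  then have "coset x = \<zero>\<^bsub>quot\<^esub>" unfolding quot_zero by (simp add: coset_eq_N_iff)
  then show "x \<in> pullback B"
    using submodule_of.N_zero[OF q.pure_submodule_of[OF B]] x by (simp add: pullback_def)
qed

lemma coset_image_pullback:
  assumes "B \<subseteq> carrier quot"
  shows "coset ` pullback B = B"
proof
  show "coset ` pullback B \<subseteq> B" by (auto simp: pullback_def)
  show "B \<subseteq> coset ` pullback B"
  proof
    fix X assume X: "X \<in> B"
    then obtain x where x: "x \<in> carrier M" "X = coset x" using assms quot_cases by blast
    then have "x \<in> pullback B" using X by (simp add: pullback_def)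
    then show "X \<in> coset ` pullback B" using x(2) by blast
  qed
qed

lemma pullback_strict_mono:
  assumes "B \<subset> B'" "B' \<subseteq> carrier quot"
  shows "pullback B \<subset> pullback B'"
proof
  show "pullback B \<subseteq> pullback B'" using assms(1) by (auto simp: pullback_def)
  have B: "B \<subseteq> carrier quot" using assms by blast
  have "B = B'" if eq: "pullback B = pullback B'"
    by (rule trans[OF coset_image_pullback[OF B, symmetric]])
      (unfold eq, rule coset_image_pullback[OF assms(2)])
  then show "pullback B \<noteq> pullback B'" using assms(1) by blast
qed

lemma pure_chain_pullback:
  assumes "pure_chain R quot n C"
  shows "pure_chain R M n (\<lambda>i. pullback (C i))"
proof -
  interpret q: tf_module R quot by (rule quot_tf_module)
  have "C i \<subseteq> carrier quot" if "i \<le> n" for i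
    using assms that submodule_of.N_subset[OF q.pure_submodule_of] unfolding pure_chain_def by blast
  then show ?thesis
    using assms pure_pullback pullback_strict_mono unfolding pure_chain_def by (metis Suc_leI)
qed

text \<open>
  An equality, not just an isomorphism: both sides consist of the same cosets, and the operations
  of a quotient do not mention the carrier.
\<close>

lemma quotient_pullback:
  assumes "B \<subseteq> carrier quot"
  shows "quotient_module (M\<lparr>carrier := pullback B\<rparr>) N = quot\<lparr>carrier := B\<rparr>"
proof -
  have r_coset: "N +>\<^bsub>M\<lparr>carrier := pullback B\<rparr>\<^esub> x = coset x" for x
    by (simp add: a_r_coset_def')
  have "a_rcosets\<^bsub>M\<lparr>carrier := pullback B\<rparr>\<^esub> N = coset ` pullback B"
    by (auto simp: A_RCOSETS_def' r_coset)
  moreover have "set_add (M\<lparr>carrier := pullback B\<rparr>) = set_add M"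
    by (intro ext) (simp add: set_add_def set_mult_def)
  ultimately show ?thesis
    unfolding coset_image_pullback[OF assms] by (simp add: quotient_module_def r_coset)
qed

lemma divisible_modulo_pullback:
  assumes "\<And>X. X \<in> carrier quot \<Longrightarrow> \<exists>Y\<in>carrier quot. \<exists>b\<in>B. X = s \<odot>\<^bsub>quot\<^esub> Y \<oplus>\<^bsub>quot\<^esub> b"
    and B: "B \<subseteq> carrier quot" and s: "s \<in> carrier R" and x: "x \<in> carrier M"
  shows "\<exists>y\<in>carrier M. \<exists>b\<in>pullback B. x = s \<cdot> y \<oplus>\<^bsub>M\<^esub> b"
proof -
  interpret q: tf_module R quot by (rule quot_tf_module)
  obtain Y b where Y: "Y \<in> carrier quot" "b \<in> B" "coset x = s \<odot>\<^bsub>quot\<^esub> Y \<oplus>\<^bsub>quot\<^esub> b"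
    using assms(1)[OF coset_closed[OF x]] by blast
  obtain y where y: "y \<in> carrier M" "Y = coset y" using Y(1) by (rule quot_cases)
  have sy: "s \<cdot> y \<in> carrier M" using s y(1) by simp
  define z where "z = x \<ominus>\<^bsub>M\<^esub> s \<cdot> y"
  have z: "z \<in> carrier M" using x sy by (simp add: z_def)
  have x_eq: "x = s \<cdot> y \<oplus>\<^bsub>M\<^esub> z" using M.eq_add_iff_minus_eq[OF x sy z] by (simp add: z_def)
  obtain w where w: "w \<in> carrier M" "b = coset w" using B Y(2) quot_cases by blast
  have "coset (s \<cdot> y \<oplus>\<^bsub>M\<^esub> z) = coset (s \<cdot> y \<oplus>\<^bsub>M\<^esub> w)"
    using Y(3) unfolding y(2) w(2) quot_smult[OF s y(1)] quot_add[OF sy w(1)] x_eq[symmetric] .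
  then have "z \<ominus>\<^bsub>M\<^esub> w \<in> N"
    using sy z w(1) by (simp add: coset_eq_iff M.add_diff_cancel_left)
  then have "coset z = b" unfolding w(2) coset_eq_iff[OF z w(1)] .
  then have "z \<in> pullback B" using z Y(2) by (simp add: pullback_def)
  then show ?thesis using x_eq y(1) by blast
qed

end

section \<open>The pure-composition series\<close>

lemma (in valuation_ring) unit_outside_maximal:
  assumes P: "maximalideal P R" and s: "s \<in> carrier R" "s \<notin> P"
  shows "\<exists>t\<in>carrier R. s \<otimes> t = \<one>"
proof -
  have P_ideal: "ideal P R" using P by (simp add: maximalideal_def)
  have s_mem: "s \<in> PIdl s" by (rule cgenideal_self[OF s(1)])
  have "P \<subseteq> PIdl s"
  proof
    fix p assume p: "p \<in> P"
    have "s \<noteq> p \<otimes> c" if "c \<in> carrier R" for c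
      using s(2) ideal.I_r_closed[OF P_ideal p that] by blast
    then obtain c where "c \<in> carrier R" "p = s \<otimes> c"
      using divides_total[OF s(1) ideal.Icarr[OF P_ideal p]] by blast
    then show "p \<in> PIdl s" unfolding cgenideal_def using s(1) by (auto simp: m_comm)
  qed
  moreover have "PIdl s \<subseteq> carrier R" using ideal.Icarr[OF cgenideal_ideal[OF s(1)]] by blast
  ultimately have "PIdl s = P \<or> PIdl s = carrier R"
    using maximalideal.I_maximal[OF P cgenideal_ideal[OF s(1)]] by blast
  then have "\<one> \<in> PIdl s" using s_mem s(2) one_closed by blast
  then show ?thesis unfolding cgenideal_def using s(1) m_comm by force
qed

theorem proposition2p5:
  fixes R :: "('a, 'r) ring_scheme"
    and P :: "'a set"
    and m :: nat
    and L :: "nat \<Rightarrow> 'a set"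
    and G :: "('a, 'b, 'c) module_scheme"
  assumes valuation: "valuation_domain R"
    and maximal: "maximalideal P R"
    and prime: "\<And>k. k \<le> m \<Longrightarrow> primeideal (L k) R"
    and L_first: "L 0 = P"
    and L_last: "L m = {\<zero>\<^bsub>R\<^esub>}"
    and L_strict: "\<And>k. k < m \<Longrightarrow> L (k + 1) \<subset> L k"
    and almost_max: "\<And>k. k < m \<Longrightarrow> almost_maximal (localization_quotient R (L k) (L (k + 1)))"
    and module: "module R G"
    and torsion_free: "torsion_free R G"
    and finite_rank: "finite_rank R G"
  shows "\<exists>H :: nat \<Rightarrow> 'b set.
    H 0 = {\<zero>\<^bsub>G\<^esub>} \<and>
    H (m + 1) = carrier G \<and>
    (\<forall>j\<le>m + 1. pure_submodule R (H j) G) \<and>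
    (\<forall>j\<le>m. H j \<subseteq> H (j + 1)) \<and>
    (\<forall>j\<le>m. sum_of_ideals_of_localization R (L j)
       (quotient_module (G\<lparr>carrier := H (j + 1)\<rparr>) (H j)))"
proof -
  interpret G: tf_module R G
    by (intro tf_module.intro tf_module_axioms.intro module torsion_free
        valuation_domain_imp_valuation_ring[OF valuation])
  obtain d where d: "\<And>n C. pure_chain R G n C \<Longrightarrow> n \<le> d"
  proof -
    interpret base_change_to_fractions R G by unfold_locales
    show ?thesis using that finite_rank_bounds_pure_chains[OF finite_rank] by blast
  qed
  have quotient: "divisible_tf_module R (quotient_module G N) (L j)"
    if N: "pure_submodule R N G" and j: "j \<le> m"
      and div: "\<And>s x. \<lbrakk>s \<in> carrier R - L j; x \<in> carrier G\<rbrakk> \<Longrightarrow>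
        \<exists>y\<in>carrier G. \<exists>b\<in>N. x = s \<odot>\<^bsub>G\<^esub> y \<oplus>\<^bsub>G\<^esub> b" for N j
  proof -
    interpret pure_quotient R G N by unfold_locales (rule N)
    show ?thesis
      by (intro divisible_tf_module.intro divisible_tf_module_axioms.intro quot_tf_module prime[OF j]
          quot_divisible_outside div)
  qed
  have bound: "n \<le> d" if N: "pure_submodule R N G" and C: "pure_chain R (quotient_module G N) n C" for N n C
  proof -
    interpret pure_quotient R G N by unfold_locales (rule N)
    show ?thesis by (rule d[OF pure_chain_pullback[OF C]])
  qed
  \<comment> \<open>The series up to index \<open>j\<close>, together with the divisibility of \<open>G / H j\<close> outside \<open>L j\<close> that
    lets it continue.\<close>
  define series where "series j H \<longleftrightarrow>
      H 0 = {\<zero>\<^bsub>G\<^esub>} \<and> (\<forall>i\<le>j. pure_submodule R (H i) G) \<and> (\<forall>i<j. H i \<subseteq> H (Suc i)) \<and>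
      (\<forall>i<j. sum_of_ideals_of_localization R (L i) (quotient_module (G\<lparr>carrier := H (Suc i)\<rparr>) (H i))) \<and>
      (\<forall>s\<in>carrier R - L j. \<forall>x\<in>carrier G. \<exists>y\<in>carrier G. \<exists>b\<in>H j. x = s \<odot>\<^bsub>G\<^esub> y \<oplus>\<^bsub>G\<^esub> b)" for j H
  have "\<exists>H. series j H" if "j \<le> m" for j
    using that
  proof (induction j)
    case 0
    have "\<exists>y\<in>carrier G. \<exists>b\<in>{\<zero>\<^bsub>G\<^esub>}. x = s \<odot>\<^bsub>G\<^esub> y \<oplus>\<^bsub>G\<^esub> b"
      if s: "s \<in> carrier R - L 0" and x: "x \<in> carrier G" for s x
    proof -
      have sR: "s \<in> carrier R" "s \<notin> P" using s L_first by auto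
      obtain t where t: "t \<in> carrier R" "s \<otimes>\<^bsub>R\<^esub> t = \<one>\<^bsub>R\<^esub>"
        using G.unit_outside_maximal[OF maximal sR] by blast
      have "x = s \<odot>\<^bsub>G\<^esub> (t \<odot>\<^bsub>G\<^esub> x)" using t sR(1) x by (simp flip: G.smult_assoc1)
      then have "x = s \<odot>\<^bsub>G\<^esub> (t \<odot>\<^bsub>G\<^esub> x) \<oplus>\<^bsub>G\<^esub> \<zero>\<^bsub>G\<^esub>" using t(1) sR(1) x by simp
      then show ?thesis using G.smult_closed[OF t(1) x] by blast
    qed
    then show ?case unfolding series_def using G.pure_zero by (intro exI[of _ "\<lambda>_. {\<zero>\<^bsub>G\<^esub>}"]) simp
  next
    case (Suc j)
    then have j: "j \<le> m" "j < m" by auto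
    obtain H where H: "series j H" using Suc.IH[OF j(1)] by blast
    have H0: "H 0 = {\<zero>\<^bsub>G\<^esub>}" and pure: "\<And>i. i \<le> j \<Longrightarrow> pure_submodule R (H i) G"
      and mono: "\<And>i. i < j \<Longrightarrow> H i \<subseteq> H (Suc i)"
      and sums: "\<And>i. i < j \<Longrightarrow>
        sum_of_ideals_of_localization R (L i) (quotient_module (G\<lparr>carrier := H (Suc i)\<rparr>) (H i))"
      and div: "\<And>s x. \<lbrakk>s \<in> carrier R - L j; x \<in> carrier G\<rbrakk> \<Longrightarrow>
        \<exists>y\<in>carrier G. \<exists>b\<in>H j. x = s \<odot>\<^bsub>G\<^esub> y \<oplus>\<^bsub>G\<^esub> b"
      using H unfolding series_def by simp_all
    note pure_j = pure[OF order_refl]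
    interpret N: pure_quotient R G "H j" by unfold_locales (rule pure_j)
    interpret q: divisible_tf_module R N.quot "L j" by (rule quotient[OF pure_j j(1) div])
    obtain B n where B: "pure_submodule R B N.quot" "ideal_sum_iso R (L j) n (N.quot\<lparr>carrier := B\<rparr>)"
      and B_div: "\<forall>s\<in>carrier R - L (Suc j). \<forall>X\<in>carrier N.quot. \<exists>Y\<in>carrier N.quot. \<exists>b\<in>B.
        X = s \<odot>\<^bsub>N.quot\<^esub> Y \<oplus>\<^bsub>N.quot\<^esub> b"
    proof -
      have L_next: "L (Suc j) \<subseteq> L j" "almost_maximal (localization_quotient R (L j) (L (Suc j)))"
        using L_strict[OF j(2)] almost_max[OF j(2)] by auto
      have "\<exists>B n. pure_submodule R B N.quot \<and> ideal_sum_iso R (L j) n (N.quot\<lparr>carrier := B\<rparr>) \<and>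
        (\<forall>s\<in>carrier R - L (Suc j). \<forall>X\<in>carrier N.quot. \<exists>Y\<in>carrier N.quot. \<exists>b\<in>B.
          X = s \<odot>\<^bsub>N.quot\<^esub> Y \<oplus>\<^bsub>N.quot\<^esub> b)"
        by (rule q.basic_submodule[where d = d, OF _ prime[OF Suc.prems] L_next]) (rule bound[OF pure_j])
      then show ?thesis using that by blast
    qed
    have B_sub: "B \<subseteq> carrier N.quot" by (rule submodule_of.N_subset[OF q.pure_submodule_of[OF B(1)]])
    define H' where "H' = H(Suc j := N.pullback B)"
    have H'_old: "H' i = H i" if "i \<le> j" for i using that by (simp add: H'_def)
    have H'_new: "H' (Suc j) = N.pullback B" by (simp add: H'_def)
    have "pure_submodule R (H' i) G" if "i \<le> Suc j" for i
      using that pure[of i] N.pure_pullback[OF B(1)] by (auto simp: H'_def)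
    moreover have "H' i \<subseteq> H' (Suc i)" if "i < Suc j" for i
    proof (cases "i = j")
      case True
      then show ?thesis using N.subset_pullback[OF B(1)] H'_old[of j] H'_new by simp
    next
      case False
      then show ?thesis using mono[of i] H'_old[of i] H'_old[of "Suc i"] that by simp
    qed
    moreover have "sum_of_ideals_of_localization R (L i) (quotient_module (G\<lparr>carrier := H' (Suc i)\<rparr>) (H' i))"
      if "i < Suc j" for i
    proof (cases "i = j")
      case True
      have "sum_of_ideals_of_localization R (L j) (N.quot\<lparr>carrier := B\<rparr>)"
        using B(2) unfolding sum_of_ideals_of_localization_def ideal_sum_iso_def by blast
      then show ?thesis using N.quotient_pullback[OF B_sub] H'_old[of j] H'_new True by simp
    next
      case False
      then show ?thesis using sums[of i] H'_old[of i] H'_old[of "Suc i"] that by simp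
    qed
    moreover have "\<exists>y\<in>carrier G. \<exists>b\<in>H' (Suc j). x = s \<odot>\<^bsub>G\<^esub> y \<oplus>\<^bsub>G\<^esub> b"
      if s: "s \<in> carrier R - L (Suc j)" and x: "x \<in> carrier G" for s x
      unfolding H'_new
      by (rule N.divisible_modulo_pullback[OF _ B_sub _ x]) (use B_div s in auto)
    ultimately show ?case unfolding series_def using H0 H'_old[of 0] by (intro exI[of _ H']) simp
  qed
  then obtain H where H: "series m H" by blast
  have H0: "H 0 = {\<zero>\<^bsub>G\<^esub>}" and pure: "\<And>i. i \<le> m \<Longrightarrow> pure_submodule R (H i) G"
    and mono: "\<And>i. i < m \<Longrightarrow> H i \<subseteq> H (Suc i)"
    and sums: "\<And>i. i < m \<Longrightarrow>
      sum_of_ideals_of_localization R (L i) (quotient_module (G\<lparr>carrier := H (Suc i)\<rparr>) (H i))"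
    and div: "\<And>s x. \<lbrakk>s \<in> carrier R - L m; x \<in> carrier G\<rbrakk> \<Longrightarrow>
      \<exists>y\<in>carrier G. \<exists>b\<in>H m. x = s \<odot>\<^bsub>G\<^esub> y \<oplus>\<^bsub>G\<^esub> b"
    using H unfolding series_def by simp_all
  note pure_m = pure[OF order_refl]
  interpret q: divisible_tf_module R "quotient_module G (H m)" "L m"
    by (rule quotient[OF pure_m order_refl div])
  obtain n where n: "ideal_sum_iso R (L m) n (quotient_module G (H m))"
  proof -
    have "\<exists>n. ideal_sum_iso R (L m) n (quotient_module G (H m))"
      by (rule q.divisible_imp_sum_of_ideals[where d = d, OF _ L_last]) (rule bound[OF pure_m])
    then show ?thesis using that by blast
  qed
  have GG: "G\<lparr>carrier := carrier G\<rparr> = G" by (cases G) simp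
  have top: "sum_of_ideals_of_localization R (L m) (quotient_module (G\<lparr>carrier := carrier G\<rparr>) (H m))"
    unfolding GG using n unfolding sum_of_ideals_of_localization_def ideal_sum_iso_def by blast
  have pure_G: "pure_submodule R (carrier G) G"
    unfolding G.pure_submodule_iff LinearCombinations.submodule_def using module by simp
  have Hm: "H m \<subseteq> carrier G" by (rule submodule_of.N_subset[OF G.pure_submodule_of[OF pure_m]])
  define H' where "H' = H(Suc m := carrier G)"
  show ?thesis
  proof (intro exI[of _ H'] conjI allI impI)
    show "H' 0 = {\<zero>\<^bsub>G\<^esub>}" "H' (m + 1) = carrier G" using H0 by (simp_all add: H'_def)
    show "pure_submodule R (H' j) G" if "j \<le> m + 1" for j
      using that pure[of j] pure_G by (auto simp: H'_def)
    show "H' j \<subseteq> H' (j + 1)" if "j \<le> m" for j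
      using that mono[of j] Hm by (auto simp: H'_def)
    show "sum_of_ideals_of_localization R (L j) (quotient_module (G\<lparr>carrier := H' (j + 1)\<rparr>) (H' j))"
      if "j \<le> m" for j
      using that sums[of j] top by (cases "j = m") (simp_all add: H'_def)
  qed
qed

end
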